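(* There exist constants $c>0$ and $C>0$ such that for every odd $n$: $L(P_n)\ge c\log n$ and $L(P_n)\le C\log^2 n$; and for every odd $n\ge 3$: $L(C_n)\ge c\log n$ and $L(C_n)\le C\log^2 n$. That is, for odd $n$, $L(P_n)=\Omega(\log n)$, $L(C_n)=\Omega(\log n)$, $L(P_n)=O(\log^2 n)$, $L(C_n)=O(\log^2 n)$.
   Context: $P_n$ denotes the path with $n$ edges and $C_n$ the cycle with $n$ edges; $\log$ is base 2. For a finite simple graph $G$ with $m$ edges, the symmetry breaking-preserving game on $G$ is played by $\mathcal{A}$ and $\mathcal{B}$ who alternately color previously uncolored edges of $G$, $\mathcal{A}$ in red and $\mathcal{B}$ in blue, one edge per move, $\mathcal{A}$ moving first; round $i$ consists of $\mathcal{A}$'s $i$-th move (edge $a_i$) followed by $\mathcal{B}$'s $i$-th move (edge $b_i$). Let $A_i=\{a_1,\dots,a_i\}$, $B_i=\{b_1,\dots,b_i\}$ as subgraphs of $G$. A strategy of $\mathcal{A}$ is a function $S_1$ with $a_i=S_1(b_1,\dots,b_{i-1})$, a strategy of $\mathcal{B}$ is a function $S_2$ with $b_i=S_2(a_1,\dots,a_i)$, both always choosing uncolored edges. $l(S_1,S_2)$ is the maximum $l\le\lfloor m/2\rfloor$ such that $A_i\cong B_i$ for all $i\le l$ in the resulting play, and $L(G)=\max_{S_2}\min_{S_1} l(S_1,S_2)$. *)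

theory Defs
  imports Complex_Main
begin

text \<open>
  A finite simple graph is given by its vertex set and its set of edges, an edge being the
  two-element set of its end vertices.
\<close>

record 'a graph =
  verts :: "'a set"
  edges :: "'a set set"

definition finite_simple_graph :: "'a graph \<Rightarrow> bool" where
  "finite_simple_graph G \<longleftrightarrow>
     finite (verts G) \<and> (\<forall>e\<in>edges G. e \<subseteq> verts G \<and> card e = 2)"

definition graph_iso :: "'a graph \<Rightarrow> 'b graph \<Rightarrow> bool" where
  "graph_iso G H \<longleftrightarrow>
     (\<exists>f. bij_betw f (verts G) (verts H) \<and>
          (\<forall>u\<in>verts G. \<forall>v\<in>verts G. {u, v} \<in> edges G \<longleftrightarrow> {f u, f v} \<in> edges H))"

text \<open>
  The subgraph formed by a set of edges: its vertices are the end vertices of these edges.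
\<close>

definition edge_subgraph :: "'a set set \<Rightarrow> 'a graph" where
  "edge_subgraph F = \<lparr>verts = \<Union>F, edges = F\<rparr>"

text \<open>The indices count edges: the path on \<open>n + 1\<close> vertices and the cycle on \<open>n\<close> vertices.\<close>

definition path_graph :: "nat \<Rightarrow> nat graph" where
  "path_graph n = \<lparr>verts = {..n}, edges = {{i, Suc i} | i. i < n}\<rparr>"

definition cycle_graph :: "nat \<Rightarrow> nat graph" where
  "cycle_graph n = \<lparr>verts = {..<n}, edges = {{i, Suc i mod n} | i. i < n}\<rparr>"

lemma finite_simple_path_graph: "finite_simple_graph (path_graph n)"
  by (auto simp: finite_simple_graph_def path_graph_def)

lemma card_edges_path_graph: "card (edges (path_graph n)) = n"
proof -
  have "edges (path_graph n) = (\<lambda>i. {i, Suc i}) ` {..<n}"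
    by (auto simp: path_graph_def)
  moreover have "inj_on (\<lambda>i. {i, Suc i}) {..<n}"
    by (auto simp: inj_on_def doubleton_eq_iff)
  ultimately show ?thesis by (simp add: card_image)
qed

lemma finite_simple_cycle_graph: "n \<ge> 3 \<Longrightarrow> finite_simple_graph (cycle_graph n)"
  by (auto simp: finite_simple_graph_def cycle_graph_def mod_Suc)

lemma card_edges_cycle_graph:
  assumes "n \<ge> 3"
  shows "card (edges (cycle_graph n)) = n"
proof -
  have "edges (cycle_graph n) = (\<lambda>i. {i, Suc i mod n}) ` {..<n}"
    by (auto simp: cycle_graph_def)
  moreover have "inj_on (\<lambda>i. {i, Suc i mod n}) {..<n}"
    using assms by (auto simp: inj_on_def doubleton_eq_iff mod_Suc split: if_splits)
  ultimately show ?thesis by (simp add: card_image)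
qed

text \<open>
  A strategy of either player maps the list of the opponent's moves so far, oldest first, to an
  edge.  The moves that a strategy has already made along such a list are determined by it:
  with \<open>k = length bs\<close>, the first player has answered \<open>bs\<close> by
  \<open>S1 (take 0 bs), \<dots>, S1 (take (k - 1) bs)\<close> before making the move \<open>S1 bs\<close>; with
  \<open>k = length as\<close>, the second player has answered \<open>as\<close> by
  \<open>S2 (take 1 as), \<dots>, S2 (take (k - 1) as)\<close> before making the move \<open>S2 as\<close>.
\<close>

type_synonym 'a strategy = "'a set list \<Rightarrow> 'a set"

definition uncolored_A :: "'a graph \<Rightarrow> 'a strategy \<Rightarrow> 'a set list \<Rightarrow> 'a set set" where
  "uncolored_A G S1 bs = edges G - set bs - (\<lambda>i. S1 (take i bs)) ` {..<length bs}"

definition uncolored_B :: "'a graph \<Rightarrow> 'a strategy \<Rightarrow> 'a set list \<Rightarrow> 'a set set" where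
  "uncolored_B G S2 as = edges G - set as - (\<lambda>i. S2 (take i as)) ` {1..<length as}"

text \<open>
  The lists of opponent's moves that can occur against a given strategy: every move of the
  opponent was an uncolored edge when it was made.
\<close>

definition history_A :: "'a graph \<Rightarrow> 'a strategy \<Rightarrow> 'a set list \<Rightarrow> bool" where
  "history_A G S1 bs \<longleftrightarrow>
     (\<forall>j<length bs. bs ! j \<in> edges G - set (take j bs) - (\<lambda>i. S1 (take i bs)) ` {..j})"

definition history_B :: "'a graph \<Rightarrow> 'a strategy \<Rightarrow> 'a set list \<Rightarrow> bool" where
  "history_B G S2 as \<longleftrightarrow>
     (\<forall>j<length as. as ! j \<in> edges G - set (take j as) - (\<lambda>i. S2 (take i as)) ` {1..j})"

text \<open>
  The value of a strategy is constrained only at histories that can occur and leave an uncolored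
  edge; its other values never influence the first \<open>\<lfloor>m/2\<rfloor>\<close> rounds of a play.
\<close>

definition strategy_A :: "'a graph \<Rightarrow> 'a strategy \<Rightarrow> bool" where
  "strategy_A G S1 \<longleftrightarrow>
     (\<forall>bs. history_A G S1 bs \<and> uncolored_A G S1 bs \<noteq> {} \<longrightarrow> S1 bs \<in> uncolored_A G S1 bs)"

definition strategy_B :: "'a graph \<Rightarrow> 'a strategy \<Rightarrow> bool" where
  "strategy_B G S2 \<longleftrightarrow>
     (\<forall>as. as \<noteq> [] \<and> history_B G S2 as \<and> uncolored_B G S2 as \<noteq> {} \<longrightarrow>
           S2 as \<in> uncolored_B G S2 as)"

text \<open>The lists \<open>[a\<^sub>1, \<dots>, a\<^sub>i]\<close> and \<open>[b\<^sub>1, \<dots>, b\<^sub>i]\<close> after \<open>i\<close> rounds.\<close>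

primrec play :: "'a strategy \<Rightarrow> 'a strategy \<Rightarrow> nat \<Rightarrow> 'a set list \<times> 'a set list" where
  "play S1 S2 0 = ([], [])"
| "play S1 S2 (Suc i) =
     (let (as, bs) = play S1 S2 i; as' = as @ [S1 bs] in (as', bs @ [S2 as']))"

definition edges_A :: "'a strategy \<Rightarrow> 'a strategy \<Rightarrow> nat \<Rightarrow> 'a set set" where
  "edges_A S1 S2 i = set (fst (play S1 S2 i))"

definition edges_B :: "'a strategy \<Rightarrow> 'a strategy \<Rightarrow> nat \<Rightarrow> 'a set set" where
  "edges_B S1 S2 i = set (snd (play S1 S2 i))"

definition preserved_rounds :: "'a graph \<Rightarrow> 'a strategy \<Rightarrow> 'a strategy \<Rightarrow> nat" where
  "preserved_rounds G S1 S2 =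
     Max {l. l \<le> card (edges G) div 2 \<and>
             (\<forall>i\<le>l. graph_iso (edge_subgraph (edges_A S1 S2 i)) (edge_subgraph (edges_B S1 S2 i)))}"

definition game_length :: "'a graph \<Rightarrow> nat" where
  "game_length G =
     Max ((\<lambda>S2. Min ((\<lambda>S1. preserved_rounds G S1 S2) ` {S1. strategy_A G S1}))
          ` {S2. strategy_B G S2})"

text \<open>
  The sets whose \<open>Max\<close> and \<open>Min\<close> are taken above are finite and nonempty.
\<close>

lemma preserved_rounds_le: "preserved_rounds G S1 S2 \<le> card (edges G) div 2"
proof -
  have "graph_iso (edge_subgraph (edges_A S1 S2 0)) (edge_subgraph (edges_B S1 S2 0))"
    by (auto simp: graph_iso_def edge_subgraph_def edges_A_def edges_B_def bij_betw_def)
  then show ?thesis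
    unfolding preserved_rounds_def by (subst Max_le_iff) auto
qed

function greedy_A :: "'a graph \<Rightarrow> 'a strategy" where
  "greedy_A G bs =
     (SOME e. e \<in> edges G - set bs - (\<lambda>i. greedy_A G (take i bs)) ` {..<length bs})"
  by auto
termination by (relation "measure (\<lambda>(G, bs). length bs)") auto

function greedy_B :: "'a graph \<Rightarrow> 'a strategy" where
  "greedy_B G as =
     (SOME e. e \<in> edges G - set as - (\<lambda>i. greedy_B G (take i as)) ` {1..<length as})"
  by auto
termination by (relation "measure (\<lambda>(G, as). length as)") auto

declare greedy_A.simps [simp del] greedy_B.simps [simp del]

lemma strategy_A_greedy: "strategy_A G (greedy_A G)"
  unfolding strategy_A_def
proof (intro allI impI)
  fix bs assume "history_A G (greedy_A G) bs \<and> uncolored_A G (greedy_A G) bs \<noteq> {}"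
  moreover have "greedy_A G bs = (SOME e. e \<in> uncolored_A G (greedy_A G) bs)"
    unfolding uncolored_A_def by (rule greedy_A.simps)
  ultimately show "greedy_A G bs \<in> uncolored_A G (greedy_A G) bs"
    by (simp only: some_in_eq simp_thms)
qed

lemma strategy_B_greedy: "strategy_B G (greedy_B G)"
  unfolding strategy_B_def
proof (intro allI impI)
  fix as assume "as \<noteq> [] \<and> history_B G (greedy_B G) as \<and> uncolored_B G (greedy_B G) as \<noteq> {}"
  moreover have "greedy_B G as = (SOME e. e \<in> uncolored_B G (greedy_B G) as)"
    unfolding uncolored_B_def by (rule greedy_B.simps)
  ultimately show "greedy_B G as \<in> uncolored_B G (greedy_B G) as"
    by (simp only: some_in_eq simp_thms)
qed

lemma finite_preserved_rounds: "finite ((\<lambda>S1. preserved_rounds G S1 S2) ` X)"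
proof (rule finite_subset)
  show "(\<lambda>S1. preserved_rounds G S1 S2) ` X \<subseteq> {..card (edges G) div 2}"
    using preserved_rounds_le[of G _ S2] by blast
qed simp

lemma finite_min_preserved_rounds:
  "finite ((\<lambda>S2. Min ((\<lambda>S1. preserved_rounds G S1 S2) ` {S1. strategy_A G S1})) ` Y)"
proof (rule finite_subset)
  have "Min ((\<lambda>S1. preserved_rounds G S1 S2) ` {S1. strategy_A G S1}) \<le> card (edges G) div 2" for S2
  proof -
    have "preserved_rounds G (greedy_A G) S2
        \<in> (\<lambda>S1. preserved_rounds G S1 S2) ` {S1. strategy_A G S1}"
      by (intro imageI CollectI strategy_A_greedy)
    then have "Min ((\<lambda>S1. preserved_rounds G S1 S2) ` {S1. strategy_A G S1})
        \<le> preserved_rounds G (greedy_A G) S2"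
      by (intro Min_le finite_preserved_rounds)
    also have "\<dots> \<le> card (edges G) div 2" by (rule preserved_rounds_le)
    finally show ?thesis .
  qed
  then show "(\<lambda>S2. Min ((\<lambda>S1. preserved_rounds G S1 S2) ` {S1. strategy_A G S1})) ` Y
      \<subseteq> {..card (edges G) div 2}" by blast
qed simp

text \<open>In a play between two strategies every move colors an uncolored edge.\<close>

lemma play_legal:
  assumes A: "strategy_A G S1" and B: "strategy_B G S2" and fin: "finite (edges G)"
    and "i \<le> card (edges G) div 2" and "play S1 S2 i = (as, bs)"
  shows "length as = i \<and> length bs = i \<and> distinct (as @ bs) \<and> set (as @ bs) \<subseteq> edges G \<and>
    (\<forall>j<i. as ! j = S1 (take j bs) \<and> bs ! j = S2 (take (Suc j) as))"
  using assms(4,5)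
proof (induction i arbitrary: as bs)
  case 0
  then show ?case by simp
next
  case (Suc i)
  obtain as0 bs0 where p: "play S1 S2 i = (as0, bs0)" by fastforce
  define a where "a = S1 bs0"
  define b where "b = S2 (as0 @ [a])"
  have eq: "as = as0 @ [a]" "bs = bs0 @ [b]"
    using Suc.prems(2) p by (auto simp: a_def b_def Let_def)
  have IH: "length as0 = i" "length bs0 = i" "distinct (as0 @ bs0)"
      "set (as0 @ bs0) \<subseteq> edges G"
      "\<And>j. j < i \<Longrightarrow> as0 ! j = S1 (take j bs0)"
      "\<And>j. j < i \<Longrightarrow> bs0 ! j = S2 (take (Suc j) as0)"
    using Suc.IH[OF _ p] Suc.prems(1) by auto
  have card0: "card (set (as0 @ bs0)) = 2 * i"
    using distinct_card[OF IH(3)] IH(1,2) by simp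
  have imA: "(\<lambda>k. S1 (take k bs0)) ` {..<j} = set (take j as0)" if "j \<le> i" for j
  proof -
    have "(\<lambda>k. S1 (take k bs0)) ` {..<j} = (\<lambda>k. as0 ! k) ` {..<j}"
      using that IH(5) by (intro image_cong) auto
    also have "\<dots> = set (take j as0)"
      using that IH(1) by (auto simp: nth_image lessThan_atLeast0)
    finally show ?thesis .
  qed
  have imB: "(\<lambda>k. S2 (take k (as0 @ [a]))) ` {1..<Suc j} = set (take j bs0)" if "j \<le> i" for j
  proof -
    have "(\<lambda>k. S2 (take k (as0 @ [a]))) ` {1..<Suc j}
        = (\<lambda>k. S2 (take (Suc k) (as0 @ [a]))) ` {..<j}"
    proof -
      have "{1..<Suc j} = Suc ` {..<j}"
        by (simp add: lessThan_atLeast0)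
      then show ?thesis by (simp only: image_image)
    qed
    also have "\<dots> = (\<lambda>k. bs0 ! k) ` {..<j}"
      using that IH(1,6) by (intro image_cong) auto
    also have "\<dots> = set (take j bs0)"
      using that IH(2) by (auto simp: nth_image lessThan_atLeast0)
    finally show ?thesis .
  qed
  have dj: "set as0 \<inter> set bs0 = {}" and da: "distinct as0" and db: "distinct bs0"
    using IH(3) by auto
  have notin: "xs ! j \<notin> set (take j xs)" if "distinct xs" "j < length xs" for j and xs :: "'a set list"
    using that by (auto simp: in_set_conv_nth nth_eq_iff_index_eq)
  have hA: "history_A G S1 bs0"
    unfolding history_A_def
  proof (intro allI impI)
    fix j assume j: "j < length bs0"
    have "(\<lambda>k. S1 (take k bs0)) ` {..j} = set (take (Suc j) as0)"
      using imA[of "Suc j"] j IH(2) by (simp add: lessThan_Suc_atMost)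
    moreover have "bs0 ! j \<in> set bs0" using j by simp
    moreover have "set (take (Suc j) as0) \<subseteq> set as0" by (rule set_take_subset)
    ultimately show "bs0 ! j \<in> edges G - set (take j bs0) - (\<lambda>k. S1 (take k bs0)) ` {..j}"
      using notin[OF db j] IH(4) dj by auto
  qed
  have uA: "uncolored_A G S1 bs0 = edges G - set (as0 @ bs0)"
    using imA[of i] IH(1,2) by (auto simp: uncolored_A_def)
  have "uncolored_A G S1 bs0 \<noteq> {}"
  proof
    assume "uncolored_A G S1 bs0 = {}"
    then have "card (edges G) \<le> card (set (as0 @ bs0))"
      unfolding uA by (intro card_mono) auto
    then show False using card0 Suc.prems(1) by simp
  qed
  then have a: "a \<in> edges G - set (as0 @ bs0)"
    using A hA uA unfolding strategy_A_def a_def by blast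
  have das: "distinct (as0 @ [a])" using da a by simp
  have hB: "history_B G S2 (as0 @ [a])"
    unfolding history_B_def
  proof (intro allI impI)
    fix j assume j: "j < length (as0 @ [a])"
    have "(\<lambda>k. S2 (take k (as0 @ [a]))) ` {1..j} = set (take j bs0)"
      using imB[of j] j IH(1) by (simp add: atLeastLessThanSuc_atLeastAtMost)
    moreover have "(as0 @ [a]) ! j \<in> set (as0 @ [a])" using j by (rule nth_mem)
    moreover have "set (take j bs0) \<subseteq> set bs0" by (rule set_take_subset)
    moreover have "set (as0 @ [a]) \<inter> set bs0 = {}" "set (as0 @ [a]) \<subseteq> edges G"
      using dj a IH(4) by auto
    ultimately show "(as0 @ [a]) ! j \<in> edges G - set (take j (as0 @ [a]))
        - (\<lambda>k. S2 (take k (as0 @ [a]))) ` {1..j}"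
      using notin[OF das j] by blast
  qed
  have uB: "uncolored_B G S2 (as0 @ [a]) = edges G - insert a (set (as0 @ bs0))"
    using imB[of i] IH(1,2) by (auto simp: uncolored_B_def)
  have "uncolored_B G S2 (as0 @ [a]) \<noteq> {}"
  proof
    assume "uncolored_B G S2 (as0 @ [a]) = {}"
    then have "card (edges G) \<le> card (insert a (set (as0 @ bs0)))"
      unfolding uB by (intro card_mono) auto
    also have "\<dots> \<le> Suc (2 * i)"
      using card0 a by simp
    finally show False using Suc.prems(1) by simp
  qed
  then have "b \<in> edges G - insert a (set (as0 @ bs0))"
    using B hB uB unfolding strategy_B_def b_def by blast
  then show ?case
    using eq a IH by (auto simp: less_Suc_eq nth_append a_def b_def)
qed

end

theory Submission imports Defs begin

text \<open>
  Lower bound. The second player keeps an involution that swaps the colors and is an isometry on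
  clusters of nearby colored edges, the two ends of the path counting as colored edges that are swapped.
  A move close to a cluster is answered by its image, a move far from everything by an arbitrary move
  far from everything; the radius that defines \<open>near\<close> shrinks by a factor 3 in every round,
  so about \<open>log n\<close> rounds are survived. On the path the two extreme edges never get the
  same color, so closing the path to a cycle does not disturb the isomorphism.

  Upper bound. An isomorphism after every round forces the second player to join blue components of the
  same sizes as the red components joined by the first player. Suppose that two red components of
  different sizes have a free gap of length \<open>g\<close> between them, but the blue components of
  these sizes have not. The first player builds a red component of a new size in the middle of the gap.
  Wherever the blue component of this size emerges, one of the two new gaps has no blue counterpart.
  This bisection ends with a gap of length 1, which the first player closes and the second cannot. It
  takes \<open>log n\<close> stages with components of size \<open>O(log n)\<close>, all of different
  sizes. In the same way a red component with more free neighbors than its blue counterpart wins at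
  once, by blocking the counterpart. A first move that exploits the parity of \<open>n\<close> (the
  middle edge of the path, the middle edge of the odd gap between the first components on the cycle)
  leads to one of these situations.
\<close>

section \<open>Strategies from invariants\<close>

text \<open>A block under construction passes through all smaller lengths, and the reply to its next
  cell is forced onto one particular blue component only if no other blue component has the current
  length. Hence all earlier components must be longer than the block, and the block sizes decrease
  from stage to stage, starting near \<open>log n\<close>. About \<open>log n\<close> stages of at
  most that many moves give the square.

  Two obstacles shape the bisection. The second player may answer inside the very gap that is
  bisected, which spoils one side and calls for a second direction of growth. And a gap of length 2
  can be neither closed by one move nor split by a block with free cells on both sides, so all
  lengths are chosen to avoid it.

  Isomorphism of the colored graphs is weaker than a copy of the position. It only forces every
  reply to have the same unordered pair of adjacent run lengths. The length of a gap is no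
  isomorphism invariant; it matters only through later moves that join components.\<close>

primrec replies :: "('e set \<Rightarrow> 'e set \<Rightarrow> 'e \<Rightarrow> 'e) \<Rightarrow> 'e list
  \<Rightarrow> 'e list" where
  "replies c [] = []"
| "replies c (a # as) = c (set as) (set (replies c as)) a # replies c as"

text \<open>Positional play: a reply depends only on the two color classes and the latest move.
  \<open>replies\<close> works on the history with the newest move first, so that the latest move is
  the head of the recursion.\<close>

definition strat_B :: "('a set set \<Rightarrow> 'a set set \<Rightarrow> 'a set \<Rightarrow> 'a set)
  \<Rightarrow> 'a strategy" where
  "strat_B c as = hd (replies c (rev as))"

lemma replies_image:
  "set (replies c (rev as)) = (\<lambda>i. strat_B c (take i as)) ` {1..length as}"
proof (induction as rule: rev_induct)
  case (snoc a as)
  have "(\<lambda>i. strat_B c (take i (as @ [a]))) ` {1..length (as @ [a])} =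
      insert (strat_B c (as @ [a])) ((\<lambda>i. strat_B c (take i as)) ` {1..length as})"
    by (simp add: atLeastAtMostSuc_conv)
  then show ?case using snoc by (simp add: strat_B_def)
qed simp

lemma strategy_B_strat_B:
  assumes c: "\<And>A B a. edges G - insert a (A \<union> B) \<noteq> {} \<Longrightarrow> c A B a \<in>
    edges G - insert a (A \<union> B)"
  shows "strategy_B G (strat_B c)"
  unfolding strategy_B_def
proof (intro allI impI)
  fix as assume h: "as \<noteq> [] \<and> history_B G (strat_B c) as \<and> uncolored_B G (strat_B c) as
    \<noteq> {}"
  then obtain a as' where as: "as = as' @ [a]" by (metis rev_exhaust)
  have "{1..<length as} = {1..length as'}" unfolding as by auto
  then have "(\<lambda>i. strat_B c (take i as)) ` {1..<length as} = (\<lambda>i. strat_B c (take i as')) `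
    {1..length as'}"
    unfolding as by auto
  then have u: "uncolored_B G (strat_B c) as = edges G - insert a (set as' \<union> set (replies c (rev
    as')))"
    unfolding uncolored_B_def replies_image as by auto
  have "strat_B c as = c (set as') (set (replies c (rev as'))) a" unfolding strat_B_def as by simp
  then show "strat_B c as \<in> uncolored_B G (strat_B c) as" using c h u by metis
qed

lemma play_strat_B: "snd (play S1 (strat_B c) i) = rev (replies c (rev (fst (play S1 (strat_B c) i))))"
  by (induction i) (auto simp: strat_B_def Let_def split: prod.splits)

lemma edges_0: "edges_A S1 S2 0 = {}" "edges_B S1 S2 0 = {}"
  unfolding edges_A_def edges_B_def by auto

lemma play_step:
  assumes "strategy_A G S1" "strategy_B G S2" "finite (edges G)" "Suc i \<le> card (edges G) div 2"
  obtains a b where "a \<in> edges G - (edges_A S1 S2 i \<union> edges_B S1 S2 i)"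
    "b \<in> edges G - insert a (edges_A S1 S2 i \<union> edges_B S1 S2 i)"
    "edges_A S1 S2 (Suc i) = insert a (edges_A S1 S2 i)" "edges_B S1 S2 (Suc i) = insert b (edges_B S1 S2 i)"
    "a = S1 (snd (play S1 S2 i))" "b = S2 (fst (play S1 S2 i) @ [a])"
proof -
  obtain as bs where p: "play S1 S2 i = (as, bs)" by fastforce
  define a where "a = S1 bs"
  define b where "b = S2 (as @ [a])"
  have q: "play S1 S2 (Suc i) = (as @ [a], bs @ [b])" using p by (simp add: a_def b_def Let_def)
  have l: "distinct ((as @ [a]) @ (bs @ [b]))" "set ((as @ [a]) @ (bs @ [b])) \<subseteq> edges G"
    using play_legal[OF assms(1-4) q] by auto
  show ?thesis
    by (rule that[of a b]) (use l p q in \<open>auto simp: edges_A_def edges_B_def a_def b_def\<close>)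
qed

text \<open>The witness strategy chooses a reply that preserves the invariant if there is one, and
  otherwise any uncolored edge. The second branch is never reached during the first \<open>k\<close>
  rounds, but \<open>strategy_B\<close> demands a legal reply at every history that can
  occur.\<close>

lemma game_length_ge:
  assumes fin: "finite (edges G)" and k: "k \<le> card (edges G) div 2"
    and Inv0: "Inv 0 {} {}"
    and step: "\<And>i A B a. i < k \<Longrightarrow> Inv i A B \<Longrightarrow> a \<in> edges G - (A
      \<union> B) \<Longrightarrow> card A = i \<Longrightarrow>
      \<exists>b\<in>edges G - insert a (A \<union> B). Inv (Suc i) (insert a A) (insert b B)"
    and iso: "\<And>i A B. i \<le> k \<Longrightarrow> Inv i A B \<Longrightarrow> graph_iso (edge_subgraph
      A) (edge_subgraph B)"
  shows "k \<le> game_length G"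
proof -
  \<comment> \<open>A positional strategy does not see the round number, so it is recovered as
    \<open>card A\<close>.\<close>
  define ok where "ok A B a b \<longleftrightarrow> b \<in> edges G - insert a (A \<union> B) \<and>
    Inv (Suc (card A)) (insert a A) (insert b B)" for A B a b
  define c where "c A B a = (if \<exists>b. ok A B a b then SOME b. ok A B a b
    else SOME b. b \<in> edges G - insert a (A \<union> B))" for A B a
  have c1: "ok A B a (c A B a)" if "ok A B a b" for A B a b
    using that unfolding c_def by (auto intro: someI)
  have c2: "c A B a \<in> edges G - insert a (A \<union> B)"
    if "edges G - insert a (A \<union> B) \<noteq> {}" for A B a
  proof (cases "\<exists>b. ok A B a b")
    case True
    then show ?thesis using c1 unfolding ok_def by blast
  next
    case False
    have "(SOME b. b \<in> edges G - insert a (A \<union> B)) \<in> edges G - insert a (A \<union> B)"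
      using that by (simp only: some_in_eq simp_thms)
    then show ?thesis unfolding c_def using False by (simp only: if_False)
  qed
  let ?S2 = "strat_B c"
  have S2: "strategy_B G ?S2" by (rule strategy_B_strat_B) (rule c2)
  have pres: "k \<le> preserved_rounds G S1 ?S2" if S1: "strategy_A G S1" for S1
  proof -
    have inv: "i \<le> k \<longrightarrow> Inv i (edges_A S1 ?S2 i) (edges_B S1 ?S2 i) \<and> card (edges_A
      S1 ?S2 i) = i" for i
    proof (induction i)
      case 0
      then show ?case using Inv0 by (simp add: edges_0)
    next
      case (Suc i)
      show ?case
      proof
        assume i: "Suc i \<le> k"
        then have "Suc i \<le> card (edges G) div 2" using k by simp
        then obtain a b where ab: "a \<in> edges G - (edges_A S1 ?S2 i \<union> edges_B S1 ?S2 i)"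
          "b \<in> edges G - insert a (edges_A S1 ?S2 i \<union> edges_B S1 ?S2 i)"
          "edges_A S1 ?S2 (Suc i) = insert a (edges_A S1 ?S2 i)"
          "edges_B S1 ?S2 (Suc i) = insert b (edges_B S1 ?S2 i)"
          "b = ?S2 (fst (play S1 ?S2 i) @ [a])"
          using play_step[OF S1 S2 fin] by metis
        have IH: "Inv i (edges_A S1 ?S2 i) (edges_B S1 ?S2 i)" "card (edges_A S1 ?S2 i) = i" using Suc i
          by auto
        have "b = c (edges_A S1 ?S2 i) (edges_B S1 ?S2 i) a"
        proof -
          have "set (replies c (rev (fst (play S1 ?S2 i)))) = set (snd (play S1 ?S2 i))"
            unfolding play_strat_B by simp
          then show ?thesis unfolding ab(5) strat_B_def edges_A_def edges_B_def by simp
        qed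
        moreover obtain b' where "ok (edges_A S1 ?S2 i) (edges_B S1 ?S2 i) a b'"
          using step[OF _ IH(1) ab(1) IH(2)] i IH(2) unfolding ok_def by auto
        ultimately have "ok (edges_A S1 ?S2 i) (edges_B S1 ?S2 i) a b" using c1 by blast
        then have "Inv (Suc i) (edges_A S1 ?S2 (Suc i)) (edges_B S1 ?S2 (Suc i))"
          unfolding ok_def IH(2) ab(3,4) by blast
        moreover have "finite (edges_A S1 ?S2 i)" unfolding edges_A_def by simp
        ultimately show "Inv (Suc i) (edges_A S1 ?S2 (Suc i)) (edges_B S1 ?S2 (Suc i)) \<and>
            card (edges_A S1 ?S2 (Suc i)) = Suc i"
          using ab(1) IH(2) unfolding ab(3) by simp
      qed
    qed
    have "k \<in> {l. l \<le> card (edges G) div 2 \<and>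
        (\<forall>i\<le>l. graph_iso (edge_subgraph (edges_A S1 ?S2 i)) (edge_subgraph (edges_B S1 ?S2 i)))}"
      using k inv iso by auto
    then show ?thesis unfolding preserved_rounds_def by (intro Max_ge) auto
  qed
  have "k \<le> Min ((\<lambda>S1. preserved_rounds G S1 ?S2) ` {S1. strategy_A G S1})"
    using pres strategy_A_greedy finite_preserved_rounds by (subst Min_ge_iff) auto
  also have "\<dots> \<le> game_length G"
    unfolding game_length_def by (rule Max_ge[OF finite_min_preserved_rounds]) (use S2 in blast)
  finally show ?thesis .
qed

section \<open>Strategies of the first player\<close>

primrec moves :: "('e set \<Rightarrow> 'e set \<Rightarrow> 'e) \<Rightarrow> 'e list \<Rightarrow> 'e
  list" where
  "moves c [] = []"
| "moves c (b # bs) = c (set (moves c bs)) (set bs) # moves c bs"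

definition strat_A :: "('a set set \<Rightarrow> 'a set set \<Rightarrow> 'a set) \<Rightarrow> 'a
  strategy" where
  "strat_A c bs = c (set (moves c (rev bs))) (set bs)"

lemma moves_image: "set (moves c (rev bs)) = (\<lambda>i. strat_A c (take i bs)) ` {..<length bs}"
proof (induction bs rule: rev_induct)
  case (snoc b bs)
  have "(\<lambda>i. strat_A c (take i (bs @ [b]))) ` {..<length (bs @ [b])} =
      insert (strat_A c bs) ((\<lambda>i. strat_A c (take i bs)) ` {..<length bs})"
    by (simp add: lessThan_Suc)
  then show ?case using snoc by (simp add: strat_A_def)
qed simp

lemma strategy_A_strat_A:
  assumes c: "\<And>A B. edges G - (A \<union> B) \<noteq> {} \<Longrightarrow> c A B \<in> edges G - (A
    \<union> B)"
  shows "strategy_A G (strat_A c)"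
  unfolding strategy_A_def
proof (intro allI impI)
  fix bs assume h: "history_A G (strat_A c) bs \<and> uncolored_A G (strat_A c) bs \<noteq> {}"
  have u: "uncolored_A G (strat_A c) bs = edges G - (set (moves c (rev bs)) \<union> set bs)"
    unfolding uncolored_A_def moves_image by auto
  then show "strat_A c bs \<in> uncolored_A G (strat_A c) bs" using c h unfolding strat_A_def by metis
qed

lemma play_strat_A: "fst (play (strat_A c) S2 i) = rev (moves c (rev (snd (play (strat_A c) S2 i))))"
  by (induction i) (auto simp: strat_A_def Let_def split: prod.splits)

text \<open>Only replies that keep the graphs isomorphic before and after the round have to preserve
  the invariant. If the invariant cannot hold after \<open>k\<close> rounds, then the first
  \<open>k\<close> rounds cannot all have been isomorphic.\<close>

lemma game_length_le:
  assumes fin: "finite (edges G)"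
    and Inv0: "Inv 0 {} {}"
    and step: "\<And>i A B. i < k \<Longrightarrow> Inv i A B \<Longrightarrow> card B = i \<Longrightarrow>
      \<exists>a\<in>edges G - (A \<union> B). \<forall>b\<in>edges G - insert a (A \<union> B).
        graph_iso (edge_subgraph A) (edge_subgraph B) \<and>
        graph_iso (edge_subgraph (insert a A)) (edge_subgraph (insert b B)) \<longrightarrow>
        Inv (Suc i) (insert a A) (insert b B)"
    and fail: "\<And>A B. \<not> Inv k A B"
  shows "game_length G \<le> k"
proof -
  define ok where "ok A B a \<longleftrightarrow> a \<in> edges G - (A \<union> B) \<and>
    (\<forall>b\<in>edges G - insert a (A \<union> B).
        graph_iso (edge_subgraph A) (edge_subgraph B) \<and>
        graph_iso (edge_subgraph (insert a A)) (edge_subgraph (insert b B)) \<longrightarrow>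
        Inv (Suc (card B)) (insert a A) (insert b B))" for A B a
  define c where "c A B = (if \<exists>a. ok A B a then SOME a. ok A B a
    else SOME a. a \<in> edges G - (A \<union> B))" for A B
  have c1: "ok A B (c A B)" if "ok A B a" for A B a
    using that unfolding c_def by (auto intro: someI)
  have c2: "c A B \<in> edges G - (A \<union> B)" if "edges G - (A \<union> B) \<noteq> {}" for A B
  proof (cases "\<exists>a. ok A B a")
    case True
    then show ?thesis using c1 unfolding ok_def by blast
  next
    case False
    have "(SOME a. a \<in> edges G - (A \<union> B)) \<in> edges G - (A \<union> B)"
      using that by (simp only: some_in_eq simp_thms)
    then show ?thesis unfolding c_def using False by (simp only: if_False)
  qed
  let ?S1 = "strat_A c"
  have S1: "strategy_A G ?S1" by (rule strategy_A_strat_A) (rule c2)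
  have pres: "preserved_rounds G ?S1 S2 \<le> k" if S2: "strategy_B G S2" for S2
  proof (rule ccontr)
    let ?P = "{l. l \<le> card (edges G) div 2 \<and>
        (\<forall>i\<le>l. graph_iso (edge_subgraph (edges_A ?S1 S2 i)) (edge_subgraph (edges_B ?S1 S2 i)))}"
    assume n: "\<not> ?thesis"
    define M where "M = Max ?P"
    have gt: "k < M" using n unfolding preserved_rounds_def M_def by (simp only: not_le)
    have "0 \<in> ?P" by (auto simp: edges_0 graph_iso_def edge_subgraph_def bij_betw_def)
    then have "?P \<noteq> {}" by blast
    then have "M \<in> ?P" unfolding M_def by (rule Max_in[rotated]) simp
    then have P: "k \<le> card (edges G) div 2"
      "\<And>i. i \<le> k \<Longrightarrow> graph_iso (edge_subgraph (edges_A ?S1 S2 i)) (edge_subgraph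
        (edges_B ?S1 S2 i))"
      using gt by auto
    have "i \<le> k \<longrightarrow> Inv i (edges_A ?S1 S2 i) (edges_B ?S1 S2 i) \<and> card (edges_B ?S1
      S2 i) = i" for i
    proof (induction i)
      case 0
      then show ?case using Inv0 by (simp add: edges_0)
    next
      case (Suc i)
      show ?case
      proof
        assume i: "Suc i \<le> k"
        then have "Suc i \<le> card (edges G) div 2" using P by simp
        then obtain a b where ab: "a \<in> edges G - (edges_A ?S1 S2 i \<union> edges_B ?S1 S2 i)"
          "b \<in> edges G - insert a (edges_A ?S1 S2 i \<union> edges_B ?S1 S2 i)"
          "edges_A ?S1 S2 (Suc i) = insert a (edges_A ?S1 S2 i)"
          "edges_B ?S1 S2 (Suc i) = insert b (edges_B ?S1 S2 i)"
          "a = ?S1 (snd (play ?S1 S2 i))"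
          using play_step[OF S1 S2 fin] by metis
        have IH: "Inv i (edges_A ?S1 S2 i) (edges_B ?S1 S2 i)" "card (edges_B ?S1 S2 i) = i" using Suc i
          by auto
        have "a = c (edges_A ?S1 S2 i) (edges_B ?S1 S2 i)"
        proof -
          have "set (moves c (rev (snd (play ?S1 S2 i)))) = set (fst (play ?S1 S2 i))"
            unfolding play_strat_A by simp
          then show ?thesis unfolding ab(5) strat_A_def edges_A_def edges_B_def by simp
        qed
        moreover obtain a' where "ok (edges_A ?S1 S2 i) (edges_B ?S1 S2 i) a'"
          using step[OF _ IH] i IH(2) unfolding ok_def by auto
        ultimately have "ok (edges_A ?S1 S2 i) (edges_B ?S1 S2 i) a" using c1 by blast
        moreover have "graph_iso (edge_subgraph (edges_A ?S1 S2 i)) (edge_subgraph (edges_B ?S1 S2 i))"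
          "graph_iso (edge_subgraph (insert a (edges_A ?S1 S2 i))) (edge_subgraph (insert b (edges_B ?S1 S2
            i)))"
          using P(2)[of i] P(2)[of "Suc i"] i ab(3,4) by auto
        ultimately have "Inv (Suc i) (edges_A ?S1 S2 (Suc i)) (edges_B ?S1 S2 (Suc i))"
          using ab(2) unfolding ok_def IH(2) ab(3,4) by blast
        moreover have "finite (edges_B ?S1 S2 i)" unfolding edges_B_def by simp
        ultimately show "Inv (Suc i) (edges_A ?S1 S2 (Suc i)) (edges_B ?S1 S2 (Suc i)) \<and>
            card (edges_B ?S1 S2 (Suc i)) = Suc i"
          using ab(2) IH(2) unfolding ab(4) by simp
      qed
    qed
    then show False using fail by blast
  qed
  have "Min ((\<lambda>S1. preserved_rounds G S1 S2) ` {S1. strategy_A G S1}) \<le> k"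
    if "strategy_B G S2" for S2
  proof -
    have "Min ((\<lambda>S1. preserved_rounds G S1 S2) ` {S1. strategy_A G S1}) \<le> preserved_rounds G
      ?S1 S2"
      by (rule Min_le[OF finite_preserved_rounds]) (use S1 in blast)
    then show ?thesis using pres[OF that] by simp
  qed
  then show ?thesis unfolding game_length_def
    using strategy_B_greedy by (subst Max_le_iff[OF finite_min_preserved_rounds]) auto
qed

lemma game_length_le_half: "finite (edges G) \<Longrightarrow> game_length G \<le> card (edges G) div 2"
proof -
  have "Min ((\<lambda>S1. preserved_rounds G S1 S2) ` {S1. strategy_A G S1}) \<le> card (edges G) div 2"
    for S2
  proof -
    have "Min ((\<lambda>S1. preserved_rounds G S1 S2) ` {S1. strategy_A G S1}) \<le> preserved_rounds G
      (greedy_A G) S2"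
      by (rule Min_le[OF finite_preserved_rounds]) (use strategy_A_greedy in blast)
    then show ?thesis using preserved_rounds_le le_trans by blast
  qed
  then show ?thesis unfolding game_length_def
    using strategy_B_greedy by (subst Max_le_iff[OF finite_min_preserved_rounds]) auto
qed

section \<open>Symmetry and transitivity of isomorphism\<close>

lemma graph_iso_sym: "graph_iso G H \<Longrightarrow> graph_iso H G"
proof -
  assume "graph_iso G H"
  then obtain f where f: "bij_betw f (verts G) (verts H)"
    "\<And>u v. u \<in> verts G \<Longrightarrow> v \<in> verts G \<Longrightarrow> {u, v} \<in> edges G
      \<longleftrightarrow> {f u, f v} \<in> edges H"
    unfolding graph_iso_def by blast
  define g where "g = inv_into (verts G) f"
  have g: "bij_betw g (verts H) (verts G)" unfolding g_def by (rule bij_betw_inv_into[OF f(1)])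
  have "{u, v} \<in> edges H \<longleftrightarrow> {g u, g v} \<in> edges G"
    if "u \<in> verts H" "v \<in> verts H" for u v
  proof -
    have "f (g u) = u" "f (g v) = v" "g u \<in> verts G" "g v \<in> verts G"
      using that f(1) g unfolding g_def by (auto simp: bij_betw_inv_into_right bij_betwE)
    then show ?thesis using f(2)[of "g u" "g v"] by simp
  qed
  then show ?thesis using g unfolding graph_iso_def by blast
qed

lemma graph_iso_trans: "graph_iso G H \<Longrightarrow> graph_iso H K \<Longrightarrow> graph_iso G K"
proof -
  assume "graph_iso G H" "graph_iso H K"
  then obtain f g where f: "bij_betw f (verts G) (verts H)"
    "\<And>u v. u \<in> verts G \<Longrightarrow> v \<in> verts G \<Longrightarrow> {u, v} \<in> edges G
      \<longleftrightarrow> {f u, f v} \<in> edges H"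
    and g: "bij_betw g (verts H) (verts K)"
    "\<And>u v. u \<in> verts H \<Longrightarrow> v \<in> verts H \<Longrightarrow> {u, v} \<in> edges H
      \<longleftrightarrow> {g u, g v} \<in> edges K"
    unfolding graph_iso_def by blast
  have "f u \<in> verts H" if "u \<in> verts G" for u using f(1) that by (rule bij_betw_apply)
  then show ?thesis unfolding graph_iso_def
    using bij_betw_trans[OF f(1) g(1)] f(2) g(2) by (intro exI[of _ "g \<circ> f"]) simp
qed

section \<open>Lower bound\<close>

text \<open>
  A pair \<open>(s, t)\<close> with \<open>s\<close> of absolute value 1 encodes the isometry sending
  \<open>x\<close> to \<open>s * x + t\<close> on the indices of edges; the index of an edge is its
  smaller end vertex. The indices \<open>-1\<close> and \<open>n\<close> stand for the two ends.
\<close>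

definition app_isom :: "int \<times> int \<Rightarrow> int \<Rightarrow> int" where
  "app_isom g x = fst g * x + snd g"

definition inv_isom :: "int \<times> int \<Rightarrow> int \<times> int" where
  "inv_isom g = (fst g, - fst g * snd g)"

definition isom :: "int \<times> int \<Rightarrow> bool" where
  "isom g \<longleftrightarrow> fst g = 1 \<or> fst g = -1"

lemma isom_inv: "isom g \<Longrightarrow> isom (inv_isom g)" unfolding isom_def inv_isom_def by simp
lemma app_inv_isom: "isom g \<Longrightarrow> app_isom (inv_isom g) (app_isom g x) = x"
  unfolding isom_def inv_isom_def app_isom_def by (auto simp: algebra_simps)
lemma inv_inv: "isom g \<Longrightarrow> inv_isom (inv_isom g) = g"
  unfolding isom_def inv_isom_def by (cases g) auto
lemma app_isom_dist: "isom g \<Longrightarrow> \<bar>app_isom g x - app_isom g y\<bar> = \<bar>x - y\<bar>"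
  unfolding isom_def app_isom_def by auto

definition positions :: "int \<Rightarrow> int set \<Rightarrow> int set \<Rightarrow> int set" where
  "positions n A B = A \<union> B \<union> {-1, n}"

text \<open>\<open>f\<close> attaches to every colored edge and to both ends the isometry that
  carries it to its partner. Positions at distance at most \<open>d\<close> share their isometry, so
  clusters are carried rigidly. Partners are more than \<open>d\<close> apart and are therefore
  never forced to share an isometry. The value at the ends is the reflection that exchanges
  \<open>-1\<close> and \<open>n\<close>.\<close>

definition matched :: "int \<Rightarrow> int \<Rightarrow> int set \<Rightarrow> int set \<Rightarrow> (int
  \<Rightarrow> int \<times> int) \<Rightarrow> bool" where
  "matched n d A B f \<longleftrightarrow> A \<subseteq> {0..<n} \<and> B \<subseteq> {0..<n} \<and> A
    \<inter> B = {} \<and>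
     f (-1) = (-1, n - 1) \<and> f n = (-1, n - 1) \<and>
     (\<forall>p\<in>positions n A B. isom (f p) \<and> f (app_isom (f p) p) = inv_isom (f p) \<and> d <
       \<bar>p - app_isom (f p) p\<bar>) \<and>
     (\<forall>p\<in>A. app_isom (f p) p \<in> B) \<and> (\<forall>p\<in>B. app_isom (f p) p \<in> A) \<and>
     (\<forall>p\<in>positions n A B. \<forall>q\<in>positions n A B. \<bar>p - q\<bar> \<le> d
       \<longrightarrow> f p = f q)"

lemma matchedD:
  assumes "matched n d A B f"
  shows "A \<subseteq> {0..<n}" "B \<subseteq> {0..<n}" "A \<inter> B = {}" "f (-1) = (-1, n - 1)" "f n =
    (-1, n - 1)"
    "\<And>p. p \<in> positions n A B \<Longrightarrow> isom (f p)" "\<And>p. p \<in> positions n A B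
      \<Longrightarrow> f (app_isom (f p) p) = inv_isom (f p)"
    "\<And>p. p \<in> positions n A B \<Longrightarrow> d < \<bar>p - app_isom (f p) p\<bar>"
    "\<And>p. p \<in> A \<Longrightarrow> app_isom (f p) p \<in> B" "\<And>p. p \<in> B \<Longrightarrow>
      app_isom (f p) p \<in> A"
    "\<And>p q. p \<in> positions n A B \<Longrightarrow> q \<in> positions n A B \<Longrightarrow> \<bar>p
      - q\<bar> \<le> d \<Longrightarrow> f p = f q"
  using assms unfolding matched_def by blast+

lemma positionsI: "p \<in> A \<Longrightarrow> p \<in> positions n A B" "p \<in> B \<Longrightarrow> p
  \<in> positions n A B" "-1 \<in> positions n A B" "n \<in> positions n A B"
  unfolding positions_def by auto

lemma matched_closed:
  assumes "matched n d A B f" "p \<in> positions n A B" shows "app_isom (f p) p \<in> positions n A B"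
proof -
  note m = matchedD[OF assms(1)]
  consider "p \<in> A" | "p \<in> B" | "p = -1" | "p = n" using assms(2) unfolding positions_def by blast
  then show ?thesis
  proof cases
    case 1
    then show ?thesis using m(9) positionsI by blast
  next
    case 2
    then show ?thesis using m(10) positionsI by blast
  next
    case 3
    then have "app_isom (f p) p = n" using m(4) by (simp add: app_isom_def)
    then show ?thesis using positionsI by simp
  next
    case 4
    then have "app_isom (f p) p = -1" using m(5) by (simp add: app_isom_def)
    then show ?thesis using positionsI by simp
  qed
qed

lemma matched_add:
  assumes m: "matched n (3 * d) A B f" and d: "0 \<le> d"
    and x: "0 \<le> x" "x < n" "x \<notin> A" "x \<notin> B" and y: "0 \<le> y" "y < n" "y \<notin> A" "y
      \<notin> B"
    and g: "isom g" "app_isom g x = y" and xy: "d < \<bar>x - y\<bar>"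
    and cx: "\<And>q. q \<in> positions n A B \<Longrightarrow> \<bar>x - q\<bar> \<le> d \<Longrightarrow>
      f q = g"
    and cy: "\<And>q. q \<in> positions n A B \<Longrightarrow> \<bar>y - q\<bar> \<le> d \<Longrightarrow>
      f q = inv_isom g"
  shows "matched n d (insert x A) (insert y B) (f(x := g, y := inv_isom g))"
proof -
  let ?f = "f(x := g, y := inv_isom g)"
  let ?K = "positions n A B"
  have K': "positions n (insert x A) (insert y B) = insert x (insert y ?K)" unfolding positions_def by auto
  have ne: "x \<noteq> y" using xy d by auto
  have xK: "x \<notin> ?K" "y \<notin> ?K" using x y unfolding positions_def by auto
  have fx: "?f x = g" "?f y = inv_isom g" using ne by auto
  have fq: "?f q = f q" if "q \<in> ?K" for q using that xK by auto
  have closed: "app_isom (f q) q \<in> ?K" if "q \<in> ?K" for q by (rule matched_closed[OF m that])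
  note M = matchedD(6-8)[OF m]
  have yx: "app_isom (inv_isom g) y = x" using app_inv_isom[OF g(1), of x] g(2) by simp
  have 1: "isom (?f p) \<and> ?f (app_isom (?f p) p) = inv_isom (?f p) \<and> d < \<bar>p - app_isom (?f p)
    p\<bar>"
    if p: "p \<in> insert x (insert y ?K)" for p
  proof -
    consider "p = x" | "p = y" | "p \<in> ?K" using p by blast
    then show ?thesis
    proof cases
      case 1
      then show ?thesis using fx g xy by simp
    next
      case 2
      then show ?thesis using fx g yx xy isom_inv inv_inv ne by auto
    next
      case 3
      then show ?thesis using fq closed M[OF 3] d by auto
    qed
  qed
  have 2: "?f p = ?f q"
    if pq: "p \<in> insert x (insert y ?K)" "q \<in> insert x (insert y ?K)" "\<bar>p - q\<bar> \<le> d"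
      for p q
  proof -
    have KK: "f p = f q" if "p \<in> ?K" "q \<in> ?K" "\<bar>p - q\<bar> \<le> d" for p q
    proof -
      have "\<bar>p - q\<bar> \<le> 3 * d" using that(3) d by linarith
      then show ?thesis by (rule matchedD(11)[OF m that(1,2)])
    qed
    consider "p = q" | "p = x" "q = y" | "p = y" "q = x" | "p = x" "q \<in> ?K" | "p = y" "q \<in> ?K" |
      "p \<in> ?K" "q = x" | "p \<in> ?K" "q = y" | "p \<in> ?K" "q \<in> ?K" using pq by blast
    then show ?thesis
    proof cases
      case 1
      then show ?thesis by simp
    next
      case 2
      then have False using pq(3) xy by simp
      then show ?thesis ..
    next
      case 3
      then have False using pq(3) xy by (simp add: abs_minus_commute)
      then show ?thesis ..
    next
      case 4
      then show ?thesis using cx[of q] fq[of q] fx pq(3) by simp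
    next
      case 5
      then show ?thesis using cy[of q] fq[of q] fx pq(3) by simp
    next
      case 6
      then show ?thesis using cx[of p] fq[of p] fx pq(3) by (simp add: abs_minus_commute)
    next
      case 7
      then show ?thesis using cy[of p] fq[of p] fx pq(3) by (simp add: abs_minus_commute)
    next
      case 8
      then show ?thesis using fq[OF 8(1)] fq[OF 8(2)] KK[OF 8 pq(3)] by simp
    qed
  qed
  have base: "A \<subseteq> {0..<n}" "B \<subseteq> {0..<n}" "A \<inter> B = {}" "f (-1) = (-1, n - 1)" "f
    n = (-1, n - 1)"
    "\<And>p. p \<in> A \<Longrightarrow> app_isom (f p) p \<in> B" "\<And>p. p \<in> B \<Longrightarrow>
      app_isom (f p) p \<in> A"
    by (rule matchedD[OF m]; assumption?)+
  have AK: "p \<in> ?K" if "p \<in> A \<or> p \<in> B" for p using that unfolding positions_def by blast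
  show ?thesis
    unfolding matched_def K'
  proof (intro conjI ballI)
    show "insert x A \<subseteq> {0..<n}" "insert y B \<subseteq> {0..<n}" using base x y by auto
    show "insert x A \<inter> insert y B = {}" using base(3) x y ne by auto
    show "?f (-1) = (-1, n - 1)" "?f n = (-1, n - 1)" using base(4,5) x y by auto
    show "app_isom (?f p) p \<in> insert y B" if "p \<in> insert x A" for p
    proof (cases "p = x")
      case False
      then have "p \<in> A" using that by simp
      then show ?thesis using fq[OF AK[of p]] base(6) by simp
    qed (use fx g in simp)
    show "app_isom (?f p) p \<in> insert x A" if "p \<in> insert y B" for p
    proof (cases "p = y")
      case False
      then have "p \<in> B" using that by simp
      then show ?thesis using fq[OF AK[of p]] base(7) by simp
    qed (use fx yx in simp)
    show "\<bar>p - q\<bar> \<le> d \<longrightarrow> ?f p = ?f q"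
      if "p \<in> insert x (insert y ?K)" "q \<in> insert x (insert y ?K)" for p q
      using 2[OF that] by blast
  qed (use 1 in blast)+
qed

text \<open>A move near \<open>p\<close> and its image near the partner of \<open>p\<close> are each
  displaced by at most \<open>d\<close>, so partners more than \<open>3 * d\<close> apart leave the
  two new edges more than \<open>d\<close> apart; this is the origin of the factor 3. The
  cardinality hypothesis serves a move far from everything: the intervals of radius \<open>d\<close>
  about the colored edges, the two ends and the move do not cover the board.\<close>

lemma matched_step:
  assumes m: "matched n (3 * d) A B f" and d: "0 \<le> d"
    and x: "0 \<le> x" "x < n" "x \<notin> A" "x \<notin> B"
    and card: "(int (card A) + int (card B) + 3) * (2 * d + 1) < n"
  shows "\<exists>y f'. 0 \<le> y \<and> y < n \<and> y \<notin> A \<and> y \<notin> B \<and> y \<noteq> x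
    \<and> matched n d (insert x A) (insert y B) f'"
proof (cases "\<exists>p\<in>positions n A B. \<bar>x - p\<bar> \<le> d")
  case True
  let ?K = "positions n A B"
  obtain p where p: "p \<in> ?K" "\<bar>x - p\<bar> \<le> d" using True by blast
  define s where "s = app_isom (f p) p"
  define y where "y = app_isom (f p) x"
  note M = matchedD(6-8)[OF m]
  note near = matchedD(11)[OF m]
  have closed: "app_isom (f q) q \<in> ?K" if "q \<in> ?K" for q by (rule matched_closed[OF m that])
  have sK: "s \<in> ?K" unfolding s_def by (rule closed[OF p(1)])
  have fs: "f s = inv_isom (f p)" unfolding s_def by (rule M(2)[OF p(1)])
  have ys: "\<bar>y - s\<bar> \<le> d" unfolding y_def s_def using app_isom_dist[OF M(1)[OF p(1)]] p(2)
    by simp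
  have bck: "app_isom (f s) y = x" unfolding fs y_def by (rule app_inv_isom[OF M(1)[OF p(1)]])
  have xK: "x \<notin> ?K" using x unfolding positions_def by auto
  \<comment> \<open>If the image were already a position, it would carry the inverse isometry
    because it is near \<open>s\<close>, and so its partner \<open>x\<close> would be a position as
    well.\<close>
  have yK: "y \<notin> ?K"
  proof
    assume y: "y \<in> ?K"
    have "f y = f s" by (rule near[OF y sK]) (use ys d in simp)
    then have "app_isom (f y) y = x" using bck by simp
    then show False using closed[OF y] xK by simp
  qed
  have ends: "-1 \<in> ?K" "n \<in> ?K" "f (-1) = (-1, n - 1)" "f n = (-1, n - 1)"
    using matchedD(4,5)[OF m] by (auto intro: positionsI)
  have sub: "A \<subseteq> {0..<n}" "B \<subseteq> {0..<n}" by (rule matchedD[OF m])+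
  have sr: "-1 \<le> s" "s \<le> n" using sK sub x unfolding positions_def by auto
  \<comment> \<open>If the image fell beyond an end, \<open>s\<close> would be within
    \<open>d\<close> of this end and carry the end reflection, which maps \<open>y\<close> beyond
    the opposite end and not to \<open>x\<close>.\<close>
  have "\<not> y < -1"
  proof
    assume y: "y < -1"
    have "f s = f (-1)" by (rule near[OF sK ends(1)]) (use y ys sr d in auto)
    then show False using bck ends x y unfolding app_isom_def by auto
  qed
  moreover have "\<not> n < y"
  proof
    assume y: "n < y"
    have "f s = f n" by (rule near[OF sK ends(2)]) (use y ys sr d in auto)
    then show False using bck ends x y unfolding app_isom_def by auto
  qed
  ultimately have yr: "0 \<le> y" "y < n" "y \<notin> A" "y \<notin> B" using yK unfolding positions_def
    by auto
  have ps: "3 * d < \<bar>p - s\<bar>" unfolding s_def by (rule M(3)[OF p(1)])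
  have xy: "d < \<bar>x - y\<bar>" using ps p(2) ys by linarith
  have "matched n d (insert x A) (insert y B) (f(x := f p, y := inv_isom (f p)))"
  proof (rule matched_add[OF m d x yr M(1)[OF p(1)] y_def[symmetric] xy])
    fix q assume q: "q \<in> ?K"
    show "f q = f p" if "\<bar>x - q\<bar> \<le> d" by (rule near[OF q p(1)]) (use that p(2) d in linarith)
    show "f q = inv_isom (f p)" if "\<bar>y - q\<bar> \<le> d"
      unfolding fs[symmetric] by (rule near[OF q sK]) (use that ys d in linarith)
  qed
  moreover have "y \<noteq> x" using xy d by auto
  ultimately show ?thesis using yr by blast
next
  case False
  let ?K = "insert x (positions n A B)"
  have fin: "finite A" "finite B"
    using finite_subset[OF matchedD(1)[OF m]] finite_subset[OF matchedD(2)[OF m]] by simp_all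
  have "\<exists>y\<in>{0..<n}. \<forall>q\<in>?K. d < \<bar>y - q\<bar>"
  proof (rule ccontr)
    assume none: "\<not> ?thesis"
    have "{0..<n} \<subseteq> (\<Union>q\<in>?K. {q - d..q + d})"
    proof
      fix y assume "y \<in> {0..<n}"
      then obtain q where q: "q \<in> ?K" "\<not> d < \<bar>y - q\<bar>" using none by blast
      then have "y \<in> {q - d..q + d}" by auto
      then show "y \<in> (\<Union>q\<in>?K. {q - d..q + d})" using q(1) by (rule UN_I[rotated])
    qed
    then have "card {0..<n} \<le> card (\<Union>q\<in>?K. {q - d..q + d})"
      using fin by (intro card_mono) (auto simp: positions_def)
    also have "\<dots> \<le> (\<Sum>q\<in>?K. card {q - d..q + d})"
      using fin by (intro card_UN_le) (auto simp: positions_def)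
    also have "\<dots> = card ?K * nat (2 * d + 1)" by (simp add: algebra_simps)
    also have "card ?K \<le> card A + card B + 3"
    proof -
      have "card ?K \<le> Suc (card (positions n A B))" by (rule card_insert_le_m1[THEN order_trans]) auto
      moreover have "card (positions n A B) \<le> card A + card B + card {-1, n}"
        unfolding positions_def
          by (metis (no_types) card_Un_le add_mono_thms_linordered_semiring(3) order_trans)
      moreover have "card {-1, n} \<le> 2" by (simp add: card_insert_if)
      ultimately show ?thesis by simp
    qed
    finally have c: "card {0..<n} \<le> (card A + card B + 3) * nat (2 * d + 1)" by simp
    have "n = int (card {0..<n})" using x by simp
    also have "\<dots> \<le> int ((card A + card B + 3) * nat (2 * d + 1))" using c by (rule of_nat_mono)
    also have "\<dots> = (int (card A) + int (card B) + 3) * (2 * d + 1)" using d by simp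
    finally show False using card by simp
  qed
  then obtain y where y0: "y \<in> {0..<n}" "\<forall>q\<in>?K. d < \<bar>y - q\<bar>" by (rule bexE)
  have y: "0 \<le> y" "y < n" using y0(1) by simp_all
  have yq: "d < \<bar>y - q\<bar>" if "q \<in> ?K" for q using y0(2) that by (rule bspec)
  have yn: "y \<notin> A" "y \<notin> B" using yq[of y] d unfolding positions_def by auto
  have xy: "d < \<bar>x - y\<bar>" using yq[of x] by simp
  \<comment> \<open>Any isometry that sends \<open>x\<close> to \<open>y\<close> would do, since no
    position within \<open>d\<close> of either of them imposes a condition; the translation is the
    simplest.\<close>
  have "matched n d (insert x A) (insert y B) (f(x := (1, y - x), y := inv_isom (1, y - x)))"
  proof (rule matched_add[OF m d x y(1,2) yn _ _ xy])
    show "isom (1, y - x)" "app_isom (1, y - x) x = y" unfolding isom_def app_isom_def by auto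
  next
    fix q assume q: "q \<in> positions n A B"
    show "f q = (1, y - x)" if "\<bar>x - q\<bar> \<le> d" using False q that by blast
    have "d < \<bar>y - q\<bar>" using q by (intro yq) simp
    then show "f q = inv_isom (1, y - x)" if "\<bar>y - q\<bar> \<le> d" using that by simp
  qed
  moreover have "y \<noteq> x" using xy d by auto
  ultimately show ?thesis using y(1,2) yn by blast
qed

lemma matched_init: "0 \<le> d \<Longrightarrow> d \<le> n \<Longrightarrow> matched n d {} {} (\<lambda>_.
  (-1, n - 1))"
  unfolding matched_def positions_def isom_def app_isom_def inv_isom_def by auto

section \<open>Graph isomorphisms from matched edges\<close>

definition path_edge :: "int \<Rightarrow> nat set" where
  "path_edge i = {nat i, nat (i + 1)}"

text \<open>
  The action on vertices of an isometry given on edge indices: a reflection maps the edge from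
  \<open>v\<close> to \<open>v + 1\<close> to its image with the end vertices exchanged.
\<close>

definition vertex_image :: "int \<times> int \<Rightarrow> int \<Rightarrow> int" where
  "vertex_image g v = fst g * v + snd g + (if fst g = 1 then 0 else 1)"

definition vertex_map :: "int set \<Rightarrow> (int \<Rightarrow> int \<times> int) \<Rightarrow> nat
  \<Rightarrow> nat" where
  "vertex_map A f v = nat (vertex_image (f (if int v \<in> A then int v else int v - 1)) (int v))"

lemma vertex_image_inv: "isom g \<Longrightarrow> vertex_image (inv_isom g) (vertex_image g v) = v"
  unfolding isom_def vertex_image_def inv_isom_def by auto

lemma vertex_image_edge: "isom g \<Longrightarrow> {vertex_image g p, vertex_image g (p + 1)} = {app_isom g
  p, app_isom g p + 1}"
  unfolding isom_def vertex_image_def app_isom_def by auto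

lemma matched_swap: "matched n d A B f \<Longrightarrow> matched n d B A f"
proof -
  assume m: "matched n d A B f"
  have e: "positions n B A = positions n A B" unfolding positions_def by blast
  show ?thesis using m unfolding matched_def e Int_commute[of B A] by blast
qed

lemma path_edge_verts:
  assumes "A \<subseteq> {0..<n}" shows "v \<in> \<Union>(path_edge ` A) \<longleftrightarrow> int v \<in>
    A \<or> int v - 1 \<in> A"
proof
  assume "v \<in> \<Union>(path_edge ` A)"
  then obtain p where p: "p \<in> A" "v \<in> path_edge p" by blast
  have "0 \<le> p" using p(1) assms by auto
  then have "int v = p \<or> int v - 1 = p" using p(2) unfolding path_edge_def by auto
  then show "int v \<in> A \<or> int v - 1 \<in> A" using p(1) by blast
next
  have "v \<in> path_edge (int v)" "v \<in> path_edge (int v - 1)" unfolding path_edge_def by simp_all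
  then show "int v \<in> A \<or> int v - 1 \<in> A \<Longrightarrow> v \<in> \<Union>(path_edge ` A)" by blast
qed

text \<open>If both edges at \<open>v\<close> belong to \<open>A\<close>, they are at distance 1 and
  share their isometry, so it does not matter which one \<open>vertex_map\<close> consults. This is
  where \<open>1 \<le> d\<close> enters.\<close>

lemma vertex_map_edge:
  assumes m: "matched n d A B f" and d: "1 \<le> d" and p: "p \<in> A" and v: "int v = p \<or> int v = p + 1"
  shows "int (vertex_map A f v) = vertex_image (f p) (int v)" "int (vertex_map A f v) \<in> {app_isom (f p)
    p, app_isom (f p) p + 1}"
proof -
  have A: "A \<subseteq> {0..<n}" "B \<subseteq> {0..<n}" "app_isom (f p) p \<in> B" "isom (f p)"
    by (rule matchedD[OF m], rule matchedD[OF m], rule matchedD(9)[OF m p], rule matchedD(6)[OF m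
      positionsI(1)[OF p]])
  have "f (if int v \<in> A then int v else int v - 1) = f p"
  proof (cases "int v \<in> A")
    case True
    have "\<bar>int v - p\<bar> \<le> d" using v d by auto
    then show ?thesis using matchedD(11)[OF m positionsI(1)[OF True] positionsI(1)[OF p]] True by simp
  next
    case False
    then show ?thesis using v p by auto
  qed
  then have e: "vertex_map A f v = nat (vertex_image (f p) (int v))" unfolding vertex_map_def by simp
  have "vertex_image (f p) (int v) \<in> {vertex_image (f p) p, vertex_image (f p) (p + 1)}" using v by auto
  then have "vertex_image (f p) (int v) \<in> {app_isom (f p) p, app_isom (f p) p + 1}"
    unfolding vertex_image_edge[OF A(4)] .
  moreover have "0 \<le> app_isom (f p) p" using A by auto
  ultimately show "int (vertex_map A f v) = vertex_image (f p) (int v)" "int (vertex_map A f v) \<in>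
    {app_isom (f p) p, app_isom (f p) p + 1}"
    unfolding e by auto
qed

lemma path_edge_nat: "{int a, int b} = {s, s + 1} \<Longrightarrow> {a, b} = path_edge s"
  unfolding path_edge_def doubleton_eq_iff by auto

lemma vertex_map_props:
  assumes m: "matched n d A B f" and d: "1 \<le> d"
  shows "v \<in> \<Union>(path_edge ` A) \<Longrightarrow> vertex_map A f v \<in> \<Union>(path_edge ` B)
    \<and> vertex_map B f (vertex_map A f v) = v"
    "{u, v} \<in> path_edge ` A \<Longrightarrow> {vertex_map A f u, vertex_map A f v} \<in> path_edge ` B"
proof -
  note A = matchedD(1,2)[OF m]
  show "vertex_map A f v \<in> \<Union>(path_edge ` B) \<and> vertex_map B f (vertex_map A f v) = v"
    if vA: "v \<in> \<Union>(path_edge ` A)"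
  proof -
    have "int v \<in> A \<or> int v - 1 \<in> A" using vA unfolding path_edge_verts[OF A(1)] .
    then have "\<exists>p. p \<in> A \<and> (int v = p \<or> int v = p + 1)"
      by (auto intro: exI[of _ "int v"] exI[of _ "int v - 1"])
    then obtain p where p: "p \<in> A" "int v = p \<or> int v = p + 1" by blast
    have q: "app_isom (f p) p \<in> B" "isom (f p)" "f (app_isom (f p) p) = inv_isom (f p)"
      by (rule matchedD(9)[OF m p(1)], rule matchedD(6)[OF m positionsI(1)[OF p(1)]],
        rule matchedD(7)[OF m positionsI(1)[OF p(1)]])
    note v = vertex_map_edge[OF m d p]
    have v2: "int (vertex_map A f v) = app_isom (f p) p \<or> int (vertex_map A f v) = app_isom (f p) p +
      1" using v(2) by simp
    then have "int (vertex_map A f v) \<in> B \<or> int (vertex_map A f v) - 1 \<in> B" using q(1)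
      by fastforce
    then have "vertex_map A f v \<in> \<Union>(path_edge ` B)" unfolding path_edge_verts[OF A(2)] .
    moreover have "int (vertex_map B f (vertex_map A f v)) = vertex_image (f (app_isom (f p) p)) (int
      (vertex_map A f v))"
      by (rule vertex_map_edge[OF matched_swap[OF m] d q(1) v2])
    ultimately show ?thesis unfolding q(3) v(1) using vertex_image_inv[OF q(2)] by simp
  qed
  show "{vertex_map A f u, vertex_map A f v} \<in> path_edge ` B" if uv: "{u, v} \<in> path_edge ` A"
  proof -
    obtain p where p: "p \<in> A" "{u, v} = path_edge p" using uv by auto
    have p0: "0 \<le> p" using p(1) A(1) by auto
    have q: "app_isom (f p) p \<in> B" "isom (f p)"
      by (rule matchedD(9)[OF m p(1)], rule matchedD(6)[OF m positionsI(1)[OF p(1)]])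
    have e: "int (vertex_map A f (nat p)) = vertex_image (f p) p" "int (vertex_map A f (nat (p + 1))) =
      vertex_image (f p) (p + 1)"
      using vertex_map_edge(1)[OF m d p(1), of "nat p"] vertex_map_edge(1)[OF m d p(1), of "nat (p + 1)"]
        p0 by auto
    have "{int (vertex_map A f (nat p)), int (vertex_map A f (nat (p + 1)))} = {app_isom (f p) p, app_isom
      (f p) p + 1}"
      unfolding e by (rule vertex_image_edge[OF q(2)])
    then have "{vertex_map A f (nat p), vertex_map A f (nat (p + 1))} = path_edge (app_isom (f p) p)"
      by (rule path_edge_nat)
    moreover have "{vertex_map A f u, vertex_map A f v} = vertex_map A f ` {u, v}" by simp
    then have "{vertex_map A f u, vertex_map A f v} = {vertex_map A f (nat p), vertex_map A f (nat (p + 1))}"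
      unfolding p(2) path_edge_def by simp
    ultimately have "{vertex_map A f u, vertex_map A f v} = path_edge (app_isom (f p) p)" by (simp only:)
    then show ?thesis by (rule image_eqI) (rule q(1))
  qed
qed

lemma matched_iso_path:
  assumes m: "matched n d A B f" and d: "1 \<le> d"
  shows "graph_iso (edge_subgraph (path_edge ` A)) (edge_subgraph (path_edge ` B))"
proof -
  note a = vertex_map_props[OF m d] and b = vertex_map_props[OF matched_swap[OF m] d]
  have "bij_betw (vertex_map A f) (\<Union>(path_edge ` A)) (\<Union>(path_edge ` B))"
    by (rule bij_betw_byWitness[where f' = "vertex_map B f"]) (use a(1) b(1) in blast)+
  moreover have "{u, v} \<in> path_edge ` A \<longleftrightarrow> {vertex_map A f u, vertex_map A f v}
    \<in> path_edge ` B"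
    if "u \<in> \<Union>(path_edge ` A)" "v \<in> \<Union>(path_edge ` A)" for u v
  proof
    assume "{vertex_map A f u, vertex_map A f v} \<in> path_edge ` B"
    then have "{vertex_map B f (vertex_map A f u), vertex_map B f (vertex_map A f v)} \<in> path_edge ` A"
      by (rule b(2))
    then show "{u, v} \<in> path_edge ` A" using a(1)[OF that(1)] a(1)[OF that(2)] by simp
  qed (rule a(2))
  ultimately show ?thesis unfolding graph_iso_def edge_subgraph_def graph.select_convs by blast
qed

lemma graph_iso_image:
  assumes "inj_on h (\<Union>F)"
  shows "graph_iso (edge_subgraph F) (edge_subgraph ((`) h ` F))"
proof -
  have "bij_betw h (\<Union>F) (\<Union>((`) h ` F))"
    unfolding bij_betw_def using assms by auto
  moreover have "{u, v} \<in> F \<longleftrightarrow> {h u, h v} \<in> (`) h ` F"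
    if "u \<in> \<Union>F" "v \<in> \<Union>F" for u v
  proof
    assume "{h u, h v} \<in> (`) h ` F"
    then obtain e where e: "e \<in> F" "h ` {u, v} = h ` e" by auto
    have "{u, v} = e"
      by (rule inj_on_image_eq_iff[OF assms, THEN iffD1]) (use e that in auto)
    then show "{u, v} \<in> F" using e by simp
  next
    assume "{u, v} \<in> F"
    then have "h ` {u, v} \<in> (`) h ` F" by (rule imageI)
    then show "{h u, h v} \<in> (`) h ` F" by simp
  qed
  ultimately show ?thesis unfolding graph_iso_def edge_subgraph_def graph.select_convs by blast
qed

definition cycle_edge :: "nat \<Rightarrow> int \<Rightarrow> nat set" where
  "cycle_edge n i = (\<lambda>v. v mod n) ` path_edge i"

lemma matched_iso_cycle:
  assumes m: "matched (int n) d A B f" and d: "1 \<le> d" and n: "1 \<le> n"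
  shows "graph_iso (edge_subgraph (cycle_edge n ` A)) (edge_subgraph (cycle_edge n ` B))"
proof -
  have one: "graph_iso (edge_subgraph (path_edge ` A)) (edge_subgraph (cycle_edge n ` A))"
    if m: "matched (int n) d A B f" for A B
  proof -
    note A = matchedD(1,3)[OF m]
    have no: "\<not> (0 \<in> A \<and> int n - 1 \<in> A)"
    proof
      assume h: "0 \<in> A \<and> int n - 1 \<in> A"
      \<comment> \<open>Edge 0 is next to the end \<open>-1\<close> and so carries the end
        reflection; hence its partner, which has the other color, is edge
        \<open>n - 1\<close>.\<close>
      have "f 0 = f (-1)" by (rule matchedD(11)[OF m]) (use h d positionsI in auto)
      then have "app_isom (f 0) 0 = int n - 1" using matchedD(4)[OF m] unfolding app_isom_def by simp
      then have "int n - 1 \<in> B" using matchedD(9)[OF m, of 0] h by simp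
      then show False using h A by blast
    qed
    have le: "v \<le> n" if "v \<in> \<Union>(path_edge ` A)" for v using that A(1)
      unfolding path_edge_verts[OF A(1)] by auto
    have zero: "0 \<in> \<Union>(path_edge ` A) \<Longrightarrow> 0 \<in> A" and last: "n \<in>
      \<Union>(path_edge ` A) \<Longrightarrow> int n - 1 \<in> A"
      using A(1) unfolding path_edge_verts[OF A(1)] by auto
    have mod: "v mod n = (if v = n then 0 else v)" if "v \<le> n" for v :: nat using that by auto
    have "inj_on (\<lambda>v. v mod n) (\<Union>(path_edge ` A))"
    proof (rule inj_onI)
      fix u v assume uv: "u \<in> \<Union>(path_edge ` A)" "v \<in> \<Union>(path_edge ` A)" "u mod n = v
        mod n"
      have "\<not> (u = 0 \<and> v = n)" "\<not> (u = n \<and> v = 0)"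
        using uv(1,2) zero last no by blast+
      then show "u = v" using uv(3) mod[OF le[OF uv(1)]] mod[OF le[OF uv(2)]] by (auto split: if_splits)
    qed
    from graph_iso_image[OF this] show ?thesis unfolding cycle_edge_def image_image .
  qed
  show ?thesis
    using graph_iso_trans[OF graph_iso_trans[OF graph_iso_sym[OF one[OF m]] matched_iso_path[OF m d]]
        one[OF matched_swap[OF m]]] .
qed

text \<open>The radius after \<open>i\<close> rounds is \<open>3 ^ (k - i)\<close>, which is still 1
  after round \<open>k\<close>. By \<open>2 * i + 3 \<le> 3 ^ (i + 1)\<close> and
  \<open>2 * d + 1 \<le> 3 * d\<close>, the covering condition of \<open>matched_step\<close>
  follows in every round from \<open>3 ^ (k + 1) < n\<close>.\<close>

lemma lower_bound:
  assumes G: "edges G = ed ` {0..<int n}" and inj: "inj_on ed {0..<int n}" and k: "3 ^ (k + 1) < n"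
    and iso: "\<And>d A B f. matched (int n) d A B f \<Longrightarrow> 1 \<le> d \<Longrightarrow>
      graph_iso (edge_subgraph (ed ` A)) (edge_subgraph (ed ` B))"
  shows "k \<le> game_length G"
proof -
  have fin: "finite (edges G)" unfolding G by simp
  have cardG: "card (edges G) = n" unfolding G using card_image[OF inj] by simp
  have kk: "2 * k + 1 \<le> 3 ^ k" for k :: nat by (induction k) auto
  define Inv where "Inv i A B \<longleftrightarrow> (\<exists>SA SB f. A = ed ` SA \<and> B = ed ` SB
    \<and> card SA = i \<and> card SB = i \<and>
    matched (int n) (3 ^ (k - i)) SA SB f)" for i A B
  show ?thesis
  proof (rule game_length_ge[OF fin, of k Inv])
    show "k \<le> card (edges G) div 2" unfolding cardG using k kk[of k] by simp
    have "(3::nat) ^ k \<le> n" using k by simp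
    then have "(3::int) ^ k \<le> int n" by (metis of_nat_le_iff of_nat_numeral of_nat_power)
    then have "matched (int n) (3 ^ k) {} {} (\<lambda>_. (-1, int n - 1))" by (intro matched_init) auto
    then show "Inv 0 {} {}" unfolding Inv_def by (intro exI[of _ "{}"]) auto
    show "graph_iso (edge_subgraph A) (edge_subgraph B)" if "i \<le> k" "Inv i A B" for i A B
      using that iso unfolding Inv_def by (metis one_le_numeral one_le_power)
    fix i A B a assume i: "i < k" and I: "Inv i A B" and a: "a \<in> edges G - (A \<union> B)"
    obtain SA SB f where S: "A = ed ` SA" "B = ed ` SB" "card SA = i" "card SB = i"
      "matched (int n) (3 ^ (k - i)) SA SB f" using I unfolding Inv_def by blast
    have sub: "SA \<subseteq> {0..<int n}" "SB \<subseteq> {0..<int n}" by (rule matchedD[OF S(5)])+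
    obtain x where x: "x \<in> {0..<int n}" "a = ed x" using a G by auto
    have xn: "x \<notin> SA" "x \<notin> SB" using a x S by auto
    define d :: int where "d = 3 ^ (k - Suc i)"
    have e: "(3::int) ^ (k - i) = 3 * d" unfolding d_def using i by (metis Suc_diff_Suc power_Suc)
    have d1: "1 \<le> d" unfolding d_def by simp
    have "(int i + int i + 3) * (2 * d + 1) \<le> 3 ^ (i + 1) * (3 * d)"
    proof (rule mult_mono)
      have "int (2 * (i + 1) + 1) \<le> int (3 ^ (i + 1))" using kk[of "i + 1"] by (rule of_nat_mono)
      then show "int i + int i + 3 \<le> 3 ^ (i + 1)" by simp
    qed (use d1 in auto)
    also have "\<dots> = 3 ^ (i + 1) * 3 ^ (k - i)" unfolding e ..
    also have "\<dots> = 3 ^ (k + 1)" using i by (simp add: power_add[symmetric])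
    also have "\<dots> < int n" using k by (metis of_nat_less_iff of_nat_numeral of_nat_power)
    finally have "(int (card SA) + int (card SB) + 3) * (2 * d + 1) < int n" unfolding S(3,4) .
    then obtain y f' where y: "0 \<le> y" "y < int n" "y \<notin> SA" "y \<notin> SB" "y \<noteq> x"
      "matched (int n) d (insert x SA) (insert y SB) f'"
      using matched_step[of "int n" d SA SB f x] S(5) x xn d1 unfolding e by auto
    have finS: "finite SA" "finite SB"
      using finite_subset[OF sub(1)] finite_subset[OF sub(2)] by simp_all
    show "\<exists>b\<in>edges G - insert a (A \<union> B). Inv (Suc i) (insert a A) (insert b B)"
    proof (rule bexI[of _ "ed y"])
      show "Inv (Suc i) (insert a A) (insert (ed y) B)"
        unfolding Inv_def
        by (rule exI[of _ "insert x SA"], rule exI[of _ "insert y SB"], rule exI[of _ f'])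
          (use S x xn y finS d_def in auto)
      have "ed y \<noteq> ed z" if "z \<in> insert x (SA \<union> SB)" for z
      proof -
        have "z \<in> {0..<int n}" "z \<noteq> y" using that sub x y by auto
        then show ?thesis using inj y(1,2) unfolding inj_on_def by auto
      qed
      then show "ed y \<in> edges G - insert a (A \<union> B)" using S x y G by auto
    qed
  qed
qed

lemma path_lower:
  assumes k: "3 ^ (k + 1) < n"
  shows "k \<le> game_length (path_graph n)"
proof (rule lower_bound[where ed = path_edge, OF _ _ k])
  have e: "path_edge (int i) = {i, Suc i}" for i unfolding path_edge_def by (simp add: nat_add_distrib)
  have "{0..<int n} = int ` {..<n}" by (simp add: lessThan_atLeast0 image_int_atLeastLessThan)
  then show "edges (path_graph n) = path_edge ` {0..<int n}" by (auto simp: path_graph_def image_image e)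
  show "inj_on path_edge {0..<int n}" unfolding inj_on_def path_edge_def doubleton_eq_iff by auto
qed (rule matched_iso_path)

lemma cycle_lower:
  assumes k: "3 ^ (k + 1) < n" and n: "3 \<le> n"
  shows "k \<le> game_length (cycle_graph n)"
proof (rule lower_bound[where ed = "cycle_edge n", OF _ _ k])
  have e: "cycle_edge n (int i) = {i, Suc i mod n}" if "i < n" for i
    using that unfolding cycle_edge_def path_edge_def by (simp add: nat_add_distrib)
  have I: "{0..<int n} = int ` {..<n}" by (simp add: lessThan_atLeast0 image_int_atLeastLessThan)
  then show edge: "edges (cycle_graph n) = cycle_edge n ` {0..<int n}"
    by (auto simp: cycle_graph_def image_image e)
  show "inj_on (cycle_edge n) {0..<int n}"
    by (rule eq_card_imp_inj_on) (use card_edges_cycle_graph[OF n] in \<open>simp_all add: edge\<close>)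
  show "graph_iso (edge_subgraph (cycle_edge n ` A)) (edge_subgraph (cycle_edge n ` B))"
    if "matched (int n) d A B f" "1 \<le> d" for d A B f
    by (rule matched_iso_cycle[OF that]) (use n in simp)
qed

section \<open>Boards and the type game\<close>

definition seg :: "int set \<Rightarrow> int \<Rightarrow> int \<Rightarrow> bool" where
  "seg S a p \<longleftrightarrow> 1 \<le> p \<and> (\<forall>z. a \<le> z \<and> z < a + p
    \<longrightarrow> z \<in> S) \<and> a - 1 \<notin> S \<and> a + p \<notin> S"

definition runs :: "int set \<Rightarrow> int \<Rightarrow> int \<Rightarrow> int \<Rightarrow> bool" where
  "runs S x l r \<longleftrightarrow> 0 \<le> l \<and> 0 \<le> r \<and> (\<forall>z. x - l \<le> z \<and> z
    < x \<longrightarrow> z \<in> S) \<and> x - l - 1 \<notin> S \<and>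
     (\<forall>z. x < z \<and> z \<le> x + r \<longrightarrow> z \<in> S) \<and> x + r + 1 \<notin> S"

text \<open>The unordered pair of run lengths beside a cell tells which component sizes a move
  joins, with 0 for no component. The order is dropped because an isomorphism does not see
  orientation.\<close>

definition same_type :: "int set \<Rightarrow> int \<Rightarrow> int set \<Rightarrow> int \<Rightarrow>
  bool" where
  "same_type R x B y \<longleftrightarrow> (\<exists>l r. runs R x l r \<and> (runs B y l r \<or> runs B y
    r l))"

definition longer_than :: "int set \<Rightarrow> int \<Rightarrow> bool" where
  "longer_than S t \<longleftrightarrow> (\<forall>a p. seg S a p \<longrightarrow> t < p)"

lemma runs_unique:
  assumes "runs S x l r" "runs S x l' r'"
  shows "l = l' \<and> r = r'"
proof -
  have "\<not> l < l'"
  proof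
    assume "l < l'"
    then have "x - l - 1 \<in> S" using assms unfolding runs_def by (auto dest!: spec[of _ "x - l - 1"])
    then show False using assms(1) unfolding runs_def by blast
  qed
  moreover have "\<not> l' < l"
  proof
    assume "l' < l"
    then have "x - l' - 1 \<in> S" using assms unfolding runs_def by (auto dest!: spec[of _ "x - l' - 1"])
    then show False using assms(2) unfolding runs_def by blast
  qed
  moreover have "\<not> r < r'"
  proof
    assume "r < r'"
    then have "x + r + 1 \<in> S" using assms unfolding runs_def by (auto dest!: spec[of _ "x + r + 1"])
    then show False using assms(1) unfolding runs_def by blast
  qed
  moreover have "\<not> r' < r"
  proof
    assume "r' < r"
    then have "x + r' + 1 \<in> S" using assms unfolding runs_def by (auto dest!: spec[of _ "x + r' + 1"])
    then show False using assms(2) unfolding runs_def by blast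
  qed
  ultimately show ?thesis by linarith
qed

lemma runs_seg_left: "runs S x l r \<Longrightarrow> 1 \<le> l \<Longrightarrow> x \<notin> S
  \<Longrightarrow> seg S (x - l) l"
  by (simp add: runs_def seg_def)

lemma runs_seg_right: "runs S x l r \<Longrightarrow> 1 \<le> r \<Longrightarrow> x \<notin> S
  \<Longrightarrow> seg S (x + 1) r"
  by (simp add: runs_def seg_def algebra_simps)

lemma same_typeD: "same_type R x B y \<Longrightarrow> runs R x l r \<Longrightarrow> runs B y l r \<or>
  runs B y r l"
  unfolding same_type_def using runs_unique by blast

text \<open>
  Cells are edges. They are indexed by integers modulo \<open>N\<close>, and a set of cells is
  represented by the periodic set of all its indices, so that a cycle can be read locally as a line. A
  path with \<open>n\<close> edges is the board with \<open>N = n + 1\<close> in which the cell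
  \<open>-1\<close> is a wall.
\<close>

locale board =
  fixes N :: int and W :: "int set"
  assumes N3: "3 \<le> N"
begin

definition periodic :: "int set \<Rightarrow> bool" where
  "periodic S \<longleftrightarrow> (\<forall>x y. x mod N = y mod N \<longrightarrow> x \<in> S
    \<longrightarrow> y \<in> S)"

definition cell :: "int \<Rightarrow> int set" where
  "cell x = {y. y mod N = x mod N}"

definition arc :: "int \<Rightarrow> int \<Rightarrow> int set" where
  "arc x j = {y. \<exists>z. x \<le> z \<and> z < x + j \<and> y mod N = z mod N}"

definition valid :: "int set \<Rightarrow> int set \<Rightarrow> bool" where
  "valid R B \<longleftrightarrow> periodic R \<and> periodic B \<and> periodic W \<and> R \<inter> B = {}
    \<and> R \<inter> W = {} \<and> B \<inter> W = {}"

definition free :: "int set \<Rightarrow> int set \<Rightarrow> int \<Rightarrow> bool" where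
  "free R B x \<longleftrightarrow> x \<notin> R \<and> x \<notin> B \<and> x \<notin> W"

text \<open>
  The first player wins within \<open>m\<close> rounds if the second player may answer only by moves of
  the same type; isomorphism of the colored subgraphs implies this condition.
\<close>

inductive wins :: "nat \<Rightarrow> int set \<Rightarrow> int set \<Rightarrow> bool" where
  "free R B x \<Longrightarrow>
   (\<And>y. free R B y \<Longrightarrow> y \<notin> cell x \<Longrightarrow> same_type R x B y
     \<Longrightarrow> wins m (R \<union> cell x) (B \<union> cell y)) \<Longrightarrow>
   wins (Suc m) R B"

lemma winsI:
  assumes "free R B x" "1 \<le> m"
    "\<And>y. free R B y \<Longrightarrow> y \<notin> cell x \<Longrightarrow> same_type R x B y
      \<Longrightarrow> wins (m - 1) (R \<union> cell x) (B \<union> cell y)"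
  shows "wins m R B"
  using wins.intros[of R B x "m - 1"] assms by simp

lemma wins_mono: "wins m R B \<Longrightarrow> m \<le> m' \<Longrightarrow> wins m' R B"
proof (induction arbitrary: m' rule: wins.induct)
  case (1 R B x m)
  show ?case
    by (rule winsI[of _ _ x]) (use 1 in auto)
qed

section \<open>Periodic sets, cells and arcs\<close>

lemma periodic_iff: "periodic S \<Longrightarrow> x mod N = y mod N \<Longrightarrow> x \<in> S
  \<longleftrightarrow> y \<in> S"
  unfolding periodic_def by metis

lemma periodic_cell [simp]: "periodic (cell x)" unfolding periodic_def cell_def by simp
lemma periodic_arc [simp]: "periodic (arc x j)" unfolding periodic_def arc_def by auto
lemma periodic_Un: "periodic S \<Longrightarrow> periodic T \<Longrightarrow> periodic (S \<union> T)"
  unfolding periodic_def by blast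
lemma periodic_empty [simp]: "periodic {}" unfolding periodic_def by simp

lemma cell_eq: "x mod N = y mod N \<Longrightarrow> cell x = cell y" unfolding cell_def by simp

lemma periodic_shift: "periodic S \<Longrightarrow> x + k * N \<in> S \<longleftrightarrow> x \<in> S"
  by (rule periodic_iff) simp_all

lemma seg_shift: "periodic S \<Longrightarrow> seg S (a + k * N) p \<longleftrightarrow> seg S a p"
proof -
  have *: "seg S (a + k * N) p" if S: "periodic S" and h: "seg S a p" for a k
  proof -
    have "z \<in> S" if "a + k * N \<le> z" "z < a + k * N + p" for z
    proof -
      have "z - k * N \<in> S" using h that unfolding seg_def by (auto dest!: spec[of _ "z - k*N"])
      then show ?thesis using periodic_shift[OF S, of "z - k*N" k] by simp
    qed
    moreover have "a + k * N - 1 \<notin> S"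
      using h periodic_shift[OF S, of "a - 1" k] unfolding seg_def by (simp add: algebra_simps)
    moreover have "a + k * N + p \<notin> S"
      using h periodic_shift[OF S, of "a + p" k] unfolding seg_def by (simp add: algebra_simps)
    ultimately show ?thesis using h unfolding seg_def by blast
  qed
  assume S: "periodic S"
  show ?thesis
  proof
    assume "seg S (a + k * N) p"
    from *[OF S this, of "-k"] show "seg S a p" by simp
  qed (rule *[OF S])
qed

lemma free_shift: "valid R B \<Longrightarrow> free R B (x + k * N) \<longleftrightarrow> free R B x"
  unfolding free_def valid_def using periodic_shift by blast

lemma free_cong: "valid R B \<Longrightarrow> x mod N = y mod N \<Longrightarrow> free R B x
  \<longleftrightarrow> free R B y"
  unfolding free_def valid_def using periodic_iff by blast

lemma modE:
  assumes "x mod N = y mod N" obtains k where "x = y + k * N"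
proof -
  have "N dvd x - y" using assms by (simp add: mod_eq_dvd_iff)
  then obtain k where "x - y = N * k" by (rule dvdE)
  then show ?thesis using that[of k] by (simp add: algebra_simps)
qed

lemma mod_eq_near:
  assumes "x mod N = y mod N" "\<bar>x - y\<bar> < N" shows "x = (y::int)"
proof -
  obtain k where k: "x = y + k * N" using modE[OF assms(1)] .
  then have "\<bar>k\<bar> * N < 1 * N" using assms(2) N3 by (simp add: abs_mult)
  then have "k = 0" using N3 by (subst (asm) mult_less_cancel_right) auto
  then show ?thesis using k by simp
qed

lemma arc_iff: "y \<in> arc x j \<longleftrightarrow> (\<exists>k. x \<le> y + k * N \<and> y + k * N < x +
  j)"
proof
  assume "y \<in> arc x j"
  then obtain z where z: "x \<le> z" "z < x + j" "z mod N = y mod N" unfolding arc_def by auto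
  obtain k where "z = y + k * N" using modE[OF z(3)] .
  then show "\<exists>k. x \<le> y + k * N \<and> y + k * N < x + j" using z by blast
next
  assume "\<exists>k. x \<le> y + k * N \<and> y + k * N < x + j"
  then obtain k where "x \<le> y + k * N \<and> y + k * N < x + j" by blast
  then show "y \<in> arc x j" unfolding arc_def by (auto intro!: exI[of _ "y + k * N"])
qed

lemma arcE:
  assumes "y \<in> arc x j" obtains k where "x \<le> y + k * N" "y + k * N < x + j"
  using assms arc_iff by blast

lemma arcI: "x \<le> y \<Longrightarrow> y < x + j \<Longrightarrow> y \<in> arc x j"
  unfolding arc_def by auto

lemma not_arc:
  assumes "x + j \<le> y" "y < x + N" shows "y \<notin> arc x j"
proof
  assume "y \<in> arc x j"
  then obtain z where z: "x \<le> z" "z < x + j" "y mod N = z mod N" unfolding arc_def by auto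
  have "y = z" by (rule mod_eq_near[OF z(3)]) (use z assms in auto)
  then show False using z assms by simp
qed

lemma not_arc':
  assumes "y < x" "x + j \<le> y + N" shows "y \<notin> arc x j"
proof
  assume "y \<in> arc x j"
  then obtain z where z: "x \<le> z" "z < x + j" "y mod N = z mod N" unfolding arc_def by auto
  have "y = z" by (rule mod_eq_near[OF z(3)]) (use z assms in auto)
  then show False using z assms by simp
qed

lemma arc_full: "N \<le> j \<Longrightarrow> y \<in> arc x j"
proof -
  assume j: "N \<le> j"
  have "(y - x) mod N < N" "0 \<le> (y - x) mod N" using N3 by auto
  moreover have "y mod N = (x + (y - x) mod N) mod N" by (simp add: mod_simps)
  ultimately show ?thesis unfolding arc_def using j by (auto intro!: exI[of _ "x + (y - x) mod N"])
qed

lemma arc_1: "arc x 1 = cell x"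
  unfolding arc_def cell_def by (auto intro: antisym)

lemma arc_right: "0 \<le> j \<Longrightarrow> arc x (j + 1) = arc x j \<union> cell (x + j)"
proof -
  assume "0 \<le> j"
  then have "x \<le> z \<and> z < x + (j + 1) \<longleftrightarrow> x \<le> z \<and> z < x + j \<or> z = x
    + j" for z by auto
  then show ?thesis unfolding arc_def cell_def by blast
qed

lemma arc_left: "0 \<le> j \<Longrightarrow> arc (x - 1) (j + 1) = arc x j \<union> cell (x - 1)"
proof -
  assume "0 \<le> j"
  then have "x - 1 \<le> z \<and> z < x - 1 + (j + 1) \<longleftrightarrow> x \<le> z \<and> z < x + j
    \<or> z = x - 1" for z by auto
  then show ?thesis unfolding arc_def cell_def by blast
qed

lemma arc_cong: "x mod N = y mod N \<Longrightarrow> arc x j = arc y j"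
proof -
  assume "x mod N = y mod N"
  then obtain k where k: "x = y + k * N" by (rule modE)
  have "\<exists>k'. y \<le> z + k' * N \<and> z + k' * N < y + j"
    if "x \<le> z + i * N" "z + i * N < x + j" for z i
    using that k by (intro exI[of _ "i - k"]) (simp add: algebra_simps)
  moreover have "\<exists>k'. x \<le> z + k' * N \<and> z + k' * N < x + j"
    if "y \<le> z + i * N" "z + i * N < y + j" for z i
    using that k by (intro exI[of _ "i + k"]) (simp add: algebra_simps)
  ultimately show ?thesis unfolding set_eq_iff arc_iff by blast
qed

lemma valid_cell:
  assumes "valid R B" "free R B x" "free R B y" "y \<notin> cell x"
  shows "valid (R \<union> cell x) (B \<union> cell y)"
proof -
  have f: "free R B z" if "z \<in> cell x \<or> z \<in> cell y" for z
  proof -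
    have "z mod N = x mod N \<or> z mod N = y mod N" using that unfolding cell_def by simp
    then show ?thesis using free_cong[OF assms(1)] assms(2,3) by blast
  qed
  have d: "cell x \<inter> cell y = {}" using assms(4) unfolding cell_def by auto
  show ?thesis using assms(1) f d unfolding valid_def free_def
    by (intro conjI periodic_Un) auto
qed

text \<open>The cells on both sides of the arc are outside \<open>S\<close>, so the arc becomes a
  component of its own and all others keep their lengths. The bound \<open>j < N\<close> prevents
  the arc from closing up around the board.\<close>

lemma seg_add_iff:
  assumes S: "periodic S" and "1 \<le> j" "j < N" and run: "\<And>z. y \<le> z \<Longrightarrow> z < y + j
    \<Longrightarrow> z \<notin> S"
    and ends: "y - 1 \<notin> S" "y + j \<notin> S"
  shows "seg (S \<union> arc y j) a p \<longleftrightarrow> seg S a p \<or> p = j \<and> a mod N = y mod N"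
proof -
  let ?T = "S \<union> arc y j"
  have T: "periodic ?T" by (intro periodic_Un S periodic_arc)
  have yl: "y - 1 \<notin> arc y j" by (rule not_arc') (use assms in auto)
  have yr: "y + j \<notin> arc y j" by (rule not_arc) (use assms in auto)
  have segy: "seg ?T y j" using assms yl yr unfolding seg_def by (auto intro: arcI)
  have nxt: "z + 1 \<notin> S" if "z \<in> arc y j" for z
  proof -
    obtain k where u: "y \<le> z + k * N" "z + k * N < y + j" using \<open>z \<in> arc y j\<close>
      by (rule arcE)
    have "z + k * N + 1 \<notin> S" using run[of "z + k * N + 1"] ends u
      by (cases "z + k * N + 1 = y + j") auto
    then show ?thesis using periodic_shift[OF S, of "z + 1" k] by (simp add: algebra_simps)
  qed
  have prv: "z - 1 \<notin> S" if "z \<in> arc y j" for z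
  proof -
    obtain k where u: "y \<le> z + k * N" "z + k * N < y + j" using \<open>z \<in> arc y j\<close>
      by (rule arcE)
    have "z + k * N - 1 \<notin> S" using run[of "z + k * N - 1"] ends u by (cases "z + k * N = y") auto
    then show ?thesis using periodic_shift[OF S, of "z - 1" k] by (simp add: algebra_simps)
  qed
  show ?thesis
  proof
    assume h: "seg S a p \<or> p = j \<and> a mod N = y mod N"
    then show "seg ?T a p"
    proof
      assume h: "seg S a p"
      have "a - 1 \<notin> arc y j" using nxt[of "a - 1"] h unfolding seg_def by auto
      moreover have "a + p \<notin> arc y j" using prv[of "a + p"] h unfolding seg_def by auto
      ultimately show ?thesis using h unfolding seg_def by auto
    next
      assume "p = j \<and> a mod N = y mod N"
      then obtain k where "a = y + k * N" "p = j" using modE by blast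
      then show ?thesis using seg_shift[OF T, of y k j] segy by simp
    qed
  next
    assume h: "seg ?T a p"
    show "seg S a p \<or> p = j \<and> a mod N = y mod N"
    proof (cases "a \<in> arc y j")
      case True
      then obtain k where u: "y \<le> a + k * N" "a + k * N < y + j" by (rule arcE)
      define u where "u = a + k * N"
      have u: "y \<le> u" "u < y + j" "a mod N = u mod N" using u unfolding u_def by auto
      have hu: "seg ?T u p" using seg_shift[OF T, of a k p] h unfolding u_def by simp
      have "u = y"
      proof (rule ccontr)
        assume "u \<noteq> y"
        then have "u - 1 \<in> arc y j" using u by (intro arcI) auto
        then show False using hu unfolding seg_def by auto
      qed
      then have hy: "seg ?T y p" using hu by simp
      have "\<not> p < j" using hy arcI[of y "y + p" j] unfolding seg_def by auto
      moreover have "\<not> j < p"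
      proof
        assume "j < p"
        then have "y + j \<in> ?T" using hy assms(2) unfolding seg_def by (auto dest!: spec[of _ "y + j"])
        then show False using ends yr by simp
      qed
      ultimately have "p = j" by simp
      moreover have "a mod N = y mod N" using u(3) unfolding \<open>u = y\<close> .
      ultimately show ?thesis by blast
    next
      case False
      \<comment> \<open>A run that starts outside the arc never enters it, because the cell before
        an arc cell is not in \<open>S\<close>.\<close>
      have "a + int i < a + p \<longrightarrow> a + int i \<in> S \<and> a + int i \<notin> arc y j" for i
      proof (induction i)
        case 0
        have "a \<in> ?T" using h unfolding seg_def by (auto dest!: spec[of _ a])
        then show ?case using False by simp
      next
        case (Suc i)
        show ?case
        proof
          assume l: "a + int (Suc i) < a + p"
          then have i: "a + int i \<in> S" using Suc by simp
          have "a + int (Suc i) \<notin> arc y j" using prv[of "a + int (Suc i)"] i by auto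
          moreover have "a + int (Suc i) \<in> ?T" using h l unfolding seg_def
            by (auto dest!: spec[of _ "a + int (Suc i)"])
          ultimately show "a + int (Suc i) \<in> S \<and> a + int (Suc i) \<notin> arc y j" by simp
        qed
      qed
      note c = this
      have "z \<in> S" if "a \<le> z" "z < a + p" for z
        using c[of "nat (z - a)"] that by simp
      then have "seg S a p" using h unfolding seg_def by auto
      then show ?thesis ..
    qed
  qed
qed

lemma arc_disjoint:
  assumes "periodic S" "\<And>z. y \<le> z \<Longrightarrow> z < y + j \<Longrightarrow> z \<notin> S" "u
    \<in> S"
  shows "u \<notin> arc y j"
proof
  assume "u \<in> arc y j"
  then obtain k where k: "y \<le> u + k * N" "u + k * N < y + j" by (rule arcE)
  then have "u + k * N \<notin> S" by (rule assms(2))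
  then show False using assms(3) periodic_shift[OF assms(1), of u k] by simp
qed

lemma arc_subset: "L \<le> x \<Longrightarrow> x + j \<le> H \<Longrightarrow> arc x j \<subseteq> arc L (H
  - L)"
  by (auto simp: subset_iff arc_iff intro: order_trans order_less_le_trans)

lemma valid_arc:
  assumes g: "valid R B"
    and x: "\<And>z. x \<le> z \<Longrightarrow> z < x + i \<Longrightarrow> free R B z"
    and y: "\<And>z. y \<le> z \<Longrightarrow> z < y + j \<Longrightarrow> free R B z \<and> z \<notin>
      arc x i"
  shows "valid (R \<union> arc x i) (B \<union> arc y j)"
proof -
  have p: "periodic R" "periodic B" "periodic W" using g unfolding valid_def by auto
  have "u \<notin> arc x i" if "u \<in> R \<union> B \<union> W" for u
    by (rule arc_disjoint[OF _ _ that]) (use p x in \<open>auto intro!: periodic_Un simp: free_def\<close>)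
  moreover have "u \<notin> arc y j" if "u \<in> R \<union> B \<union> W \<union> arc x i" for u
    by (rule arc_disjoint[OF _ _ that]) (use p y in \<open>auto intro!: periodic_Un simp: free_def\<close>)
  ultimately show ?thesis using g unfolding valid_def by (intro conjI periodic_Un periodic_arc) auto
qed

section \<open>Forced replies\<close>

lemma place:
  assumes "free R B x" "x - 1 \<notin> R" "x + 1 \<notin> R"
    and cont: "\<And>y. free R B y \<Longrightarrow> y \<notin> cell x \<Longrightarrow> y - 1 \<notin> B
      \<Longrightarrow> y + 1 \<notin> B \<Longrightarrow>
      wins m (R \<union> arc x 1) (B \<union> arc y 1)"
  shows "wins (Suc m) R B"
proof (rule wins.intros[OF assms(1)])
  fix y assume y: "free R B y" "y \<notin> cell x" "same_type R x B y"
  have "runs R x 0 0" using assms unfolding runs_def by auto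
  then have "runs B y 0 0" using same_typeD[OF y(3)] by blast
  then show "wins m (R \<union> cell x) (B \<union> cell y)"
    using cont[OF y(1,2)] unfolding runs_def arc_1 by simp
qed

text \<open>
  Each extension of the red block has to be answered by an extension of the only blue component of the
  same length. That component stays outside the free region from \<open>L\<close> to \<open>H\<close>,
  since it could enter only next to the red block or past a cell that is not free.
\<close>

lemma grow:
  assumes valid: "valid R B" and bt: "longer_than B t" and s: "s \<le> t"
    and fr: "\<And>z. L \<le> z \<Longrightarrow> z < H \<Longrightarrow> free R B z"
    and isoX: "X - 1 \<notin> R" "X + s \<notin> R" and LX: "L \<le> X" "X + s \<le> H"
    and cont: "\<And>y'. y' \<le> yi \<Longrightarrow> yi < y' + s \<Longrightarrow>
      (\<And>z. y' \<le> z \<Longrightarrow> z < y' + s \<Longrightarrow> free R B z \<and> z \<notin> arc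
        L (H - L)) \<Longrightarrow>
      y' - 1 \<notin> B \<Longrightarrow> y' + s \<notin> B \<Longrightarrow> wins m (R \<union> arc X s)
        (B \<union> arc y' s)"
    and "1 \<le> j" "X \<le> x" "x + j \<le> X + s"
    and "\<And>z. y \<le> z \<Longrightarrow> z < y + j \<Longrightarrow> free R B z \<and> z \<notin> arc
      L (H - L)"
    and "y - 1 \<notin> B" "y + j \<notin> B" "y \<le> yi" "yi < y + j"
    and "x = L \<or> \<not> free R B (L - 1)" "x + j = H \<or> \<not> free R B H"
    and "s - j = int d"
  shows "wins (m + d) (R \<union> arc x j) (B \<union> arc y j)"
  using assms(10-)
proof (induction d arbitrary: x y j)
  case 0
  then have "x = X" "s = j" by auto
  then show ?case using cont[of y] 0 by simp
next
  case (Suc d)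
  note j = Suc.prems(1) and x = Suc.prems(2,3) and y = Suc.prems(4) and yi = Suc.prems(5,6)
    and y0 = Suc.prems(7,8) and gl = Suc.prems(9) and gr = Suc.prems(10) and sj = Suc.prems(11)
  let ?R = "R \<union> arc x j" and ?B = "B \<union> arc y j"
  have p: "periodic R" "periodic B" "periodic W" using valid unfolding valid_def by auto
  have HL: "H - L < N"
  proof (rule ccontr)
    assume "\<not> ?thesis"
    then have "y \<in> arc L (H - L)" by (intro arc_full) simp
    then show False using y[of y] j by simp
  qed
  have sub: "arc x j \<subseteq> arc L (H - L)" by (rule arc_subset) (use x LX in auto)
  have valid': "valid ?R ?B"
    by (rule valid_arc[OF valid]) (use y fr x LX sub in auto)
  have jN: "j < N" using x LX HL by linarith
  have frB: "free R B u \<and> u \<notin> arc x j" if "free ?R ?B u" for u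
    using that unfolding free_def by auto
  have reply: "wins (m + d) (?R \<union> cell c) (?B \<union> cell y1)"
    if R': "?R \<union> cell c = R \<union> arc x' (j + 1)" and t: "runs ?R c j 0 \<or> runs ?R c 0 j"
      and x': "X \<le> x'" "x' + (j + 1) \<le> X + s" "x' = L \<or> \<not> free R B (L - 1)"
        "x' + (j + 1) = H \<or> \<not> free R B H"
      and y1: "free ?R ?B y1" "same_type ?R c ?B y1"
    for c x' y1
  proof -
    have ty1: "runs ?B y1 j 0 \<or> runs ?B y1 0 j"
      using t same_typeD[OF y1(2)] by blast
    \<comment> \<open>All older blue components are longer than \<open>t\<close> and hence longer
      than \<open>j\<close>, so the one at \<open>y\<close> is the only one that the reply can
      extend.\<close>
    have segj: "a mod N = y mod N" if "seg ?B a j" for a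
    proof -
      have "seg B a j \<or> j = j \<and> a mod N = y mod N"
        using that by (subst (asm) seg_add_iff) (use p j jN y yi in \<open>auto simp: free_def\<close>)
      moreover have "\<not> seg B a j" using bt j sj s unfolding longer_than_def by fastforce
      ultimately show ?thesis by blast
    qed
    have y1B: "y1 \<notin> ?B" using y1(1) unfolding free_def by simp
    show ?thesis
    proof (cases "runs ?B y1 j 0")
      case True
      have "seg ?B (y1 - j) j" by (rule runs_seg_left[OF True j y1B])
      then have "(y1 - j) mod N = y mod N" by (rule segj)
      then obtain k where "y1 - j = y + k * N" by (rule modE)
      then have k: "y1 = (y + j) + k * N" by simp
      then have cl: "cell y1 = cell (y + j)" by (intro cell_eq) simp
      have fy: "free R B (y + j) \<and> y + j \<notin> arc x j"
        using y1(1) k free_shift[OF valid, of "y + j" k] periodic_shift[OF periodic_arc, of "y + j" k x j]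
        unfolding free_def by auto
      \<comment> \<open>The blue block could enter the region at its left end only by coming from
        \<open>L - 1\<close>, which would then be free in \<open>R\<close> and \<open>B\<close>. In
        this case the red block starts at \<open>L\<close>, so \<open>L\<close> is taken. The right
        end is symmetric.\<close>
      have nl: "y + j \<notin> arc L (H - L)"
      proof
        assume "y + j \<in> arc L (H - L)"
        then obtain i where i: "L \<le> y + j + i * N" "y + j + i * N < L + (H - L)" by (rule arcE)
        have "y + j - 1 \<notin> arc L (H - L)" and f1: "free R B (y + j - 1)" using y[of "y + j - 1"] j
          by auto
        then have "\<not> L \<le> y + j - 1 + i * N" using i unfolding arc_iff by auto
        then have e: "y + j + i * N = L" using i by simp
        then have e1: "(y + j - 1) + i * N = L - 1" by simp
        have "free R B (L - 1)" using f1 free_shift[OF valid, of "y + j - 1" i] unfolding e1 by simp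
        then have "x = L" using gl by blast
        then have "L \<in> arc x j" using j by (intro arcI) auto
        then show False using fy periodic_shift[OF periodic_arc, of "y + j" i x j] unfolding e by simp
      qed
      moreover have "y + (j + 1) \<notin> B"
      proof -
        have "y1 + 1 \<notin> B" using True unfolding runs_def by auto
        then show ?thesis using k periodic_shift[OF p(2), of "y + (j + 1)" k] by (simp add: algebra_simps)
      qed
      ultimately have "wins (m + d) (R \<union> arc x' (j + 1)) (B \<union> arc y (j + 1))"
      proof (intro Suc.IH)
        fix z assume "y \<le> z" "z < y + (j + 1)"
        then show "free R B z \<and> z \<notin> arc L (H - L)"
          using y[of z] fy nl by (cases "z = y + j") auto
      qed (use x' yi y0 j sj in auto)
      moreover have "?B \<union> cell y1 = B \<union> arc y (j + 1)"
        using cl arc_right[of j y] j by auto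
      ultimately show ?thesis using R' by simp
    next
      case False
      then have t': "runs ?B y1 0 j" using ty1 by blast
      have "seg ?B (y1 + 1) j" by (rule runs_seg_right[OF t' j y1B])
      then have "(y1 + 1) mod N = y mod N" by (rule segj)
      then obtain k where "y1 + 1 = y + k * N" by (rule modE)
      then have k: "y1 = (y - 1) + k * N" by simp
      then have cl: "cell y1 = cell (y - 1)" by (intro cell_eq) simp
      have fy: "free R B (y - 1) \<and> y - 1 \<notin> arc x j"
        using y1(1) k free_shift[OF valid, of "y - 1" k] periodic_shift[OF periodic_arc, of "y - 1" k x j]
        unfolding free_def by auto
      have nl: "y - 1 \<notin> arc L (H - L)"
      proof
        assume "y - 1 \<in> arc L (H - L)"
        then obtain i where i: "L \<le> y - 1 + i * N" "y - 1 + i * N < L + (H - L)" by (rule arcE)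
        have "y \<notin> arc L (H - L)" and f1: "free R B y" using y[of "y"] j by auto
        then have "\<not> y + i * N < H" using i unfolding arc_iff by auto
        then have e: "y + i * N = H" using i by simp
        have "free R B H" using f1 free_shift[OF valid, of "y" i] unfolding e by simp
        then have "x + j = H" using gr by blast
        then have "H - 1 \<in> arc x j" using j by (intro arcI) auto
        moreover have e1: "y - 1 + i * N = H - 1" using e by simp
        ultimately show False using fy periodic_shift[OF periodic_arc, of "y - 1" i x j] unfolding e1 by simp
      qed
      moreover have "y - 1 - 1 \<notin> B"
      proof -
        have "y1 - 1 \<notin> B" using t' unfolding runs_def by auto
        then show ?thesis using k periodic_shift[OF p(2), of "y - 1 - 1" k] by (simp add: algebra_simps)
      qed
      ultimately have "wins (m + d) (R \<union> arc x' (j + 1)) (B \<union> arc (y - 1) (j + 1))"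
      proof (intro Suc.IH)
        fix z assume "y - 1 \<le> z" "z < y - 1 + (j + 1)"
        then show "free R B z \<and> z \<notin> arc L (H - L)"
          using y[of z] fy nl by (cases "z = y - 1") auto
      qed (use x' yi y0 j sj in auto)
      moreover have "?B \<union> cell y1 = B \<union> arc (y - 1) (j + 1)"
        using cl arc_left[of j y] j by auto
      ultimately show ?thesis using R' by simp
    qed
  qed
  have fR: "z \<notin> R" if "X \<le> z" "z < X + s" for z
    using fr[of z] that LX unfolding free_def by auto
  have fI: "free ?R ?B z" if "L \<le> z" "z < H" "z \<notin> arc x j" for z
  proof -
    have "z \<in> arc L (H - L)" using that by (intro arcI) auto
    then have "z \<notin> arc y j" using arc_disjoint[OF periodic_arc, of y j L "H - L" z] y by blast
    then show ?thesis using fr[OF that(1,2)] that(3) unfolding free_def by auto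
  qed
  have xl: "x - 1 \<notin> R" using fR[of "x - 1"] isoX x j by (cases "x = X") auto
  have xr: "x + j \<notin> R" using fR[of "x + j"] isoX x j by (cases "x + j = X + s") auto
  have xl': "x - 1 \<notin> arc x j" by (rule not_arc') (use jN in auto)
  have xr': "x + j \<notin> arc x j" by (rule not_arc) (use jN j in auto)
  have sN: "s < N" using LX HL by linarith
  show ?case
  \<comment> \<open>The block grows to the right until it reaches \<open>X + s\<close>, and only
    then to the left down to \<open>X\<close>.\<close>
  proof (cases "x + j < X + s")
    case True
    have t: "runs ?R (x + j) j 0"
    proof -
      have "x + j + 1 \<notin> R" using fR[of "x + j + 1"] isoX x j True by (cases "x + j + 1 = X + s") auto
      moreover have "x + j + 1 \<notin> arc x j" by (rule not_arc) (use sN sj j in auto)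
      ultimately show ?thesis using xl xl' j unfolding runs_def by (auto intro: arcI)
    qed
    have "wins (Suc (m + d)) ?R ?B"
    proof (rule wins.intros)
      show "free ?R ?B (x + j)" by (rule fI) (use x LX True j xr' in auto)
      fix y1 assume "free ?R ?B y1" "same_type ?R (x + j) ?B y1"
      then show "wins (m + d) (?R \<union> cell (x + j)) (?B \<union> cell y1)"
        by (intro reply[of _ x]) (use t x gl gr True LX j arc_right[of j x] in auto)
    qed
    then show ?thesis by simp
  next
    case False
    then have e: "x + j = X + s" and xX: "X < x" using x sj by auto
    have t: "runs ?R (x - 1) 0 j"
    proof -
      have "x - 2 \<notin> R" using fR[of "x - 2"] isoX x j xX by (cases "x - 1 = X") auto
      moreover have "x - 2 \<notin> arc x j" by (rule not_arc') (use sN sj j in auto)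
      ultimately show ?thesis using xr xr' j unfolding runs_def by (auto intro: arcI)
    qed
    have "wins (Suc (m + d)) ?R ?B"
    proof (rule wins.intros)
      show "free ?R ?B (x - 1)" by (rule fI) (use x LX xX j xl' in auto)
      fix y1 assume "free ?R ?B y1" "same_type ?R (x - 1) ?B y1"
      then show "wins (m + d) (?R \<union> cell (x - 1)) (?B \<union> cell y1)"
        by (intro reply[of _ "x - 1"]) (use t x gl gr e xX LX j arc_left[of j x] in auto)
    qed
    then show ?thesis by simp
  qed
qed

end

section \<open>Gaps between red components\<close>

text \<open>
  A plan to win in \<open>m\<close> rounds with a gap of length \<open>g\<close>, when all components
  are longer than \<open>t\<close>: a block of length \<open>s\<close> leaves gaps \<open>d1\<close> and
  \<open>d2\<close>. If the second player answers the first cell of the block to its right inside the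
  gap, then the block grows to the left instead, to length \<open>sL\<close>. The length 2 admits no
  plan.
\<close>

inductive gap_plan :: "int \<Rightarrow> int \<Rightarrow> nat \<Rightarrow> bool" where
  one: "1 \<le> m \<Longrightarrow> gap_plan 1 t m"
| split: "1 \<le> sL \<Longrightarrow> sL \<le> s \<Longrightarrow> s \<le> t \<Longrightarrow> gap_plan d1
  (s - 1) m \<Longrightarrow> gap_plan d2 (s - 1) m \<Longrightarrow>
    gap_plan (d1 - sL + 1) (sL - 1) m \<Longrightarrow> m + nat s \<le> m' \<Longrightarrow> gap_plan (d1 +
      s + d2) t m'"

lemma gap_plan_pos: "gap_plan g t m \<Longrightarrow> 1 \<le> g \<and> 1 \<le> m"
  by (induction rule: gap_plan.induct) auto

lemma seg_left_unique: "seg S a p \<Longrightarrow> seg S a q \<Longrightarrow> p = q"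
proof -
  have "\<not> p < q" if "seg S a p" "seg S a q" for p q
    using that unfolding seg_def by (auto dest!: spec[of _ "a + p"])
  then show "seg S a p \<Longrightarrow> seg S a q \<Longrightarrow> p = q" by (metis linorder_neqE)
qed

lemma seg_right_unique: "seg S (c - p) p \<Longrightarrow> seg S (c - q) q \<Longrightarrow> p = q"
proof -
  have "\<not> p < q" if "seg S (c - p) p" "seg S (c - q) q" for p q
    using that unfolding seg_def by (auto dest!: spec[of _ "c - p - 1"])
  then show "seg S (c - p) p \<Longrightarrow> seg S (c - q) q \<Longrightarrow> p = q"
    by (metis linorder_neqE)
qed

lemma runs_left_seg:
  assumes "runs S x l r" "seg S (x - s) s" shows "l = s"
proof -
  have "\<not> l < s" using assms unfolding runs_def seg_def by (auto dest!: spec[of _ "x - l - 1"])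
  moreover have "\<not> s < l" using assms unfolding runs_def seg_def by (auto dest!: spec[of _ "x - s - 1"])
  ultimately show ?thesis by simp
qed

lemma runs_right_seg:
  assumes "runs S x l r" "seg S (x + 1) s" shows "r = s"
proof -
  have "\<not> r < s" using assms unfolding runs_def seg_def by (auto dest!: spec[of _ "x + r + 1"])
  moreover have "\<not> s < r" using assms unfolding runs_def seg_def by (auto dest!: spec[of _ "x + 1 + s"])
  ultimately show ?thesis by simp
qed

context board begin

text \<open>\<open>R\<close> and \<open>B\<close> are the position before the two blocks are added;
  the conditions make each block a component of its own color.\<close>

definition placed :: "int set \<Rightarrow> int set \<Rightarrow> int \<Rightarrow> int \<Rightarrow> int
  \<Rightarrow> bool" where
  "placed R B x y s \<longleftrightarrow> 1 \<le> s \<and> s < N \<and>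
     (\<forall>z. x \<le> z \<and> z < x + s \<longrightarrow> free R B z) \<and> x - 1 \<notin> R \<and> x
       + s \<notin> R \<and>
     (\<forall>z. y \<le> z \<and> z < y + s \<longrightarrow> free R B z \<and> z \<notin> arc x s) \<and>
       y - 1 \<notin> B \<and> y + s \<notin> B"

text \<open>\<open>p\<close> is the left one of the two components. A counterpart of a red gap may
  be reflected, so both orders of \<open>p\<close> and \<open>q\<close> have to be excluded in the
  sequel.\<close>

definition adj :: "int set \<Rightarrow> int set \<Rightarrow> int \<Rightarrow> int \<Rightarrow> int
  \<Rightarrow> bool" where
  "adj R B g p q \<longleftrightarrow>
     (\<exists>a. seg B a p \<and> seg B (a + p + g) q \<and> (\<forall>z. a + p \<le> z \<and> z < a + p +
       g \<longrightarrow> free R B z))"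

lemma placed_valid: "valid R B \<Longrightarrow> placed R B x y s \<Longrightarrow> valid (R \<union> arc x
  s) (B \<union> arc y s)"
  by (rule valid_arc) (auto simp: placed_def)

lemma placed_segR:
  "valid R B \<Longrightarrow> placed R B x y s \<Longrightarrow> seg (R \<union> arc x s) a p
    \<longleftrightarrow> seg R a p \<or> p = s \<and> a mod N = x mod N"
  by (rule seg_add_iff) (auto simp: placed_def valid_def free_def)

lemma placed_segB:
  "valid R B \<Longrightarrow> placed R B x y s \<Longrightarrow> seg (B \<union> arc y s) a p
    \<longleftrightarrow> seg B a p \<or> p = s \<and> a mod N = y mod N"
  by (rule seg_add_iff) (auto simp: placed_def valid_def free_def)

text \<open>The bound drops to \<open>s - 1\<close> because the new components have length
  \<open>s\<close> themselves; this is why later blocks must be shorter.\<close>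

lemma placed_longer:
  assumes "valid R B" "placed R B x y s" "longer_than R t" "longer_than B t" "s \<le> t"
  shows "longer_than (R \<union> arc x s) (s - 1)" "longer_than (B \<union> arc y s) (s - 1)"
  using assms placed_segR placed_segB unfolding longer_than_def by fastforce+

lemma placed_free: "free (R \<union> arc x s) (B \<union> arc y s) z \<longleftrightarrow> free R B z
  \<and> z \<notin> arc x s \<and> z \<notin> arc y s"
  unfolding free_def by auto

lemma placed_shift: "placed R B x (y + k * N) s \<Longrightarrow> valid R B \<Longrightarrow> placed R B x
  y s"
proof -
  assume p: "placed R B x (y + k * N) s" and g: "valid R B"
  then have P: "periodic B" unfolding valid_def by simp
  have "free R B z \<and> z \<notin> arc x s" if "y \<le> z" "z < y + s" for z
  proof -
    have "free R B (z + k * N) \<and> z + k * N \<notin> arc x s" using p that unfolding placed_def by auto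
    then show ?thesis using free_shift[OF g] periodic_shift[OF periodic_arc] by blast
  qed
  moreover have "y - 1 \<notin> B" "y + s \<notin> B"
    using p periodic_shift[OF P, of "y - 1" k] periodic_shift[OF P, of "y + s" k]
    unfolding placed_def by (auto simp: algebra_simps)
  ultimately show ?thesis using p unfolding placed_def by auto
qed

text \<open>A longer free stretch would contain the translate of \<open>c\<close> by one
  period.\<close>

lemma gap_length:
  assumes "valid R B" "\<not> free R B c" "\<And>z. c < z \<Longrightarrow> z < c' \<Longrightarrow> free R
    B z"
  shows "c' - c \<le> N"
proof (rule ccontr)
  assume "\<not> ?thesis"
  then have "free R B (c + 1 * N)" using N3 by (intro assms(3)) auto
  then show False using assms(2) free_shift[OF assms(1), of c 1] by simp
qed

text \<open>\<open>B\<close> has no component of length \<open>s\<close>, so the right component of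
  the adjacency is the new block up to a multiple of \<open>N\<close>, and the left one is old
  because \<open>p\<close> differs from \<open>s\<close>.\<close>

lemma adj_left:
  assumes g: "valid R B" and pl: "placed R B x y s" and ps: "p \<noteq> s" and ns: "\<And>a. \<not> seg B a s"
    and adj: "adj (R \<union> arc x s) (B \<union> arc y s) h p s"
  shows "seg B (y - h - p) p \<and> (\<forall>z. y - h \<le> z \<and> z < y \<longrightarrow> free (R
    \<union> arc x s) (B \<union> arc y s) z)"
proof -
  let ?R = "R \<union> arc x s" and ?B = "B \<union> arc y s"
  have g': "valid ?R ?B" by (rule placed_valid[OF g pl])
  have P: "periodic B" using g unfolding valid_def by auto
  obtain a where a: "seg ?B a p" "seg ?B (a + p + h) s"
      "\<And>z. a + p \<le> z \<Longrightarrow> z < a + p + h \<Longrightarrow> free ?R ?B z"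
        using adj unfolding adj_def by blast
  have ap: "seg B a p" using a(1) placed_segB[OF g pl] ps by auto
  have "(a + p + h) mod N = y mod N" using a(2) ns placed_segB[OF g pl] by auto
  then obtain k where k: "a + p + h = y + k * N" by (rule modE)
  have "a = (y - h - p) + k * N" using k by simp
  then have "seg B (y - h - p) p" using ap seg_shift[OF P, of "y - h - p" k p] by simp
  moreover have "free ?R ?B z" if "y - h \<le> z" "z < y" for z
    using a(3)[of "z + k * N"] that k free_shift[OF g', of z k] by simp
  ultimately show ?thesis by blast
qed

lemma adj_right:
  assumes g: "valid R B" and pl: "placed R B x y s" and ps: "p \<noteq> s" and ns: "\<And>a. \<not> seg B a s"
    and adj: "adj (R \<union> arc x s) (B \<union> arc y s) h s p"
  shows "seg B (y + s + h) p \<and>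
    (\<forall>z. y + s \<le> z \<and> z < y + s + h \<longrightarrow> free (R \<union> arc x s) (B \<union>
      arc y s) z)"
proof -
  let ?R = "R \<union> arc x s" and ?B = "B \<union> arc y s"
  have g': "valid ?R ?B" by (rule placed_valid[OF g pl])
  have P: "periodic B" using g unfolding valid_def by auto
  obtain a where a: "seg ?B a s" "seg ?B (a + s + h) p"
      "\<And>z. a + s \<le> z \<Longrightarrow> z < a + s + h \<Longrightarrow> free ?R ?B z"
        using adj unfolding adj_def by blast
  have ap: "seg B (a + s + h) p" using a(2) placed_segB[OF g pl] ps by auto
  have "a mod N = y mod N" using a(1) ns placed_segB[OF g pl] by auto
  then obtain k where k: "a = y + k * N" by (rule modE)
  have e: "a + s + h = (y + s + h) + k * N" using k by simp
  have "seg B (y + s + h) p" using ap seg_shift[OF P, of "y + s + h" k p] unfolding e by blast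
  moreover have "free ?R ?B z" if "y + s \<le> z" "z < y + s + h" for z
    using a(3)[of "z + k * N"] that k free_shift[OF g', of z k] by simp
  ultimately show ?thesis by blast
qed

text \<open>A neighbor of the new block would have to end at or inside one of the barriers
  \<open>c1\<close> and \<open>c2\<close>. But no old blue cell lies strictly between them, and
  neither barrier bounds a component of length \<open>p\<close>.\<close>

lemma not_adj_between:
  assumes g: "valid R B" and pl: "placed R B x y s" and ps: "p \<noteq> s" and ns: "\<And>a. \<not> seg B a s"
    and h: "0 \<le> h" and c: "c1 < y" "y + s \<le> c2"
    and fB: "\<And>z. c1 < z \<Longrightarrow> z < c2 \<Longrightarrow> z \<notin> B"
    and c1: "\<not> free (R \<union> arc x s) (B \<union> arc y s) c1" "\<not> seg B (c1 + 1 - p) p"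
    and c2: "\<not> free (R \<union> arc x s) (B \<union> arc y s) c2" "\<not> seg B c2 p"
  shows "\<not> adj (R \<union> arc x s) (B \<union> arc y s) h p s \<and> \<not> adj (R \<union> arc x s)
    (B \<union> arc y s) h s p"
proof (intro conjI notI)
  have s1: "1 \<le> s" using pl unfolding placed_def by simp
  assume "adj (R \<union> arc x s) (B \<union> arc y s) h p s"
  from adj_left[OF g pl ps ns this]
  have b: "seg B (y - h - p) p" and fr: "\<And>z. y - h \<le> z \<Longrightarrow> z < y \<Longrightarrow>
    free (R \<union> arc x s) (B \<union> arc y s) z"
    by auto
  have "c1 \<le> y - h - 1" using fr[of c1] c c1 by linarith
  moreover have "c1 \<noteq> y - h - 1" using c1(2) b by auto
  moreover have "y - h - 1 \<in> B" using b unfolding seg_def by auto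
  ultimately show False using fB[of "y - h - 1"] c h s1 by simp
next
  have s1: "1 \<le> s" using pl unfolding placed_def by simp
  assume "adj (R \<union> arc x s) (B \<union> arc y s) h s p"
  from adj_right[OF g pl ps ns this]
  have b: "seg B (y + s + h) p"
    and fr: "\<And>z. y + s \<le> z \<Longrightarrow> z < y + s + h \<Longrightarrow> free (R \<union> arc
      x s) (B \<union> arc y s) z"
    by auto
  have "y + s + h \<le> c2" using fr[of c2] c c2 by linarith
  moreover have "c2 \<noteq> y + s + h" using c2(2) b by auto
  moreover have "y + s + h \<in> B" using b unfolding seg_def by auto
  ultimately show False using fB[of "y + s + h"] c h s1 by simp
qed

lemma longer_than_not_seg: "longer_than S t \<Longrightarrow> s \<le> t \<Longrightarrow> \<not> seg S a s"
  unfolding longer_than_def by fastforce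

text \<open>
  The first player occupies \<open>x\<close> in a free gap. The three continuations distinguish whether
  the blue component emerges in the gap to the right of \<open>x\<close>, in the gap to the left, or
  elsewhere.
\<close>

lemma build:
  assumes g: "valid R B" and bB: "longer_than B t" and s: "1 \<le> sL" "sL \<le> s" "s \<le> t"
    and fr: "\<And>z. L \<le> z \<Longrightarrow> z < H \<Longrightarrow> free R B z"
    and nf: "\<not> free R B (L - 1)" "\<not> free R B H"
    and x: "L \<le> x - sL" "x + s \<le> H" "x + s \<notin> R"
    and right: "\<And>y. x < y \<Longrightarrow> y + sL \<le> H \<Longrightarrow> placed R B (x - sL + 1) y
      sL \<Longrightarrow>
      wins m (R \<union> arc (x - sL + 1) sL) (B \<union> arc y sL)"
    and left: "\<And>y. L \<le> y \<Longrightarrow> y + s \<le> x \<Longrightarrow> placed R B x y s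
      \<Longrightarrow>
      wins m (R \<union> arc x s) (B \<union> arc y s)"
    and out: "\<And>y. (\<And>z. y \<le> z \<Longrightarrow> z < y + s \<Longrightarrow> z \<notin> arc L
      (H - L)) \<Longrightarrow> placed R B x y s \<Longrightarrow>
      wins m (R \<union> arc x s) (B \<union> arc y s)"
  shows "wins (m + nat s) R B"
proof -
  have P: "periodic R" "periodic B" using g unfolding valid_def by auto
  have len: "H - (L - 1) \<le> N" by (rule gap_length[OF g nf(1)]) (use fr in auto)
  have fR: "z \<notin> R" if "L \<le> z" "z < H" for z using fr[OF that] unfolding free_def by simp
  have x1: "x + 1 \<notin> R" using fR[of "x + 1"] x s by (cases "x + 1 = x + s") auto
  have ends: "x - sL \<notin> R" "x - 1 \<notin> R" "x + 1 \<notin> R" "x + s \<notin> R"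
    using fR[of "x - sL"] fR[of "x - 1"] x1 x s by auto
  have sN: "sL < N" "s < N" using len x s by linarith+
  have pl: "placed R B x y s"
    if "\<And>z. y \<le> z \<Longrightarrow> z < y + s \<Longrightarrow> free R B z \<and> z \<notin> arc x
      (H - x)"
    "y - 1 \<notin> B" "y + s \<notin> B" for y
  proof -
    have "arc x s \<subseteq> arc x (H - x)" by (rule arc_subset) (use x in auto)
    then show ?thesis unfolding placed_def using s sN that ends x by (auto intro!: fr)
  qed
  have "wins (Suc (m + nat (s - 1))) R B"
  proof (rule place[of _ _ x])
    show "free R B x" using x s by (intro fr) auto
    fix y0 assume y0: "free R B y0" "y0 \<notin> cell x" "y0 - 1 \<notin> B" "y0 + 1 \<notin> B"
    show "wins (m + nat (s - 1)) (R \<union> arc x 1) (B \<union> arc y0 1)"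
    proof (cases "y0 \<in> arc L (H - L)")
      case True
      then obtain k where k: "L \<le> y0 + k * N" "y0 + k * N < L + (H - L)" by (rule arcE)
      define y1 where "y1 = y0 + k * N"
      have y1c: "arc y0 1 = arc y1 1" by (rule arc_cong) (simp add: y1_def)
      have y1: "free R B y1" "y1 - 1 \<notin> B" "y1 + 1 \<notin> B"
        using y0 free_shift[OF g, of y0 k] periodic_shift[OF P(2), of "y0 - 1" k] periodic_shift[OF P(2),
          of "y0 + 1" k]
        unfolding y1_def by (auto simp: algebra_simps)
      have ne: "y1 \<noteq> x" using y0(2) unfolding y1_def cell_def by auto
      have y1r: "L \<le> y1" "y1 < H" using k y1_def by auto
      have one: "z = y1" if "y1 \<le> z" "z < y1 + 1" for z using that by simp
      show ?thesis
      \<comment> \<open>The side on which the blue cell appears decides the direction of growth: the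
        red block grows away from it. The region passed to \<open>grow\<close> ends at
        \<open>x\<close> on that side, so the blue block cannot pass \<open>x\<close>.\<close>
      proof (cases "x < y1")
        case True
        have "wins (m + nat (sL - 1)) (R \<union> arc x 1) (B \<union> arc y1 1)"
        proof (rule grow[where t = t and L = L and H = "x + 1" and X = "x - sL + 1" and s = sL and yi = y1])
          show "free R B z \<and> z \<notin> arc L (x + 1 - L)" if "y1 \<le> z" "z < y1 + 1" for z
            unfolding one[OF that] using y1(1) not_arc[of L "x + 1 - L" y1] True y1r len by auto
        next
          fix y assume y: "y \<le> y1" "y1 < y + sL"
            "\<And>z. y \<le> z \<Longrightarrow> z < y + sL \<Longrightarrow> free R B z \<and> z \<notin>
              arc L (x + 1 - L)" "y - 1 \<notin> B" "y + sL \<notin> B"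
          have "x < y" using y(3)[of x] y(1,2) True arcI[of L x "x + 1 - L"] x s by linarith
          moreover have "y + sL \<le> H" using y(3)[of H] y(1,2) y1r nf by linarith
          moreover have "placed R B (x - sL + 1) y sL"
          proof -
            have "arc (x - sL + 1) sL \<subseteq> arc L (x + 1 - L)" by (rule arc_subset) (use x in auto)
            then show ?thesis unfolding placed_def using s sN y ends x by (auto intro!: fr)
          qed
          ultimately show "wins m (R \<union> arc (x - sL + 1) sL) (B \<union> arc y sL)" by (rule right)
        qed (use s x ends fr y1 nf g bB in auto)
        then show ?thesis unfolding y1c by (rule wins_mono) (use s in auto)
      next
        case False
        then have y1x: "y1 < x" using ne by simp
        have "wins (m + nat (s - 1)) (R \<union> arc x 1) (B \<union> arc y1 1)"
        proof (rule grow[where t = t and L = x and H = H and X = x and s = s and yi = y1])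
          show "free R B z \<and> z \<notin> arc x (H - x)" if "y1 \<le> z" "z < y1 + 1" for z
            unfolding one[OF that] using y1(1) not_arc'[of y1 x "H - x"] y1x y1r len by auto
        next
          fix y assume y: "y \<le> y1" "y1 < y + s"
            "\<And>z. y \<le> z \<Longrightarrow> z < y + s \<Longrightarrow> free R B z \<and> z \<notin>
              arc x (H - x)" "y - 1 \<notin> B" "y + s \<notin> B"
          have "y + s \<le> x" using y(3)[of x] y(1,2) y1x arcI[of x x "H - x"] x s by linarith
          moreover have "L \<le> y" using y(3)[of "L - 1"] y(1,2) y1r nf by linarith
          ultimately show "wins m (R \<union> arc x s) (B \<union> arc y s)" using left pl y(3-5) by blast
        qed (use s x ends fr y1 nf g bB in auto)
        then show ?thesis unfolding y1c .
      qed
    next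
      case False
      have one: "z = y0" if "y0 \<le> z" "z < y0 + 1" for z using that by simp
      show ?thesis
      proof (rule grow[where t = t and L = L and H = H and X = x and s = s and yi = y0])
        show "free R B z \<and> z \<notin> arc L (H - L)" if "y0 \<le> z" "z < y0 + 1" for z
          unfolding one[OF that] using y0(1) False by simp
      next
        fix y assume y: "\<And>z. y \<le> z \<Longrightarrow> z < y + s \<Longrightarrow> free R B z \<and>
          z \<notin> arc L (H - L)" "y - 1 \<notin> B" "y + s \<notin> B"
        have "arc x (H - x) \<subseteq> arc L (H - L)" by (rule arc_subset) (use x s in auto)
        then have "placed R B x y s" using y by (intro pl) auto
        then show "wins m (R \<union> arc x s) (B \<union> arc y s)" using out y(1) by blast
      qed (use s x ends fr y0 nf g bB in auto)
    qed
  qed (use ends in auto)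
  then show ?thesis by (rule wins_mono) (use s in auto)
qed

text \<open>Closing a gap of length 1 joins the sizes \<open>p\<close> and \<open>q\<close>, which
  has no blue counterpart. In a longer gap, a blue copy of the new block cannot realize both new
  gaps: with neighbors on opposite sides it would complete a counterpart of the old gap, and on the
  same side the two neighbors would coincide, so that \<open>p = q\<close>.\<close>

lemma gap_wins:
  "gap_plan g t m \<Longrightarrow> valid R B \<Longrightarrow> longer_than R t \<Longrightarrow>
    longer_than B t \<Longrightarrow> p \<noteq> q \<Longrightarrow> seg R a p \<Longrightarrow> seg R (a +
      p + g) q \<Longrightarrow>
   (\<And>z. a + p \<le> z \<Longrightarrow> z < a + p + g \<Longrightarrow> free R B z) \<Longrightarrow>
     \<not> adj R B g p q \<Longrightarrow> \<not> adj R B g q p \<Longrightarrow>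
   wins m R B"
proof (induction arbitrary: R B a p q rule: gap_plan.induct)
  case (one m t)
  show ?case
  proof (rule winsI[of _ _ "a + p"])
    show "free R B (a + p)" using one by auto
    fix y assume y: "free R B y" "y \<notin> cell (a + p)" "same_type R (a + p) B y"
    have "runs R (a + p) p q" using one.prems(5,6) unfolding seg_def runs_def by (auto simp: algebra_simps)
    then have t: "runs B y p q \<or> runs B y q p" using same_typeD[OF y(3)] by blast
    have yB: "y \<notin> B" using y(1) unfolding free_def by simp
    have *: "adj R B 1 i j" if "runs B y i j" "1 \<le> i" "1 \<le> j" for i j
    proof -
      have "free R B z" if "y \<le> z" "z < y + 1" for z using that y(1) by (cases "z = y") auto
      then show ?thesis using runs_seg_left[OF that(1,2) yB] runs_seg_right[OF that(1,3) yB]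
        unfolding adj_def by (intro exI[of _ "y - i"]) auto
    qed
    have "1 \<le> p" "1 \<le> q" using one.prems(5,6) unfolding seg_def by auto
    then show "wins (m - 1) (R \<union> cell (a + p)) (B \<union> cell y)" using t * one.prems by blast
  qed (rule one.hyps)
next
  case (split sL s t d1 m d2 m')
  note sL = split.hyps(1-3) and gws = split.hyps(4-6) and mm = split.hyps(7)
  note IH1 = split.IH(1) and IH2 = split.IH(2) and IH3 = split.IH(3)
  note g = split.prems(1) and bR = split.prems(2) and bB = split.prems(3) and pq = split.prems(4)
    and sp = split.prems(5) and sq = split.prems(6) and fr = split.prems(7) and na = split.prems(8,9)
  have d: "1 \<le> d1" "1 \<le> d2" "1 \<le> d1 - sL + 1" "1 \<le> m"
    using gap_plan_pos[OF gws(1)] gap_plan_pos[OF gws(2)] gap_plan_pos[OF gws(3)] by auto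
  define x0 where "x0 = a + p + d1"
  define zr where "zr = a + p + (d1 + s + d2)"
  have p1: "1 \<le> p" "1 \<le> q" using sp sq unfolding seg_def by auto
  have ps: "p \<noteq> j" "q \<noteq> j" if "j \<le> s" for j using bR sp sq sL that
    unfolding longer_than_def by fastforce+
  have nsB: "\<not> seg B b j" if "j \<le> s" for b j using longer_than_not_seg[OF bB] that sL by simp
  have zl: "a + p - 1 \<in> R" using sp unfolding seg_def by auto
  have zrR: "zr \<in> R" using sq unfolding seg_def zr_def by auto
  have nfzl: "\<not> free R B (a + p - 1)" and nfzr: "\<not> free R B zr" using zl zrR
    unfolding free_def by auto
  have disj: "R \<inter> B = {}" and P: "periodic R" "periodic B" using g unfolding valid_def by auto
  have len: "zr - (a + p - 1) \<le> N"
    by (rule gap_length[OF g nfzl]) (use fr zr_def in auto)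
  have frx: "free R B z" if "a + p \<le> z" "z < zr" for z using fr that zr_def by auto
  have segq: "seg R zr q" using sq zr_def by simp
  have xb: "a + p \<le> x0 - sL" "x0 + s < zr" "a + p \<le> x0 - 1" "a + p \<le> x0" "x0 + 1 < zr" "x0 < zr"
    using d sL x0_def zr_def by auto
  have frb: "free R B (x0 - sL)" "free R B (x0 + s)" "free R B (x0 - 1)" "free R B (x0 + 1)" "free R B x0"
    using xb sL by (auto intro!: frx)
  then have nRb: "x0 - sL \<notin> R" "x0 + s \<notin> R" "x0 - 1 \<notin> R" "x0 + 1 \<notin> R" "x0
    \<notin> R"
    unfolding free_def by auto
  let ?R = "R \<union> arc x0 s"
  have frl: "z \<notin> arc x0 s" if "a + p \<le> z" "z < x0" for z
    by (rule not_arc') (use that len d x0_def zr_def in auto)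
  have frr: "z \<notin> arc x0 s" if "x0 + s \<le> z" "z < zr" for z
    by (rule not_arc) (use that len d x0_def zr_def in auto)
  have x0s: "x0 \<in> arc x0 s" using sL by (intro arcI) auto
  have right: "wins m ?R (B \<union> arc y' s)"
    if pl: "placed R B x0 y' s" and c: "\<And>z. x0 + s \<le> z \<Longrightarrow> z < zr \<Longrightarrow>
      z \<notin> arc y' s"
      and na': "\<not> adj ?R (B \<union> arc y' s) d2 s q" "\<not> adj ?R (B \<union> arc y' s) d2 q s"
        for y'
  proof (rule IH2[of _ _ s q x0])
    show "valid ?R (B \<union> arc y' s)" by (rule placed_valid[OF g pl])
    show "longer_than ?R (s - 1)" "longer_than (B \<union> arc y' s) (s - 1)"
      using placed_longer[OF g pl bR bB] sL by auto
    show "s \<noteq> q" using ps[of s] by auto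
    show "seg ?R x0 s" using placed_segR[OF g pl] by auto
    show "seg ?R (x0 + s + d2) q" using placed_segR[OF g pl] sq x0_def by (auto simp: algebra_simps)
    show "free ?R (B \<union> arc y' s) z" if "x0 + s \<le> z" "z < x0 + s + d2" for z
      unfolding placed_free using c[of z] frr[of z] frx[of z] that d sL x0_def zr_def by auto
  qed (use na' in auto)
  have "wins (m + nat s) R B"
  proof (rule build[OF g bB sL frx, where x = x0])
    show "\<not> free R B (a + p - 1)" "\<not> free R B zr" by fact+
    show "a + p \<le> x0 - sL" "x0 + s \<le> zr" "x0 + s \<notin> R" using xb nRb by auto
  next
    fix y' assume y'x: "x0 < y'" and y'z: "y' + sL \<le> zr" and pl: "placed R B (x0 - sL + 1) y' sL"
    let ?X = "x0 - sL + 1"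
    let ?R = "R \<union> arc ?X sL" and ?B = "B \<union> arc y' sL"
    have x0i: "x0 \<in> arc ?X sL" using sL by (intro arcI) auto
    \<comment> \<open>Between the red cells \<open>x0\<close> and \<open>zr\<close> the new block is
      the only blue one, so it has no neighbor of length \<open>p\<close>.\<close>
    have na': "\<not> adj ?R ?B (d1 - sL + 1) p sL \<and> \<not> adj ?R ?B (d1 - sL + 1) sL p"
    proof (rule not_adj_between[OF g pl ps(1)[OF sL(2)] nsB[OF sL(2)]])
      show "x0 < y'" "y' + sL \<le> zr" by fact+
      show "z \<notin> B" if "x0 < z" "z < zr" for z
        using frx[of z] that d x0_def unfolding free_def by auto
      show "\<not> free ?R ?B x0" using x0i unfolding free_def by simp
      show "\<not> free ?R ?B zr" using zrR unfolding free_def by simp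
      have "zr \<notin> B" using zrR disj by auto
      then show "\<not> seg B zr p" using p1 unfolding seg_def by (auto dest!: spec[of _ zr])
      have "free R B x0" by (rule frx) (use d sL x0_def zr_def in auto)
      then have "x0 \<notin> B" unfolding free_def by simp
      then show "\<not> seg B (x0 + 1 - p) p" using p1 unfolding seg_def by (auto dest!: spec[of _ x0])
    qed (use d in auto)
    show "wins m ?R ?B"
    proof (rule IH3[of _ _ p sL a])
      show "valid ?R ?B" by (rule placed_valid[OF g pl])
      show "longer_than ?R (sL - 1)" "longer_than ?B (sL - 1)"
        using placed_longer[OF g pl bR bB] sL by auto
      show "p \<noteq> sL" by (rule ps) (use sL in auto)
      show "seg ?R a p" using placed_segR[OF g pl] sp by auto
      show "seg ?R (a + p + (d1 - sL + 1)) sL"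
        using placed_segR[OF g pl] by (auto simp: x0_def algebra_simps)
      show "free ?R ?B z" if "a + p \<le> z" "z < a + p + (d1 - sL + 1)" for z
      proof -
        have "z \<notin> arc y' sL" by (rule not_arc') (use that y'x y'z len sL x0_def in auto)
        moreover have "z \<notin> arc ?X sL" by (rule not_arc') (use that len d sL x0_def zr_def in auto)
        ultimately show ?thesis unfolding placed_free using frx[of z] that d sL x0_def zr_def by auto
      qed
    qed (use na' in auto)
  next
    fix y' assume y'z: "a + p \<le> y'" and y'x: "y' + s \<le> x0" and pl: "placed R B x0 y' s"
    have na': "\<not> adj ?R (B \<union> arc y' s) d2 q s \<and> \<not> adj ?R (B \<union> arc y' s) d2 s q"
    proof (rule not_adj_between[OF g pl ps(2)[OF order_refl] nsB[OF order_refl]])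
      show "a + p - 1 < y'" "y' + s \<le> x0" using y'z y'x by auto
      show "z \<notin> B" if "a + p - 1 < z" "z < x0" for z
        using frx[of z] that d sL x0_def zr_def unfolding free_def by auto
      show "\<not> free ?R (B \<union> arc y' s) x0" using x0s unfolding free_def by simp
      show "\<not> free ?R (B \<union> arc y' s) (a + p - 1)" using zl unfolding free_def by simp
      have "a + p - 1 \<notin> B" using zl disj by auto
      then show "\<not> seg B (a + p - 1 + 1 - q) q" using p1 unfolding seg_def
        by (auto dest!: spec[of _ "a + p - 1"])
      have "free R B x0" by (rule frx) (use d sL x0_def zr_def in auto)
      then have "x0 \<notin> B" unfolding free_def by simp
      then show "\<not> seg B x0 q" using p1 unfolding seg_def by (auto dest!: spec[of _ x0])
    qed (use d in auto)
    show "wins m ?R (B \<union> arc y' s)"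
    proof (rule right[OF pl])
      show "z \<notin> arc y' s" if "x0 + s \<le> z" "z < zr" for z
        by (rule not_arc) (use that y'z y'x len sL in auto)
    qed (use na' in auto)
  next
    fix y' assume y': "\<And>z. y' \<le> z \<Longrightarrow> z < y' + s \<Longrightarrow> z \<notin> arc (a
      + p) (zr - (a + p))"
      and pl: "placed R B x0 y' s"
    let ?B = "B \<union> arc y' s"
    have far: "z \<notin> arc y' s" if "a + p \<le> z" "z < zr" for z
    proof -
      have "z \<in> arc (a + p) (zr - (a + p))" using that by (intro arcI) auto
      then show ?thesis using arc_disjoint[OF periodic_arc, of y' s "a + p" "zr - (a + p)" z] y' by blast
    qed
    show "wins m ?R ?B"
    proof (cases "adj ?R ?B d2 s q \<or> adj ?R ?B d2 q s")
      case False
      show ?thesis by (rule right[OF pl]) (use far False x0_def d sL in auto)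
    next
      case a2: True
      show ?thesis
      proof (rule IH1[of _ _ p s a])
        show "valid ?R ?B" by (rule placed_valid[OF g pl])
        show "longer_than ?R (s - 1)" "longer_than ?B (s - 1)" using placed_longer[OF g pl bR bB] sL by auto
        show "p \<noteq> s" using ps[of s] by auto
        show "seg ?R a p" using placed_segR[OF g pl] sp by auto
        show "seg ?R (a + p + d1) s" using placed_segR[OF g pl] x0_def by auto
        show "free ?R ?B z" if "a + p \<le> z" "z < a + p + d1" for z
          unfolding placed_free using frl[of z] frx[of z] far[of z] that d sL x0_def zr_def by auto
        have yB: "free R B z" if "y' \<le> z" "z < y' + s" for z using pl that unfolding placed_def by blast
        have s1: "1 \<le> s" using sL by simp
        have L: "seg B (y' - h - r) r \<and> (\<forall>z. y' - h \<le> z \<and> z < y' \<longrightarrow>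
          free R B z)"
          if "adj ?R ?B h r s" "r = p \<or> r = q" for h r
          using adj_left[OF g pl _ nsB[OF order_refl] that(1)] that(2) ps[of s] unfolding placed_free by auto
        have Rt: "seg B (y' + s + h) r \<and> (\<forall>z. y' + s \<le> z \<and> z < y' + s + h
          \<longrightarrow> free R B z)"
          if "adj ?R ?B h s r" "r = p \<or> r = q" for h r
          using adj_right[OF g pl _ nsB[OF order_refl] that(1)] that(2) ps[of s] unfolding placed_free by auto
        have both: "adj R B (h + s + h') r r'"
          if "adj ?R ?B h r s" "adj ?R ?B h' s r'" "r = p \<or> r = q" "r' = p \<or> r' = q" for h h' r r'
        proof -
          have l: "seg B (y' - h - r) r" "\<And>z. y' - h \<le> z \<Longrightarrow> z < y'
            \<Longrightarrow> free R B z"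
            using L[OF that(1,3)] by auto
          have r: "seg B (y' + s + h') r'" "\<And>z. y' + s \<le> z \<Longrightarrow> z < y' + s + h'
            \<Longrightarrow> free R B z"
            using Rt[OF that(2,4)] by auto
          have "free R B z" if "y' - h \<le> z" "z < y' + s + h'" for z
            using l(2)[of z] r(2)[of z] yB[of z] that by (cases "z < y'"; cases "z < y' + s") auto
          then show ?thesis unfolding adj_def using l(1) r(1)
            by (intro exI[of _ "y' - h - r"]) (auto simp: algebra_simps)
        qed
        have sideL: False if "adj ?R ?B d1 p s" "adj ?R ?B d2 q s"
        proof -
          have l: "seg B (y' - d1 - p) p" "\<And>z. y' - d1 \<le> z \<Longrightarrow> z < y'
            \<Longrightarrow> free R B z"
            using L[OF that(1)] by auto
          have r: "seg B (y' - d2 - q) q" "\<And>z. y' - d2 \<le> z \<Longrightarrow> z < y'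
            \<Longrightarrow> free R B z"
            using L[OF that(2)] by auto
          have "y' - d1 - 1 \<in> B" "y' - d2 - 1 \<in> B" using l(1) r(1) unfolding seg_def by auto
          then have "d1 = d2" using l(2)[of "y' - d2 - 1"] r(2)[of "y' - d1 - 1"] d
            unfolding free_def by linarith
          then show False using seg_right_unique[of B "y' - d1" p q] l(1) r(1) pq by simp
        qed
        have sideR: False if "adj ?R ?B d1 s p" "adj ?R ?B d2 s q"
        proof -
          have l: "seg B (y' + s + d1) p" "\<And>z. y' + s \<le> z \<Longrightarrow> z < y' + s + d1
            \<Longrightarrow> free R B z"
            using Rt[OF that(1)] by auto
          have r: "seg B (y' + s + d2) q" "\<And>z. y' + s \<le> z \<Longrightarrow> z < y' + s + d2
            \<Longrightarrow> free R B z"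
            using Rt[OF that(2)] by auto
          have "y' + s + d1 \<in> B" "y' + s + d2 \<in> B" using l(1) r(1) unfolding seg_def by auto
          then have "d1 = d2" using l(2)[of "y' + s + d2"] r(2)[of "y' + s + d1"] d
            unfolding free_def by linarith
          then show False using seg_left_unique[of B "y' + s + d1" p q] l(1) r(1) pq by simp
        qed
        show "\<not> adj ?R ?B d1 p s"
          using a2 both[of d1 p d2 q] sideL na by blast
        have e: "d2 + s + d1 = d1 + s + d2" by simp
        show "\<not> adj ?R ?B d1 s p"
          using a2 both[of d2 q d1 p] sideR na unfolding e by blast
      qed
    qed
  qed
  then show ?case by (rule wins_mono) (use mm sL in auto)
qed

lemma cell_sym: "x \<in> cell y \<longleftrightarrow> y \<in> cell x"
  unfolding cell_def mem_Collect_eq by (rule eq_commute)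

lemma cell_near: "x \<in> cell y \<Longrightarrow> \<bar>x - y\<bar> < N \<Longrightarrow> x = y"
  unfolding cell_def mem_Collect_eq by (rule mod_eq_near)

text \<open>Only the component that absorbs \<open>y\<close> can be new, and its length is
  \<open>i + j + 1\<close>. The cell \<open>u\<close> guarantees that this component does not close
  up around the board.\<close>

lemma seg_insert:
  assumes P: "periodic B" and u: "u \<notin> B" "u \<notin> cell y" and t: "runs B y i j" and h: "seg (B
    \<union> cell y) b s"
  shows "seg B b s \<or> s = i + j + 1"
proof (cases "\<exists>z. b \<le> z \<and> z < b + s \<and> z \<in> cell y")
  case False
  then show ?thesis using h unfolding seg_def by auto
next
  case True
  then obtain z where z: "b \<le> z" "z < b + s" "z mod N = y mod N" unfolding cell_def by auto
  obtain k where k: "z = y + k * N" using modE[OF z(3)] .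
  define c where "c = b - k * N"
  have PT: "periodic (B \<union> cell y)" by (rule periodic_Un[OF P periodic_cell])
  have hc: "seg (B \<union> cell y) c s" using seg_shift[OF PT, of c k s] h unfolding c_def by simp
  have yc: "c \<le> y" "y < c + s" using z k unfolding c_def by auto
  have ij: "0 \<le> i" "0 \<le> j" using t unfolding runs_def by auto
  have u': "u + q * N \<notin> B" "u + q * N \<notin> cell y" for q
    using u periodic_shift[OF P] periodic_shift[OF periodic_cell] by auto
  have "\<not> y - i < c"
  proof
    assume "y - i < c"
    then have "c - 1 \<in> B" using t yc unfolding runs_def by auto
    then show False using hc unfolding seg_def by auto
  qed
  moreover have "\<not> c < y - i"
  proof
    assume "c < y - i"
    then have "y - i - 1 \<in> B \<union> cell y" using hc yc ij unfolding seg_def by auto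
    then have c1: "y - i - 1 \<in> cell y" using t unfolding runs_def by auto
    have "N \<le> i + 1"
    proof (rule ccontr)
      assume "\<not> ?thesis"
      then have "y - i - 1 = y" using ij by (intro cell_near[OF c1]) auto
      then show False using ij by simp
    qed
    then obtain q where q: "y - i - 1 \<le> u + q * N" "u + q * N < y - i - 1 + (i + 1)"
      using arc_full[of "i + 1" u "y - i - 1"] arcE by metis
    show False using u'[of q] c1 t q unfolding runs_def by (cases "u + q * N = y - i - 1") auto
  qed
  moreover have "\<not> c + s < y + j + 1"
  proof
    assume "c + s < y + j + 1"
    then have "c + s \<in> B" using t yc unfolding runs_def by auto
    then show False using hc unfolding seg_def by auto
  qed
  moreover have "\<not> y + j + 1 < c + s"
  proof
    assume "y + j + 1 < c + s"
    then have "y + j + 1 \<in> B \<union> cell y" using hc yc ij unfolding seg_def by auto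
    then have c1: "y + j + 1 \<in> cell y" using t unfolding runs_def by auto
    have "N \<le> j + 1"
    proof (rule ccontr)
      assume "\<not> ?thesis"
      then have "y + j + 1 = y" using ij by (intro cell_near[OF c1]) auto
      then show False using ij by simp
    qed
    then obtain q where q: "y + 1 \<le> u + q * N" "u + q * N < y + 1 + (j + 1)"
      using arc_full[of "j + 1" u "y + 1"] arcE by metis
    show False using u'[of q] c1 t q unfolding runs_def by (cases "u + q * N = y + j + 1") auto
  qed
  ultimately show ?thesis by linarith
qed

lemma runs_shift:
  assumes S: "periodic S" and t: "runs S x l r"
  shows "runs S (x + k * N) l r"
proof -
  have 1: "z \<in> S" if "x + k * N - l \<le> z" "z < x + k * N" for z
  proof -
    have "z - k * N \<in> S" using t that unfolding runs_def by auto
    then show ?thesis using periodic_shift[OF S, of "z - k * N" k] by simp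
  qed
  have 2: "z \<in> S" if "x + k * N < z" "z \<le> x + k * N + r" for z
  proof -
    have "z - k * N \<in> S" using t that unfolding runs_def by auto
    then show ?thesis using periodic_shift[OF S, of "z - k * N" k] by simp
  qed
  have e: "x + k * N - l - 1 = (x - l - 1) + k * N" "x + k * N + r + 1 = (x + r + 1) + k * N" by auto
  have "x + k * N - l - 1 \<notin> S" "x + k * N + r + 1 \<notin> S"
    using t unfolding e periodic_shift[OF S] runs_def by auto
  then show ?thesis using t 1 2 unfolding runs_def by blast
qed

lemma seg_keep:
  assumes "seg S a k" "y \<notin> cell (a - 1)" "y \<notin> cell (a + k)"
  shows "seg (S \<union> cell y) a k"
  using assms unfolding seg_def cell_sym[of y] by auto

section \<open>Blocked components\<close>

text \<open>Extending the red component is a move whose type contains \<open>k\<close>. A reply of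
  this type needs a free neighbor of a blue component of length \<open>k\<close>.\<close>

lemma block0:
  assumes a: "seg R a k" "free R B (a - 1) \<or> free R B (a + k)"
    and b: "\<And>b. seg B b k \<Longrightarrow> \<not> free R B (b - 1) \<and> \<not> free R B (b + k)"
  shows "wins 1 R B"
proof -
  have k: "1 \<le> k" using a(1) unfolding seg_def by simp
  have no: False if "free R B y" "runs B y k r \<or> runs B y r k" for y r
  proof -
    have "y \<notin> B" using that(1) unfolding free_def by simp
    then have "seg B (y - k) k \<or> seg B (y + 1) k"
      using that(2) runs_seg_left[of B y k r] runs_seg_right[of B y r k] k by blast
    then show False using b[of "y - k"] b[of "y + 1"] that(1) by auto
  qed
  show ?thesis
  proof (cases "free R B (a + k)")
    case True
    show ?thesis
    proof (rule winsI[OF True])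
      fix y assume y: "free R B y" "same_type R (a + k) B y"
      then obtain l r where t: "runs R (a + k) l r" "runs B y l r \<or> runs B y r l"
        unfolding same_type_def by blast
      have "l = k" by (rule runs_left_seg[OF t(1)]) (use a in simp)
      then show "wins (1 - 1) (R \<union> cell (a + k)) (B \<union> cell y)" using no y(1) t(2) by blast
    qed simp
  next
    case False
    then have f: "free R B (a - 1)" using a by blast
    show ?thesis
    proof (rule winsI[OF f])
      fix y assume y: "free R B y" "same_type R (a - 1) B y"
      then obtain l r where t: "runs R (a - 1) l r" "runs B y l r \<or> runs B y r l"
        unfolding same_type_def by blast
      have "r = k" by (rule runs_right_seg[OF t(1)]) (use a in simp)
      then show "wins (1 - 1) (R \<union> cell (a - 1)) (B \<union> cell y)" using no y(1) t(2) by blast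
    qed simp
  qed
qed

text \<open>The first player takes the remaining free neighbor \<open>q\<close> of the blue
  component, if any. The reply can take only one of the two free neighbors of \<open>a\<close>, so
  \<open>block0\<close> finishes, provided that no further blue component of length \<open>k\<close>
  arises. The absence of red components of length \<open>k - 1\<close> serves this purpose.\<close>

lemma block1:
  assumes g: "valid R B" and a: "seg R a k" "free R B (a - 1)" "free R B (a + k)"
    and k: "2 \<le> k" "k + 1 < N" and b: "seg B b k" and uniq: "\<And>c. seg B c k \<Longrightarrow> c mod
      N = b mod N"
    and nb: "\<not> (free R B (b - 1) \<and> free R B (b + k))" and no: "\<And>c. \<not> seg R c (k - 1)"
  shows "wins 2 R B"
proof -
  have P: "periodic R" "periodic B" and disj: "R \<inter> B = {}" using g unfolding valid_def by auto
  have nbs: "\<not> free R' B' (c - 1) \<and> \<not> free R' B' (c + k)"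
    if "seg B c k" "\<not> free R' B' (b - 1)" "\<not> free R' B' (b + k)" "valid R' B'" for c R' B'
  proof -
    have "c mod N = b mod N" by (rule uniq) fact
    then obtain i where i: "c = b + i * N" by (rule modE)
    have e: "c - 1 = (b - 1) + i * N" "c + k = (b + k) + i * N" using i by auto
    show ?thesis using that(2,3) free_shift[OF that(4)] unfolding e by simp
  qed
  show ?thesis
  proof (cases "free R B (b - 1) \<or> free R B (b + k)")
    case False
    have "wins 1 R B" by (rule block0[OF a(1)]) (use a False nbs[OF _ _ _ g] in auto)
    then show ?thesis by (rule wins_mono) simp
  next
    case True
    define q where "q = (if free R B (b - 1) then b - 1 else b + k)"
    have q: "free R B q" "q = b - 1 \<or> q = b + k" using True unfolding q_def by auto
    have other: "z = q" if "free R B z" "z = b - 1 \<or> z = b + k" for z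
      using that nb unfolding q_def by auto
    have bB: "b \<in> B" "b + k - 1 \<in> B" using b k unfolding seg_def by auto
    show ?thesis
    proof (rule winsI[OF q(1)])
      fix y assume y: "free R B y" "y \<notin> cell q" "same_type R q B y"
      then obtain l r where t: "runs R q l r" "runs B y l r \<or> runs B y r l" unfolding same_type_def
        by blast
      have lr: "0 \<le> l" "0 \<le> r" using t unfolding runs_def by auto
      have yB: "y \<notin> B" using y(1) unfolding free_def by simp
      \<comment> \<open>A run of length \<open>k\<close> in the type would require a reply next to
        \<open>b\<close>, but \<open>q\<close> was the only free cell there.\<close>
      have notk: "l \<noteq> k \<and> r \<noteq> k"
      proof (rule ccontr)
        assume "\<not> ?thesis"
        then obtain i where "runs B y k i \<or> runs B y i k" using t(2) by blast
        then have "seg B (y - k) k \<or> seg B (y + 1) k"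
          using runs_seg_left[of B y k i] runs_seg_right[of B y i k] yB k by auto
        then obtain c where c: "seg B c k" "y = c + k \<or> y = c - 1" by force
        obtain i where i: "c = b + i * N" using uniq[OF c(1)] by (rule modE)
        have "y - i * N = b + k \<or> y - i * N = b - 1" using c(2) i by auto
        moreover have "free R B (y - i * N)" using free_shift[OF g, of "y" "-i"] y(1) by simp
        ultimately have "y - i * N = q" using other by blast
        then have "y = q + i * N" by simp
        then have "y \<in> cell q" unfolding cell_def by simp
        then show False using y(2) by blast
      qed
      have qa: "q \<notin> cell (a - 1)" "q \<notin> cell (a + k)"
      proof -
        have pt: "runs R (q + i * N) l r" for i by (rule runs_shift[OF P(1) t(1)])
        show "q \<notin> cell (a - 1)"
        proof
          assume "q \<in> cell (a - 1)"
          then have "(a - 1) mod N = q mod N" unfolding cell_def by simp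
          then obtain i where e: "a - 1 = q + i * N" by (rule modE)
          have "runs R (a - 1) l r" unfolding e by (rule pt)
          then have "r = k" using runs_right_seg[of R "a - 1" l r k] a(1) by simp
          then show False using notk by blast
        qed
        show "q \<notin> cell (a + k)"
        proof
          assume "q \<in> cell (a + k)"
          then have "(a + k) mod N = q mod N" unfolding cell_def by simp
          then obtain i where e: "a + k = q + i * N" by (rule modE)
          have "runs R (a + k) l r" unfolding e by (rule pt)
          then have "l = k" using runs_left_seg[of R "a + k" l r k] a(1) by simp
          then show False using notk by blast
        qed
      qed
      \<comment> \<open>A neighbor of \<open>q\<close> is blue, so one of the two red runs at
        \<open>q\<close> is empty. A new component of length \<open>k\<close> would thus require a
        red one of length \<open>k - 1\<close>.\<close>
      have sum: "l + r + 1 \<noteq> k"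
      proof
        assume s: "l + r + 1 = k"
        have qR: "q \<notin> R" using q(1) unfolding free_def by simp
        have "l = 0 \<or> r = 0"
        proof (cases "q = b - 1")
          case True
          have "b \<notin> R" using bB disj by auto
          then have "\<not> 1 \<le> r" using t(1) True unfolding runs_def by auto
          then show ?thesis using lr by simp
        next
          case False
          then have "q - 1 \<notin> R" using bB disj q(2) by auto
          then have "\<not> 1 \<le> l" using t(1) unfolding runs_def by auto
          then show ?thesis using lr by simp
        qed
        then show False
          using s k no runs_seg_left[OF t(1) _ qR] runs_seg_right[OF t(1) _ qR] lr by auto
      qed
      let ?R = "R \<union> cell q" and ?B = "B \<union> cell y"
      have g': "valid ?R ?B" by (rule valid_cell[OF g q(1) y(1,2)])
      have segB: "seg B c k" if c: "seg ?B c k" for c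
      proof -
        have aR: "a \<in> R" using a(1) k unfolding seg_def by auto
        then have "a \<notin> B" using disj by auto
        moreover have "a \<notin> cell y"
        proof
          assume "a \<in> cell y"
          then have "free R B a" using free_cong[OF g, of a y] y(1) unfolding cell_def mem_Collect_eq by blast
          then show False using aR unfolding free_def by simp
        qed
        ultimately have "seg B c k \<or> k = l + r + 1"
          using t(2) seg_insert[OF P(2) _ _ _ c, of a l r] seg_insert[OF P(2) _ _ _ c, of a r l] by auto
        then show ?thesis using sum by simp
      qed
      have frI: "free ?R ?B z" if "free R B z" "q \<notin> cell z" "y \<notin> cell z" for z
        using that unfolding free_def cell_sym[of _ z] by auto
      have "\<not> (y \<in> cell (a - 1) \<and> y \<in> cell (a + k))"
      proof
        assume "y \<in> cell (a - 1) \<and> y \<in> cell (a + k)"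
        then have "(a + k) mod N = (a - 1) mod N" unfolding cell_def mem_Collect_eq by metis
        then have "a + k = a - 1" by (rule mod_eq_near) (use k in auto)
        then show False using k by simp
      qed
      then have fa: "free ?R ?B (a - 1) \<or> free ?R ?B (a + k)" using frI a(2,3) qa by blast
      have qR: "q \<in> ?R" unfolding cell_def by simp
      have fb: "\<not> free ?R ?B z" if "z = b - 1 \<or> z = b + k" for z
        using that other[of z] qR unfolding free_def by blast
      have "wins 1 ?R ?B"
      proof (rule block0[OF seg_keep[OF a(1) qa] fa])
        fix c assume "seg ?B c k"
        then have c: "seg B c k" by (rule segB)
        show "\<not> free ?R ?B (c - 1) \<and> \<not> free ?R ?B (c + k)"
          by (rule nbs[OF c _ _ g']) (use fb in auto)
      qed
      then show "wins (2 - 1) ?R ?B" by simp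
    qed simp
  qed
qed

lemma block_wins:
  assumes g: "valid R B" and a: "seg R a k"
    and k: "2 \<le> k" "k + 1 < N" and b: "seg B b k" and uniq: "\<And>c. seg B c k \<Longrightarrow> c mod
      N = b mod N"
    and no: "\<And>c. \<not> seg R c (k - 1)"
    and nb: "free R B (a - 1) \<and> free R B (a + k) \<and> \<not> (free R B (b - 1) \<and> free R B (b +
      k)) \<or>
      (free R B (a - 1) \<or> free R B (a + k)) \<and> \<not> free R B (b - 1) \<and> \<not> free R B (b + k)"
  shows "wins 2 R B"
  using nb
proof
  assume "free R B (a - 1) \<and> free R B (a + k) \<and> \<not> (free R B (b - 1) \<and> free R B (b + k))"
  then show ?thesis using block1[OF g a _ _ k b uniq _ no] by blast
next
  assume h: "(free R B (a - 1) \<or> free R B (a + k)) \<and> \<not> free R B (b - 1) \<and> \<not> free R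
    B (b + k)"
  have "wins 1 R B"
  proof (rule block0[OF a])
    fix c assume c: "seg B c k"
    obtain i where i: "c = b + i * N" using uniq[OF c] by (rule modE)
    have e: "c - 1 = (b - 1) + i * N" "c + k = (b + k) + i * N" using i by auto
    show "\<not> free R B (c - 1) \<and> \<not> free R B (c + k)" using h free_shift[OF g] unfolding e by simp
  qed (use h in blast)
  then show ?thesis by (rule wins_mono) simp
qed

text \<open>
  The first player builds a block that abuts on the blue component at \<open>v\<close>. If the second
  player abuts symmetrically on the red component \<open>a\<close>, then the new gap of length
  \<open>d\<close> has no blue counterpart; otherwise \<open>a\<close> keeps more free neighbors than
  \<open>v\<close>.
\<close>

lemma room_wins:
  assumes g: "valid R B" and bR: "longer_than R t" and bB: "longer_than B t"
    and u: "seg R u p" and v: "seg B v k" and e: "v = u + p + d + w"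
    and fr: "\<And>z. u + p \<le> z \<Longrightarrow> z < v \<Longrightarrow> free R B z"
    and a: "seg R a k" and pk: "p \<noteq> k" and k: "t + 2 \<le> k" "k + 1 < N"
    and uniq: "\<And>c. seg B c k \<Longrightarrow> c mod N = v mod N"
    and no: "\<And>c. \<not> seg R c (k - 1)"
    and noL: "\<And>b. seg B b p \<Longrightarrow> seg R (b + p + (d + w)) k \<Longrightarrow>
        (\<And>z. b + p \<le> z \<Longrightarrow> z < b + p + (d + w) \<Longrightarrow> free R B z)
          \<Longrightarrow> False"
    and noR: "\<And>b. seg B b p \<Longrightarrow> seg R (b - (d + w) - k) k \<Longrightarrow>
        (\<And>z. b - (d + w) \<le> z \<Longrightarrow> z < b \<Longrightarrow> free R B z)
          \<Longrightarrow> False"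
    and nb: "free R B (a - 1) \<and> free R B (a + k) \<or>
        (free R B (a - 1) \<or> free R B (a + k)) \<and> \<not> free R B (v + k)"
    and sL: "1 \<le> sL" "sL \<le> w" "w \<le> t"
    and gws: "gap_plan d (w - 1) m" "gap_plan (d - sL + 1) (sL - 1) m"
  shows "wins (m + 2 + nat w) R B"
proof -
  have d: "1 \<le> d" "1 \<le> d - sL + 1" "1 \<le> m"
    using gap_plan_pos[OF gws(1)] gap_plan_pos[OF gws(2)] by auto
  have disj: "R \<inter> B = {}" and P: "periodic R" "periodic B" using g unfolding valid_def by auto
  define x0 where "x0 = v - w"
  have p1: "1 \<le> p" using u unfolding seg_def by auto
  have pw: "p \<noteq> j" "k \<noteq> j" if "j \<le> w" for j using bR u k sL that
    unfolding longer_than_def by fastforce+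
  have nsB: "\<not> seg B b j" if "j \<le> w" for b j using longer_than_not_seg[OF bB] that sL by simp
  have zl: "u + p - 1 \<in> R" using u unfolding seg_def by auto
  have vB: "v \<in> B" using v unfolding seg_def by auto
  have nfzl: "\<not> free R B (u + p - 1)" and nfv: "\<not> free R B v" using zl vB unfolding free_def by auto
  have len: "v - (u + p - 1) \<le> N" by (rule gap_length[OF g nfzl]) (use fr in auto)
  have xb: "u + p \<le> x0 - sL" "x0 + w = v" "u + p \<le> x0 - 1" "u + p \<le> x0" "x0 < v"
    using d sL x0_def e by auto
  have x0d: "x0 = u + p + d" using x0_def e by simp
  have frb: "free R B (x0 - sL)" "free R B (x0 - 1)" "free R B x0"
    using xb sL by (auto intro!: fr)
  have nRb: "x0 - sL \<notin> R" "x0 - 1 \<notin> R" "x0 \<notin> R" "v \<notin> R" "x0 + 1 \<notin> R" "x0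
    + w \<notin> R"
  proof -
    show "v \<notin> R" using vB disj by auto
    then show "x0 + w \<notin> R" using xb by simp
    show "x0 + 1 \<notin> R"
      using \<open>v \<notin> R\<close> fr[of "x0 + 1"] xb sL unfolding free_def by (cases "x0 + 1 = v") auto
  qed (use frb in \<open>auto simp: free_def\<close>)
  have wN: "w < N" "sL < N" using len xb x0d sL d by linarith+
  have free_mid: "z \<notin> arc y' s"
    if "\<And>z. y' \<le> z \<Longrightarrow> z < y' + s \<Longrightarrow> z \<notin> arc c h" "c \<le> z"
      "z < c + h" for y' s c h z
  proof -
    have "z \<in> arc c h" using that by (intro arcI) auto
    then show ?thesis using arc_disjoint[OF periodic_arc, of y' s c h z] that(1) by blast
  qed
  \<comment> \<open>A neighbor of \<open>a\<close> inside the gap would put a red cell into the gap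
    or on \<open>v\<close>, or would identify \<open>a\<close> with the component at
    \<open>u\<close>, whose length is different.\<close>
  have out: "z \<notin> arc (u + p) (v - (u + p))" if "z = a - 1 \<or> z = a + k" for z
  proof
    assume "z \<in> arc (u + p) (v - (u + p))"
    then obtain i where i: "u + p \<le> z + i * N" "z + i * N < v"
      using arcE[of z "u + p" "v - (u + p)"] by auto
    define a' where "a' = a + i * N"
    have a': "seg R a' k" using seg_shift[OF P(1), of a i k] a unfolding a'_def by simp
    then have aR: "a' \<in> R" "a' + k - 1 \<in> R" using k sL unfolding seg_def by auto
    from that show False
    proof
      assume "z = a - 1"
      then have z: "u + p \<le> a' - 1" "a' - 1 < v" using i unfolding a'_def by auto
      then have "a' \<noteq> v" "\<not> a' < v" using aR vB disj fr[of a'] unfolding free_def by auto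
      then show False using z by simp
    next
      assume "z = a + k"
      then have z: "u + p \<le> a' + k" "a' + k < v" using i unfolding a'_def by auto
      have "\<not> u + p < a' + k"
      proof
        assume "u + p < a' + k"
        then have "free R B (a' + k - 1)" using z by (intro fr) auto
        then show False using aR unfolding free_def by simp
      qed
      then have "a' + k = u + p" using z by linarith
      then have e': "u + p - k = a'" by simp
      have "p = k" using seg_right_unique[of R "u + p" p k] u a' unfolding e' by simp
      then show False using pk by simp
    qed
  qed
  \<comment> \<open>The block covers \<open>v - 1\<close>, so \<open>v\<close> has lost its left
    free neighbor, whereas \<open>a\<close> has lost none.\<close>
  have fin: "wins 2 (R \<union> arc x0 w) (B \<union> arc y' w)"
    if pl: "placed R B x0 y' w" and nt: "a - 1 \<notin> arc y' w" "a + k \<notin> arc y' w" for y'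
  proof (rule block_wins[where a = a and b = v])
    have sub: "arc x0 w \<subseteq> arc (u + p) (v - (u + p))" by (rule arc_subset) (use xb in auto)
    show "valid (R \<union> arc x0 w) (B \<union> arc y' w)" by (rule placed_valid[OF g pl])
    show "seg (R \<union> arc x0 w) a k" using placed_segR[OF g pl] a by blast
    show "seg (B \<union> arc y' w) v k" using placed_segB[OF g pl] v by blast
    show "c mod N = v mod N" if "seg (B \<union> arc y' w) c k" for c
    proof -
      have "seg B c k" using placed_segB[OF g pl] that pw(2)[OF order_refl] by blast
      then show ?thesis by (rule uniq)
    qed
    show "\<not> seg (R \<union> arc x0 w) c (k - 1)" for c
      using placed_segR[OF g pl, of c "k - 1"] no[of c] k sL by auto
    have "v - 1 \<in> arc x0 w" using xb sL by (intro arcI) auto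
    then have "\<not> free (R \<union> arc x0 w) (B \<union> arc y' w) (v - 1)" unfolding placed_free by simp
    moreover have "a - 1 \<notin> arc x0 w" "a + k \<notin> arc x0 w"
      using out[of "a - 1"] out[of "a + k"] sub by auto
    ultimately show "free (R \<union> arc x0 w) (B \<union> arc y' w) (a - 1) \<and>
        free (R \<union> arc x0 w) (B \<union> arc y' w) (a + k) \<and>
        \<not> (free (R \<union> arc x0 w) (B \<union> arc y' w) (v - 1) \<and> free (R \<union> arc x0 w)
          (B \<union> arc y' w) (v + k)) \<or>
        (free (R \<union> arc x0 w) (B \<union> arc y' w) (a - 1) \<or> free (R \<union> arc x0 w) (B
          \<union> arc y' w) (a + k)) \<and>
        \<not> free (R \<union> arc x0 w) (B \<union> arc y' w) (v - 1) \<and> \<not> free (R \<union> arc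
          x0 w) (B \<union> arc y' w) (v + k)"
      using nb nt unfolding placed_free by blast
  qed (use k sL in auto)
  have "wins (m + 2 + nat w) R B"
  proof (rule build[OF g bB sL fr, where x = x0])
    show "\<not> free R B (u + p - 1)" "\<not> free R B v" by fact+
    show "u + p \<le> x0 - sL" "x0 + w \<le> v" "x0 + w \<notin> R" using xb nRb by auto
  next
    fix y' assume y'x: "x0 < y'" and y'v: "y' + sL \<le> v" and pl: "placed R B (x0 - sL + 1) y' sL"
    let ?X = "x0 - sL + 1"
    let ?R = "R \<union> arc ?X sL" and ?B = "B \<union> arc y' sL"
    have x0i: "x0 \<in> arc ?X sL" using sL by (intro arcI) auto
    have na': "\<not> adj ?R ?B (d - sL + 1) p sL \<and> \<not> adj ?R ?B (d - sL + 1) sL p"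
    proof (rule not_adj_between[OF g pl pw(1)[OF sL(2)] nsB[OF sL(2)]])
      show "x0 < y'" "y' + sL \<le> v" by fact+
      show "z \<notin> B" if "x0 < z" "z < v" for z
        using fr[of z] that xb unfolding free_def by auto
      show "\<not> free ?R ?B x0" using x0i unfolding free_def by simp
      show "\<not> free ?R ?B v" using vB unfolding free_def by simp
      show "\<not> seg B v p" using seg_left_unique v pk by blast
      have "x0 \<notin> B" using frb unfolding free_def by simp
      then show "\<not> seg B (x0 + 1 - p) p" using p1 unfolding seg_def by (auto dest!: spec[of _ x0])
    qed (use d in auto)
    have "wins m ?R ?B"
    proof (rule gap_wins[OF gws(2)])
      show "valid ?R ?B" by (rule placed_valid[OF g pl])
      show "longer_than ?R (sL - 1)" "longer_than ?B (sL - 1)"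
        using placed_longer[OF g pl bR bB] sL by auto
      show "p \<noteq> sL" by (rule pw) (use sL in auto)
      show "seg ?R u p" using placed_segR[OF g pl] u by auto
      show "seg ?R (u + p + (d - sL + 1)) sL"
        using placed_segR[OF g pl] x0d by (auto simp: algebra_simps)
      show "free ?R ?B z" if z: "u + p \<le> z" "z < u + p + (d - sL + 1)" for z
      proof -
        have "z \<notin> arc y' sL" by (rule not_arc') (use z y'x y'v len sL x0d in auto)
        moreover have "z \<notin> arc ?X sL" by (rule not_arc') (use z len sL xb x0d in auto)
        ultimately show ?thesis unfolding placed_free using fr[of z] z sL xb x0d by auto
      qed
    qed (use na' in auto)
    then show "wins (m + 2) ?R ?B" by (rule wins_mono) simp
  next
    fix y' assume y': "u + p \<le> y'" "y' + w \<le> x0" and pl: "placed R B x0 y' w"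
    have "arc y' w \<subseteq> arc (u + p) (v - (u + p))" by (rule arc_subset) (use y' xb in auto)
    then have "wins 2 (R \<union> arc x0 w) (B \<union> arc y' w)"
      using fin[OF pl] out[of "a - 1"] out[of "a + k"] by blast
    then show "wins (m + 2) (R \<union> arc x0 w) (B \<union> arc y' w)" by (rule wins_mono) simp
  next
    fix y' assume y': "\<And>z. y' \<le> z \<Longrightarrow> z < y' + w \<Longrightarrow> z \<notin> arc (u
      + p) (v - (u + p))"
      and pl: "placed R B x0 y' w"
    let ?R = "R \<union> arc x0 w" and ?B = "B \<union> arc y' w"
    show "wins (m + 2) ?R ?B"
    proof (cases "adj ?R ?B d p w \<or> adj ?R ?B d w p")
      case False
      have "wins m ?R ?B"
      proof (rule gap_wins[OF gws(1)])
        show "valid ?R ?B" by (rule placed_valid[OF g pl])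
        show "longer_than ?R (w - 1)" "longer_than ?B (w - 1)"
          using placed_longer[OF g pl bR bB] sL by auto
        show "p \<noteq> w" by (rule pw) (use sL in auto)
        show "seg ?R u p" using placed_segR[OF g pl] u by auto
        show "seg ?R (u + p + d) w"
          using placed_segR[OF g pl] x0d by auto
        show "free ?R ?B z" if z: "u + p \<le> z" "z < u + p + d" for z
        proof -
          have "z \<notin> arc y' w"
            by (rule free_mid[of _ _ "u + p" "v - (u + p)"]) (use y' z xb x0d sL in auto)
          moreover have "z \<notin> arc x0 w" by (rule not_arc') (use z len sL xb x0d in auto)
          ultimately show ?thesis unfolding placed_free using fr[of z] z sL xb x0d by auto
        qed
      qed (use False in auto)
      then show ?thesis by (rule wins_mono) simp
    next
      case True
      have yB: "free R B z" if "y' \<le> z" "z < y' + w" for z using pl that unfolding placed_def by blast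
      have adjL: "seg B (y' - d - p) p \<and> (\<forall>z. y' - d \<le> z \<and> z < y' \<longrightarrow>
        free R B z)"
        if "adj ?R ?B d p w"
        using adj_left[OF g pl pw(1)[OF order_refl] nsB[OF order_refl] that] unfolding placed_free by blast
      have adjR: "seg B (y' + w + d) p \<and> (\<forall>z. y' + w \<le> z \<and> z < y' + w + d
        \<longrightarrow> free R B z)"
        if "adj ?R ?B d w p"
        using adj_right[OF g pl pw(1)[OF order_refl] nsB[OF order_refl] that] unfolding placed_free by blast
      \<comment> \<open>A reply that touches \<open>a\<close> and also lies at distance
        \<open>d\<close> from a blue component of length \<open>p\<close> would be the symmetric
        configuration that \<open>noL\<close> and \<open>noR\<close> exclude.\<close>
      have nt1: "a - 1 \<notin> arc y' w"
      proof
        assume "a - 1 \<in> arc y' w"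
        then obtain i where i: "y' \<le> a - 1 + i * N" "a - 1 + i * N < y' + w" by (rule arcE)
        define a' where "a' = a + i * N"
        have a': "seg R a' k" using seg_shift[OF P(1), of a i k] a unfolding a'_def by simp
        then have aR: "a' \<in> R" using k sL unfolding seg_def by auto
        have "\<not> a' < y' + w" using yB[of a'] i aR unfolding a'_def free_def by auto
        then have e': "a' = y' + w" using i unfolding a'_def by simp
        from True show False
        proof
          assume "adj ?R ?B d p w"
          then have L: "seg B (y' - d - p) p" "\<And>z. y' - d \<le> z \<Longrightarrow> z < y'
            \<Longrightarrow> free R B z"
            using adjL by auto
          show False
          proof (rule noL[OF L(1)])
            show "seg R (y' - d - p + p + (d + w)) k" using a' e' by (simp add: algebra_simps)
            show "free R B z" if "y' - d - p + p \<le> z" "z < y' - d - p + p + (d + w)" for z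
              using that L(2)[of z] yB[of z] by (cases "z < y'") auto
          qed
        next
          assume "adj ?R ?B d w p"
          then have "free R B (y' + w)" using adjR d by auto
          then show False using aR e' unfolding free_def by simp
        qed
      qed
      have nt2: "a + k \<notin> arc y' w"
      proof
        assume "a + k \<in> arc y' w"
        then obtain i where i: "y' \<le> a + k + i * N" "a + k + i * N < y' + w" by (rule arcE)
        define a' where "a' = a + i * N"
        have a': "seg R a' k" using seg_shift[OF P(1), of a i k] a unfolding a'_def by simp
        then have aR: "a' + k - 1 \<in> R" using k sL unfolding seg_def by auto
        have "\<not> y' \<le> a' + k - 1" using yB[of "a' + k - 1"] i aR unfolding a'_def free_def by auto
        then have e': "a' + k = y'" using i unfolding a'_def by simp
        from True show False
        proof
          assume "adj ?R ?B d p w"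
          then have "free R B (y' - 1)" using adjL d by auto
          then show False using aR e' unfolding free_def by auto
        next
          assume "adj ?R ?B d w p"
          then have L: "seg B (y' + w + d) p" "\<And>z. y' + w \<le> z \<Longrightarrow> z < y' + w + d
            \<Longrightarrow> free R B z"
            using adjR by auto
          show False
          proof (rule noR[OF L(1)])
            have "y' + w + d - (d + w) - k = a'" using e' by simp
            then show "seg R (y' + w + d - (d + w) - k) k" using a' by simp
            show "free R B z" if "y' + w + d - (d + w) \<le> z" "z < y' + w + d" for z
              using that L(2)[of z] yB[of z] by (cases "z < y' + w") auto
          qed
        qed
      qed
      show ?thesis by (rule wins_mono[OF fin[OF pl nt1 nt2]]) simp
    qed
  qed
  then show ?thesis .
qed

text \<open>One cell leaves no space for a block, but filling it extends \<open>u\<close> and blocks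
  \<open>v\<close> at once. The reply has to extend a blue component of length \<open>p\<close>, and
  \<open>noL\<close> and \<open>noR\<close> keep it away from \<open>a\<close>. By
  \<open>k < p\<close> the new components of length \<open>p + 1\<close> are confused with neither
  \<open>k\<close> nor \<open>k - 1\<close>.\<close>

lemma room_wins_1:
  assumes g: "valid R B"
    and u: "seg R u p" and v: "seg B v k" and e: "v = u + p + 1"
    and fr: "free R B (u + p)"
    and a: "seg R a k" and pk: "k < p" and k: "2 \<le> k" "k + 1 < N"
    and uniq: "\<And>c. seg B c k \<Longrightarrow> c mod N = v mod N"
    and no: "\<And>c. \<not> seg R c (k - 1)"
    and noL: "\<And>b. seg B b p \<Longrightarrow> seg R (b + p + 1) k \<Longrightarrow> \<not> free R B (b
      + p)"
    and noR: "\<And>b. seg B b p \<Longrightarrow> seg R (b - 1 - k) k \<Longrightarrow> \<not> free R B (b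
      - 1)"
    and nb: "free R B (a - 1) \<and> free R B (a + k) \<or>
        (free R B (a - 1) \<or> free R B (a + k)) \<and> \<not> free R B (v + k)"
  shows "wins 3 R B"
proof (rule winsI[OF fr])
  have disj: "R \<inter> B = {}" and P: "periodic R" "periodic B" using g unfolding valid_def by auto
  fix y assume y: "free R B y" "y \<notin> cell (u + p)" "same_type R (u + p) B y"
  let ?x = "u + p"
  let ?R = "R \<union> cell ?x" and ?B = "B \<union> cell y"
  have vB: "v \<in> B" using v unfolding seg_def by auto
  have "u + p + 1 \<notin> R" using vB e disj by auto
  then have t: "runs R ?x p 0" using u unfolding runs_def seg_def by auto
  then have runs: "runs B y p 0 \<or> runs B y 0 p" using same_typeD[OF y(3)] by blast
  have yB: "y \<notin> B" using y(1) unfolding free_def by simp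
  have bsy: "seg B (y - p) p \<or> seg B (y + 1) p"
    using runs runs_seg_left[of B y p 0] runs_seg_right[of B y 0 p] yB pk k by auto
  have g': "valid ?R ?B" by (rule valid_cell[OF g fr y(1,2)])
  have uR: "u \<in> R" using u unfolding seg_def by auto
  have xi: "a + k \<notin> cell ?x" "a - 1 \<notin> cell ?x"
  proof -
    show "a + k \<notin> cell ?x"
    proof
      assume "a + k \<in> cell ?x"
      then have "?x mod N = (a + k) mod N" unfolding cell_def mem_Collect_eq by metis
      then obtain i where i: "?x = a + k + i * N" by (rule modE)
      have "seg R (a + i * N) k" using seg_shift[OF P(1), of a i k] a by simp
      then have "seg R (?x - k) k" using i by (simp add: algebra_simps)
      then have "p = k" using seg_right_unique[of R ?x p k] u by simp
      then show False using pk by simp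
    qed
    show "a - 1 \<notin> cell ?x"
    proof
      assume "a - 1 \<in> cell ?x"
      then have "?x mod N = (a - 1) mod N" unfolding cell_def mem_Collect_eq by metis
      then obtain i where i: "?x = a - 1 + i * N" by (rule modE)
      then have i': "v = a + i * N" using e by simp
      have "a \<in> R" using a k unfolding seg_def by auto
      then have "v \<in> R" using periodic_shift[OF P(1), of a i] i' by simp
      then show False using vB disj by auto
    qed
  qed
  have yi: "a - 1 \<notin> cell y" "a + k \<notin> cell y"
  proof -
    have frs: "free R B (y + i * N)" for i using free_shift[OF g] y(1) by blast
    have bs: "seg B (y + i * N - p) p \<or> seg B (y + i * N + 1) p" for i
      using bsy seg_shift[OF P(2), of "y - p" i p] seg_shift[OF P(2), of "y + 1" i p]
      by (auto simp: algebra_simps)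
    show "a - 1 \<notin> cell y"
    proof
      assume "a - 1 \<in> cell y"
      then have "(a - 1) mod N = y mod N" unfolding cell_def mem_Collect_eq .
      then obtain i where i: "a - 1 = y + i * N" by (rule modE)
      have ai: "y + i * N = a - 1" using i by simp
      have "a \<in> R" using a k unfolding seg_def by auto
      then have "a \<notin> B" using disj by auto
      then have "\<not> seg B a p" using pk k unfolding seg_def by auto
      then have "seg B (a - 1 - p) p" using bs[of i] unfolding ai by simp
      from noL[OF this] show False using a frs[of i] unfolding ai by simp
    qed
    show "a + k \<notin> cell y"
    proof
      assume "a + k \<in> cell y"
      then have "(a + k) mod N = y mod N" unfolding cell_def mem_Collect_eq .
      then obtain i where i: "a + k = y + i * N" by (rule modE)
      have ai: "y + i * N = a + k" using i by simp
      have "a + k - 1 \<in> R" using a k unfolding seg_def by auto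
      then have "a + k - 1 \<notin> B" using disj by auto
      then have "\<not> seg B (a + k - p) p" using pk k unfolding seg_def
        by (auto dest!: spec[of _ "a + k - 1"])
      then have "seg B (a + k + 1) p" using bs[of i] unfolding ai by simp
      from noR[OF this] show False using a frs[of i] unfolding ai by simp
    qed
  qed
  have uB: "u \<notin> ?B"
  proof -
    have "u \<notin> B" using uR disj by auto
    moreover have "u \<notin> cell y"
    proof
      assume "u \<in> cell y"
      then have "free R B u" using free_cong[OF g, of u y] y(1) unfolding cell_def mem_Collect_eq by blast
      then show False using uR unfolding free_def by simp
    qed
    ultimately show ?thesis by simp
  qed
  have segB: "seg B c k" if c: "seg ?B c k" for c
    using runs seg_insert[OF P(2) _ _ _ c, of u p 0] seg_insert[OF P(2) _ _ _ c, of u 0 p] uB pk by auto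
  have vR: "v \<notin> ?R"
  proof -
    have "v \<notin> cell ?x"
    proof
      assume "v \<in> cell ?x"
      then have "v = ?x" by (rule cell_near) (use e N3 in auto)
      then show False using e by simp
    qed
    then show ?thesis using vB disj by auto
  qed
  have segR: "\<not> seg ?R c (k - 1)" for c
  proof
    assume c: "seg ?R c (k - 1)"
    have "seg R c (k - 1) \<or> k - 1 = p + 0 + 1"
      by (rule seg_insert[OF P(1) _ _ t c, of v]) (use vR in auto)
    then show False using no[of c] pk by auto
  qed
  have segv: "seg ?B v k"
  proof -
    have bsk: "y \<notin> cell (v - 1)"
      using y(2) e unfolding cell_def by simp
    moreover have "y \<notin> cell (v + k)"
    proof
      assume "y \<in> cell (v + k)"
      then have "(v + k) mod N = y mod N" unfolding cell_def mem_Collect_eq by metis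
      then obtain i where i: "v + k = y + i * N" by (rule modE)
      have "seg B (v + k - k) k" using v by simp
      then have 1: "l = k" if "runs B (v + k) l r" for l r using runs_left_seg that by blast
      have "runs B (y + i * N) p 0 \<or> runs B (y + i * N) 0 p" using runs runs_shift[OF P(2)] by blast
      then show False using 1 i pk k by fastforce
    qed
    ultimately show ?thesis using seg_keep v by blast
  qed
  have fr': "free ?R ?B (a - 1) \<longleftrightarrow> free R B (a - 1)" "free ?R ?B (a + k)
    \<longleftrightarrow> free R B (a + k)"
    using xi yi unfolding free_def by auto
  have "v - 1 \<in> cell ?x" using e unfolding cell_def by simp
  then have v1: "\<not> free ?R ?B (v - 1)" unfolding free_def by simp
  have v2: "free ?R ?B (v + k) \<Longrightarrow> free R B (v + k)" unfolding free_def by auto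
  have "wins 2 ?R ?B"
  proof (rule block_wins[where a = a and b = v, OF g' _ k segv])
    show "seg ?R a k" by (rule seg_keep[OF a]) (use xi in \<open>auto simp: cell_sym[of ?x]\<close>)
    show "c mod N = v mod N" if "seg ?B c k" for c using uniq segB that by blast
  qed (use segR fr' v1 v2 nb in blast)+
  then show "wins (3 - 1) ?R ?B" by simp
qed simp

end

section \<open>Existence of plans\<close>

lemma gap_plan_mono: "gap_plan g t m \<Longrightarrow> m \<le> m' \<Longrightarrow> gap_plan g t m'"
  by (erule gap_plan.cases) (auto intro: gap_plan.intros)

text \<open>A single block of length \<open>g - 2\<close> leaves a gap of length 1 on each
  side.\<close>

lemma gap_plan_small:
  assumes "1 \<le> g" "g \<noteq> 2" "g \<le> t + 2" "1 + nat t \<le> m"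
  shows "gap_plan g t m"
proof (cases "g = 1")
  case True
  then show ?thesis using assms by (auto intro: gap_plan.one)
next
  case False
  have "gap_plan (1 + (g - 2) + 1) t m"
    by (rule gap_plan.split[where sL = 1 and m = 1]) (use assms False in \<open>auto intro:
      gap_plan.one\<close>)
  then show ?thesis by simp
qed

lemma square_add_le: "1 \<le> (t::int) \<Longrightarrow> nat (t\<^sup>2) + nat t \<le> nat ((t + 1)\<^sup>2)"
  by (simp add: power2_eq_square algebra_simps nat_add_distrib[symmetric])

lemma le_square: "0 \<le> (t::int) \<Longrightarrow> 1 + nat t \<le> nat ((t + 1)\<^sup>2)"
  by (simp add: power2_eq_square algebra_simps nat_le_eq_zle le_nat_iff)

text \<open>Each stage at least halves the gap and costs at most \<open>t\<close> moves, and the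
  next stage works with a smaller \<open>t\<close>. The squares absorb these costs by
  \<open>square_add_le\<close>. The case distinctions keep every gap away from length 2.\<close>

lemma gap_plan_power:
  "1 \<le> g \<Longrightarrow> g \<noteq> 2 \<Longrightarrow> g \<le> 2 ^ k \<Longrightarrow> int k + 4
    \<le> t \<Longrightarrow> gap_plan g t (nat ((t + 1)\<^sup>2))"
proof (induction k arbitrary: g t)
  case 0
  then show ?case by (intro gap_plan_small le_square) auto
next
  case (Suc k)
  show ?case
  proof (cases "g \<le> t + 2")
    case True
    then show ?thesis using Suc.prems by (intro gap_plan_small le_square) auto
  next
    case False
    \<comment> \<open>For \<open>g = t + 3\<close> a block of length \<open>t\<close> would have to
      leave gaps of lengths 1 and 2.\<close>
    define s where "s = (if g = t + 3 then t - 1 else t)"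
    have s: "s \<le> t" "3 \<le> s" "4 \<le> g - s" using False Suc.prems unfolding s_def by auto
    show ?thesis
    proof (cases "g - s \<le> 5")
      case True
      have sq: "1 + nat (s - 1) \<le> nat (s\<^sup>2)" using le_square[of "s - 1"] s by simp
      have m1: "1 \<le> nat (s\<^sup>2)" using sq by simp
      have "nat (s\<^sup>2) + nat s \<le> nat ((s + 1)\<^sup>2)" by (rule square_add_le) (use s in simp)
      also have "\<dots> \<le> nat ((t + 1)\<^sup>2)" using s by (intro nat_mono power_mono) auto
      finally have "gap_plan (1 + s + (g - s - 1)) t (nat ((t + 1)\<^sup>2))"
        using s True m1 sq by (intro gap_plan.split[where sL = 1 and m = "nat (s\<^sup>2)"] gap_plan_small)
          (auto intro: gap_plan.one)
      then show ?thesis by simp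
    next
      case F2: False
      then have st: "s = t" using s_def by (auto split: if_splits)
      define d where "d = (g - t) div 2"
      have r: "6 \<le> g - t" using F2 st by simp
      have d: "3 \<le> d" "3 \<le> g - t - d" "2 * d \<le> g" "2 * (g - t - d) \<le> g"
        using r Suc.prems unfolding d_def by auto
      have pw: "d \<le> 2 ^ k" "g - t - d \<le> 2 ^ k" using d Suc.prems(3) by auto
      let ?m = "nat (t\<^sup>2)"
      have IH: "gap_plan x (t - 1) ?m" if "1 \<le> x" "x \<noteq> 2" "x \<le> 2 ^ k" for x
        using Suc.IH[of x "t - 1"] that Suc.prems by simp
      have m1: "1 \<le> ?m" "1 + nat (t - 2) \<le> ?m" using le_square[of "t - 1"] Suc.prems by auto
      \<comment> \<open>Growth to the left leaves a gap of length \<open>d - sL + 1\<close>, which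
        must again differ from 2; hence \<open>t - 1\<close> rather than \<open>t\<close> for
        \<open>d = t + 1\<close>.\<close>
      have "\<exists>sL. 1 \<le> sL \<and> sL \<le> t \<and> gap_plan (d - sL + 1) (sL - 1) ?m"
      proof -
        consider "d \<le> t" | "d = t + 1" | "t + 2 \<le> d" by linarith
        then show ?thesis
        proof cases
          case 1
          then show ?thesis using d m1 by (intro exI[of _ d]) (auto intro: gap_plan.one)
        next
          case 2
          then show ?thesis using d m1 Suc.prems by (intro exI[of _ "t - 1"]) (auto intro!: gap_plan_small)
        next
          case 3
          then show ?thesis using pw Suc.prems by (intro exI[of _ t]) (auto intro!: IH)
        qed
      qed
      then obtain sL where sL: "1 \<le> sL" "sL \<le> t" "gap_plan (d - sL + 1) (sL - 1) ?m" by blast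
      have "gap_plan (d + t + (g - t - d)) t (nat ((t + 1)\<^sup>2))"
        by (rule gap_plan.split[where sL = sL and m = ?m])
          (use sL IH d pw square_add_le[of t] Suc.prems in auto)
      then show ?thesis by simp
    qed
  qed
qed

text \<open>The analogue of a plan for a gap that ends at a blue component: the block abuts on this
  component, so only one gap \<open>d\<close> remains. Where length \<open>t\<close> would leave a
  gap of length 2, \<open>t - 1\<close> is taken for the block or for its variant that grows to the
  left.\<close>

lemma room_split:
  assumes "2 \<le> e" "e \<le> 2 ^ k" "int k + 5 \<le> t"
  shows "\<exists>d w sL. e = d + w \<and> 1 \<le> sL \<and> sL \<le> w \<and> w \<le> t \<and> gap_plan d
    (w - 1) (nat ((t + 1)\<^sup>2)) \<and>
    gap_plan (d - sL + 1) (sL - 1) (nat ((t + 1)\<^sup>2))"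
proof -
  let ?m = "nat ((t + 1)\<^sup>2)"
  have m: "1 + nat t \<le> ?m" by (rule le_square) (use assms in simp)
  have IH: "gap_plan x (t - 1) ?m" if "1 \<le> x" "x \<noteq> 2" "x \<le> 2 ^ k" for x
  proof -
    have "gap_plan x (t - 1) (nat (t\<^sup>2))" using gap_plan_power[OF that, of "t - 1"] assms by simp
    then show ?thesis by (rule gap_plan_mono) (use assms in \<open>auto intro!: nat_mono power_mono\<close>)
  qed
  consider "e \<le> t + 1" | "e = t + 2" | "t + 3 \<le> e" "e \<le> 2 * t" | "e = 2 * t + 1" | "2 * t + 2
    \<le> e" by linarith
  then show ?thesis
  proof cases
    case 1
    then show ?thesis using assms m
      by (intro exI[of _ 1] exI[of _ "e - 1"]) (auto intro!: gap_plan.one)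
  next
    case 2
    then show ?thesis using assms m
      by (intro exI[of _ 3] exI[of _ "t - 1"]) (auto intro!: gap_plan.one gap_plan_small)
  next
    case 3
    then show ?thesis using assms m
      by (intro exI[of _ "e - t"] exI[of _ t]) (auto intro!: gap_plan.one IH)
  next
    case 4
    then show ?thesis using assms m
      by (intro exI[of _ "e - t"] exI[of _ t] exI[of _ "t - 1"]) (auto intro!: gap_plan_small IH)
  next
    case 5
    then show ?thesis using assms m
      by (intro exI[of _ "e - t"] exI[of _ t]) (auto intro!: IH)
  qed
qed

context board begin

text \<open>A room of length 1 cannot be split into a block and a gap; it is left to
  \<open>room_wins_1\<close>, hence the alternative with \<open>k < p\<close>.\<close>

lemma room_wins':
  assumes g: "valid R B" and bR: "longer_than R t" and bB: "longer_than B t"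
    and u: "seg R u p" and v: "seg B v k" and e: "v = u + p + e"
    and fr: "\<And>z. u + p \<le> z \<Longrightarrow> z < v \<Longrightarrow> free R B z"
    and a: "seg R a k" and pk: "p \<noteq> k" and k: "t + 2 \<le> k" "k + 1 < N"
    and uniq: "\<And>c. seg B c k \<Longrightarrow> c mod N = v mod N"
    and no: "\<And>c. \<not> seg R c (k - 1)"
    and noL: "\<And>b. seg B b p \<Longrightarrow> seg R (b + p + e) k \<Longrightarrow>
        (\<And>z. b + p \<le> z \<Longrightarrow> z < b + p + e \<Longrightarrow> free R B z)
          \<Longrightarrow> False"
    and noR: "\<And>b. seg B b p \<Longrightarrow> seg R (b - e - k) k \<Longrightarrow>
        (\<And>z. b - e \<le> z \<Longrightarrow> z < b \<Longrightarrow> free R B z) \<Longrightarrow> False"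
    and nb: "free R B (a - 1) \<and> free R B (a + k) \<or>
        (free R B (a - 1) \<or> free R B (a + k)) \<and> \<not> free R B (v + k)"
    and eb: "2 \<le> e \<or> e = 1 \<and> k < p" "e \<le> 2 ^ i" "int i + 5 \<le> t"
  shows "wins (nat ((t + 1)\<^sup>2) + 2 + nat t) R B"
proof (cases "2 \<le> e")
  case True
  obtain d w sL where s: "e = d + w" "1 \<le> sL" "sL \<le> w" "w \<le> t" "gap_plan d (w - 1) (nat ((t +
    1)\<^sup>2))"
    "gap_plan (d - sL + 1) (sL - 1) (nat ((t + 1)\<^sup>2))" using room_split[OF True eb(2,3)] by blast
  have "wins (nat ((t + 1)\<^sup>2) + 2 + nat w) R B"
    by (rule room_wins[OF g bR bB u v _ fr a pk k uniq no _ _ nb s(2-6)])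
      (use e s(1) noL noR in auto)
  then show ?thesis by (rule wins_mono) (use s in auto)
next
  case False
  then have e1: "e = 1" and kp: "k < p" using eb(1) by auto
  have "wins 3 R B"
  proof (rule room_wins_1[OF g u v _ _ a kp _ k(2) uniq no _ _ nb])
    show "v = u + p + 1" using e e1 by simp
    show "free R B (u + p)" by (rule fr) (use e e1 in auto)
    show "2 \<le> k" using k eb(3) by simp
    show "\<not> free R B (b + p)" if b: "seg B b p" "seg R (b + p + 1) k" for b
    proof
      assume "free R B (b + p)"
      then have "free R B z" if "b + p \<le> z" "z < b + p + e" for z
        using that e1 by (cases "z = b + p") auto
      then show False using noL[OF b(1)] b(2) e1 by blast
    qed
    show "\<not> free R B (b - 1)" if b: "seg B b p" "seg R (b - 1 - k) k" for b
    proof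
      assume "free R B (b - 1)"
      then have "free R B z" if "b - e \<le> z" "z < b" for z
        using that e1 by (cases "z = b - 1") auto
      then show False using noR[OF b(1)] b(2) e1 by blast
    qed
  qed
  then show ?thesis by (rule wins_mono) (use le_square[of t] eb(3) in auto)
qed

lemma seg_arc: "1 \<le> s \<Longrightarrow> s < N \<Longrightarrow> seg (arc x s) a p \<longleftrightarrow>
  p = s \<and> a mod N = x mod N"
  using seg_add_iff[OF periodic_empty, of s x a p] by (auto simp: seg_def dest: spec[of _ a])

section \<open>Reflections of the board\<close>

definition refl_set :: "int \<Rightarrow> int set \<Rightarrow> int set" where
  "refl_set c S = {z. c - z \<in> S}"

lemma refl_mod: "(c - z) mod N = x mod N \<longleftrightarrow> z mod N = (c - x) mod (N::int)"
  by (auto simp: mod_eq_dvd_iff dvd_diff_commute algebra_simps)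

lemma refl_cell: "refl_set c (cell x) = cell (c - x)"
  unfolding refl_set_def cell_def by (simp add: refl_mod)

lemma refl_arc: "refl_set c (arc x j) = arc (c - x - j + 1) j"
proof -
  have "c - z \<in> arc x j \<longleftrightarrow> z \<in> arc (c - x - j + 1) j" for z
  proof
    assume "c - z \<in> arc x j"
    then obtain k where "x \<le> c - z + k * N" "c - z + k * N < x + j" by (rule arcE)
    then show "z \<in> arc (c - x - j + 1) j" unfolding arc_iff by (intro exI[of _ "-k"]) auto
  next
    assume "z \<in> arc (c - x - j + 1) j"
    then obtain k where "c - x - j + 1 \<le> z + k * N" "z + k * N < c - x - j + 1 + j" by (rule arcE)
    then show "c - z \<in> arc x j" unfolding arc_iff by (intro exI[of _ "-k"]) auto
  qed
  then show ?thesis unfolding refl_set_def by auto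
qed

lemma refl_runs: "runs S x l r \<Longrightarrow> runs (refl_set c S) (c - x) r l"
  unfolding runs_def refl_set_def by (auto simp: algebra_simps)

lemma refl_Un: "refl_set c (S \<union> T) = refl_set c S \<union> refl_set c T"
  unfolding refl_set_def by auto

lemma refl_refl [simp]: "refl_set c (refl_set c S) = S"
  unfolding refl_set_def by simp

lemma wins_refl:
  assumes W: "refl_set c W = W"
  shows "wins m R B \<Longrightarrow> wins m (refl_set c R) (refl_set c B)"
proof (induction rule: wins.induct)
  case (1 R B x m)
  have fr: "free (refl_set c R) (refl_set c B) z \<longleftrightarrow> free R B (c - z)" for z
    using W unfolding free_def refl_set_def by blast
  show ?case
  proof (rule wins.intros[of _ _ "c - x"])
    show "free (refl_set c R) (refl_set c B) (c - x)" using 1 fr by simp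
    fix y assume y: "free (refl_set c R) (refl_set c B) y" "y \<notin> cell (c - x)"
      "same_type (refl_set c R) (c - x) (refl_set c B) y"
    obtain l r where t: "runs (refl_set c R) (c - x) l r"
      "runs (refl_set c B) y l r \<or> runs (refl_set c B) y r l" using y(3) unfolding same_type_def by blast
    have "runs R x r l" using refl_runs[OF t(1), of c] by simp
    moreover have "runs B (c - y) r l \<or> runs B (c - y) l r"
      using t(2) refl_runs[of "refl_set c B" y _ _ c] by auto
    ultimately have "same_type R x B (c - y)" unfolding same_type_def by blast
    moreover have "c - y \<notin> cell x" using y(2) refl_cell[of c x] unfolding refl_set_def by auto
    moreover have "free R B (c - y)" using y(1) fr by simp
    ultimately have "wins m (refl_set c (R \<union> cell x)) (refl_set c (B \<union> cell (c - y)))"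
      by (intro 1)
    then show "wins m (refl_set c R \<union> cell (c - x)) (refl_set c B \<union> cell y)"
      by (simp add: refl_Un refl_cell)
  qed
qed

lemma arc_window:
  assumes "c \<le> x" "x + j \<le> c + N" "c \<le> z" "z < c + N"
  shows "z \<in> arc x j \<longleftrightarrow> x \<le> z \<and> z < x + j"
  using assms not_arc[of x j z] not_arc'[of z x j] arcI[of x z j]
    by (cases "x \<le> z"; cases "z < x + j") auto

lemma cell_window: "c \<le> x \<Longrightarrow> x < c + N \<Longrightarrow> c \<le> z \<Longrightarrow> z <
  c + N \<Longrightarrow> z \<in> cell x \<longleftrightarrow> z = x"
  using arc_window[of c x 1 z] unfolding arc_1 by auto

lemma segs_shift:
  assumes "valid R B" "c mod N = y mod N" "seg R (c + i) k"
    "\<And>z. c + lo \<le> z \<Longrightarrow> z < c + hi \<Longrightarrow> free R B z"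
  shows "seg R (y + i) k \<and> (\<forall>z. y + lo \<le> z \<and> z < y + hi \<longrightarrow> free R B z)"
proof -
  obtain q where q: "c = y + q * N" using modE[OF assms(2)] .
  have P: "periodic R" using assms(1) unfolding valid_def by simp
  have e: "c + i = (y + i) + q * N" using q by simp
  have "seg R (y + i) k" using assms(3) seg_shift[OF P, of "y + i" q k] unfolding e by simp
  moreover have "free R B z" if "y + lo \<le> z" "z < y + hi" for z
    using assms(4)[of "z + q * N"] that q free_shift[OF assms(1), of z q] by simp
  ultimately show ?thesis by blast
qed

section \<open>The path\<close>

text \<open>
  Since the first move was the middle cell \<open>h\<close>, the space to the right of the red block
  exceeds the whole free space to its left. A second red component one cell away from the right wall
  cannot be copied on the left at the same distance, except next to a wall or to the first block, where
  it is blocked.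
\<close>

lemma path_stage:
  assumes N: "N = 2 * h + 2" and W: "W = cell (-1)" and t: "int k + 5 \<le> t" "2 * h + 2 \<le> 2 ^ k"
    and h: "6 * t + 40 \<le> h" and y: "0 \<le> y" "y + (t + 4) \<le> h"
  shows "wins (nat ((t + 1)\<^sup>2) + nat (2 * t) + 5) (arc h (t + 4)) (arc y (t + 4))"
proof -
  \<comment> \<open>The second block is shorter than the first and can therefore be built after it.
    Its length \<open>t + 2\<close> is the least that \<open>room_wins'\<close> allows for a
    component that is to be blocked.\<close>
  define s1 where "s1 = t + 4"
  define s2 where "s2 = t + 2"
  \<comment> \<open>The block ends at cell \<open>2 * h - 1\<close>, so exactly one free cell is
    left before the wall \<open>2 * h + 1\<close>.\<close>
  define p0 where "p0 = 2 * h - s2"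
  define n where "n = 2 * h + 1"
  let ?R = "arc h s1" and ?B = "arc y s1"
  have t5: "5 \<le> t" using t(1) by simp
  note sd = s1_def s2_def p0_def n_def
  have w: "-1 \<le> y" "y + s1 \<le> h" using y s1_def by auto
  have inR: "z \<in> ?R \<longleftrightarrow> h \<le> z \<and> z < h + s1" if "-1 \<le> z" "z < n" for z
    by (rule arc_window[where c = "-1"]) (use that N h t5 sd in auto)
  have inB: "z \<in> ?B \<longleftrightarrow> y \<le> z \<and> z < y + s1" if "-1 \<le> z" "z < n" for z
    by (rule arc_window[where c = "-1"]) (use that N h t5 w sd in auto)
  have inW: "z \<in> W \<longleftrightarrow> z = -1" if "-1 \<le> z" "z < n" for z
    unfolding W by (rule cell_window[where c = "-1"]) (use that N h t5 sd in auto)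
  have nW: "n \<in> W" unfolding W cell_def n_def using N by (simp add: mod_eq_dvd_iff add.commute)
  have valid: "valid ?R ?B"
  proof -
    have "z \<notin> arc h s1" if "y \<le> z" "z < y + s1" for z using inR[of z] that w h t5 sd by auto
    then have "valid ({} \<union> arc h s1) ({} \<union> arc y s1)"
    proof (intro valid_arc)
      show "valid {} {}" unfolding valid_def by (simp add: W)
      show "free {} {} z" if "h \<le> z" "z < h + s1" for z
        using inW[of z] that h t5 sd unfolding free_def by auto
      show "free {} {} z \<and> z \<notin> arc h s1"
        if "y \<le> z" "z < y + s1" "\<And>z. y \<le> z \<Longrightarrow> z < y + s1 \<Longrightarrow> z
          \<notin> arc h s1" for z
        using inW[of z] that h t5 y sd unfolding free_def by auto
    qed
    then show ?thesis by simp
  qed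
  have sN: "1 \<le> s1" "s1 < N" "1 \<le> s2" "s2 < N" "s2 + 1 < N" using N h t5 sd by auto
  have segR: "seg ?R a p \<longleftrightarrow> p = s1 \<and> a mod N = h mod N" for a p
    by (rule seg_arc[OF sN(1,2)])
  have segB: "seg ?B a p \<longleftrightarrow> p = s1 \<and> a mod N = y mod N" for a p
    by (rule seg_arc[OF sN(1,2)])
  have bigR: "longer_than ?R (t + 2)" "longer_than ?B (t + 2)" unfolding longer_than_def segR segB
    using sd by auto
  have fr: "free ?R ?B z" if "h + s1 \<le> z" "z < n" for z
    using inR[of z] inB[of z] inW[of z] that w h t5 sd y unfolding free_def by auto
  have nfh: "\<not> free ?R ?B (h + s1 - 1)" "\<not> free ?R ?B h" "h \<in> ?R" "h + s1 - 1 \<in> ?R"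
    using inR[of "h + s1 - 1"] inR[of h] h t5 sd unfolding free_def by auto
  have nfn: "\<not> free R' B' n" for R' B' using nW unfolding free_def by simp
  have nf1: "\<not> free R' B' (-1)" for R' B' using inW[of "-1"] h t5 sd unfolding free_def by auto
  have xb: "h + s1 + 2 * s2 + 3 < p0" "p0 + s2 + 1 = n" using h t5 sd by auto
  have ends: "p0 - 1 \<notin> ?R" "p0 + 1 \<notin> ?R" "p0 + s2 \<notin> ?R" "p0 - s2 \<notin> ?R"
    by (subst inR; use xb sN h t5 sd in auto)+
  have nseg: "\<not> seg ?B b s2" for b unfolding segB using sd by auto
  have nB: "n \<notin> ?B" using valid nW unfolding valid_def by auto
  \<comment> \<open>The positions of the blue block that remain: in the gap between the red blocks,
    at the left wall, or at the left side of the first red block. Unless it lies in the gap away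
    from the left end, it has a blocked side and \<open>block_wins\<close> applies at once.\<close>
  have final: "wins (nat ((t + 1)\<^sup>2) + 2 + nat t) (?R \<union> arc p0 s2) (?B \<union> arc y' s2)"
    if pl: "placed ?R ?B p0 y' s2"
      and win: "h + s1 \<le> y' \<and> y' + s2 \<le> p0 \<or> y' = 0 \<and> y' + s2 \<le> h \<or> y' + s2 =
        h \<and> 0 \<le> y'" for y'
  proof -
    let ?R' = "?R \<union> arc p0 s2" and ?B' = "?B \<union> arc y' s2"
    have g': "valid ?R' ?B'" by (rule placed_valid[OF valid pl])
    have sR: "seg ?R' a p \<longleftrightarrow> p = s1 \<and> a mod N = h mod N \<or> p = s2 \<and> a mod N
      = p0 mod N" for a p
      unfolding placed_segR[OF valid pl] segR ..
    have sB: "seg ?B' a p \<longleftrightarrow> p = s1 \<and> a mod N = y mod N \<or> p = s2 \<and> a mod N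
      = y' mod N" for a p
      unfolding placed_segB[OF valid pl] segB ..
    have inP: "z \<in> arc p0 s2 \<longleftrightarrow> p0 \<le> z \<and> z < p0 + s2"
      if "-1 \<le> z" "z < n" for z
      by (rule arc_window[where c = "-1"]) (use that N h t5 sd xb in auto)
    have inY: "z \<in> arc y' s2 \<longleftrightarrow> y' \<le> z \<and> z < y' + s2"
      if "-1 \<le> z" "z < n" for z
      by (rule arc_window[where c = "-1"]) (use that N h t5 sd xb win in auto)
    have f2: "free ?R' ?B' (p0 + s2)"
      unfolding placed_free using fr[of "p0 + s2"] inP[of "p0 + s2"] inY[of "p0 + s2"] xb win sd h t5 by auto
    have f1: "free ?R' ?B' (p0 - 1) \<or> y' + s2 = p0"
      unfolding placed_free using fr[of "p0 - 1"] inP[of "p0 - 1"] inY[of "p0 - 1"] xb win sd h t5 by auto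
    have p0R: "p0 \<in> ?R'" using inP[of p0] xb sd h t5 by auto
    have no: "\<not> seg ?R' c (s2 - 1)" for c unfolding sR using sd by auto
    have uniq: "c mod N = y' mod N" if "seg ?B' c s2" for c using that unfolding sB using sd by auto
    have segs: "seg ?R' p0 s2" "seg ?B' y' s2" "seg ?R' h s1" "seg ?B' y s1" unfolding sR sB by auto
    have block: "wins (nat ((t + 1)\<^sup>2) + 2 + nat t) ?R' ?B'"
      if "\<not> free ?R' ?B' (y' - 1) \<or> \<not> free ?R' ?B' (y' + s2)" and "h + s1 \<le> y'
        \<Longrightarrow> \<not> free ?R' ?B' (y' - 1)"
    proof -
      have "wins 2 ?R' ?B'"
      proof (rule block_wins[OF g' segs(1) _ sN(5) segs(2) uniq no])
        show "2 \<le> s2" using sd t5 by simp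
        show "free ?R' ?B' (p0 - 1) \<and> free ?R' ?B' (p0 + s2) \<and>
            \<not> (free ?R' ?B' (y' - 1) \<and> free ?R' ?B' (y' + s2)) \<or>
            (free ?R' ?B' (p0 - 1) \<or> free ?R' ?B' (p0 + s2)) \<and>
            \<not> free ?R' ?B' (y' - 1) \<and> \<not> free ?R' ?B' (y' + s2)"
        proof (cases "y' + s2 = p0")
          case True
          have "\<not> free ?R' ?B' (y' + s2)" unfolding True using p0R unfolding free_def by simp
          moreover have "h + s1 \<le> y'" using True xb win sd h t5 by auto
          ultimately show ?thesis using f2 that(2) by blast
        next
          case False
          then show ?thesis using f1 f2 that(1) by blast
        qed
      qed
      then show ?thesis by (rule wins_mono) simp
    qed
    have notfree: "\<not> free ?R' ?B' z" if "z \<in> ?R" for z using that unfolding free_def by simp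
    consider "y' = h + s1" | "y' = 0" "y' + s2 \<le> h" | "y' + s2 = h" "0 \<le> y'" | "h + s1 < y'" "y' +
      s2 \<le> p0" using win by linarith
    then show ?thesis
    proof cases
      case 1
      then have "\<not> free ?R' ?B' (y' - 1)" using notfree[OF nfh(4)] by simp
      then show ?thesis by (intro block) auto
    next
      case 2
      then have "\<not> free ?R' ?B' (y' - 1)" using nf1 by simp
      then show ?thesis by (intro block) auto
    next
      case 3
      then have "\<not> free ?R' ?B' (y' + s2)" using notfree[OF nfh(3)] by simp
      then show ?thesis using 3 h t5 sd by (intro block) auto
    next
      case 4
      show ?thesis
      proof (rule room_wins'[OF g' _ _ segs(3,2) _ _ segs(1) _ _ sN(5) uniq no, of t "y' - (h + s1)" k])
        show "longer_than ?R' t" "longer_than ?B' t" unfolding longer_than_def sR sB using sd by auto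
        show "free ?R' ?B' z" if "h + s1 \<le> z" "z < y'" for z
          unfolding placed_free using fr[of z] inP[of z] inY[of z] that 4 xb sd h t5 by auto
        show "(2::int) \<le> y' - (h + s1) \<or> y' - (h + s1) = 1 \<and> s2 < s1" using 4 sd by auto
        show "y' - (h + s1) \<le> 2 ^ k" using 4 xb t(2) sd h t5 by auto
        show "free ?R' ?B' (p0 - 1) \<and> free ?R' ?B' (p0 + s2) \<or>
            (free ?R' ?B' (p0 - 1) \<or> free ?R' ?B' (p0 + s2)) \<and> \<not> free ?R' ?B' (y' + s2)"
        proof (cases "y' + s2 = p0")
          case True
          have "\<not> free ?R' ?B' (y' + s2)" unfolding True using p0R unfolding free_def by simp
          then show ?thesis using f2 by blast
        next
          case False
          then show ?thesis using f1 f2 by blast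
        qed
      next
        fix b assume b: "seg ?B' b s1" "seg ?R' (b + s1 + (y' - (h + s1))) s2"
          "\<And>z. b + s1 \<le> z \<Longrightarrow> z < b + s1 + (y' - (h + s1)) \<Longrightarrow> free
            ?R' ?B' z"
        define e where "e = y' - (h + s1)"
        have e1: "1 \<le> e" using 4 e_def by simp
        have "b mod N = y mod N" using b(1) unfolding sB using sd by auto
        from segs_shift[OF g' this, of "s1 + e" s2 s1 "s1 + e"] b(2,3)
        have c: "seg ?R' (y + (s1 + e)) s2" "\<And>z. y + s1 \<le> z \<Longrightarrow> z < y + s1 + e
          \<Longrightarrow> free ?R' ?B' z"
          unfolding e_def by (auto simp: algebra_simps)
        \<comment> \<open>To the right of the blue block at \<open>y\<close>, the first red cell is
          \<open>h\<close>, where the component has length \<open>s1\<close> and not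
          \<open>s2\<close>.\<close>
        have "y + s1 + e \<le> h" using c(2)[of h] notfree[OF nfh(3)] w by linarith
        moreover have "y + s1 + e \<in> ?R'" using c(1) sN unfolding seg_def by (auto simp: algebra_simps)
        ultimately have "y + s1 + e = h"
          using inR[of "y + s1 + e"] inP[of "y + s1 + e"] xb w y e1 sd h t5 by auto
        then have "seg ?R' h s2" using c(1) by (simp add: algebra_simps)
        then show False using seg_left_unique[OF segs(3), of s2] sd by auto
      next
        fix b assume b: "seg ?B' b s1" "seg ?R' (b - (y' - (h + s1)) - s2) s2"
          "\<And>z. b - (y' - (h + s1)) \<le> z \<Longrightarrow> z < b \<Longrightarrow> free ?R' ?B' z"
        define e where "e = y' - (h + s1)"
        have e1: "1 \<le> e" using 4 e_def by simp
        have "b mod N = y mod N" using b(1) unfolding sB using sd by auto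
        from segs_shift[OF g' this, of "- e - s2" s2 "- e" 0] b(2,3)
        have c: "seg ?R' (y - e - s2) s2" "\<And>z. y - e \<le> z \<Longrightarrow> z < y \<Longrightarrow>
          free ?R' ?B' z"
          unfolding e_def by (auto simp: algebra_simps)
        have "-1 < y - e" using c(2)[of "-1"] nf1[of ?R' ?B'] w y by linarith
        moreover have "y - e - 1 \<in> ?R'" using c(1) sN unfolding seg_def by auto
        ultimately show False
          using inR[of "y - e - 1"] inP[of "y - e - 1"] xb w y e1 sd h t5 by auto
      qed (use sd t5 t 4 in auto)
    qed
  qed
  have "wins (nat ((t + 1)\<^sup>2) + 2 + nat t + nat s2) ?R ?B"
  proof (rule build[OF valid bigR(2) sN(3) order_refl _ fr, where x = p0])
    show "s2 \<le> t + 2" using sd by simp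
    show "\<not> free ?R ?B (h + s1 - 1)" "\<not> free ?R ?B n" by (rule nfh nfn)+
    show "h + s1 \<le> p0 - s2" "p0 + s2 \<le> n" "p0 + s2 \<notin> ?R" using xb sN ends by auto
  next
    fix y' assume y'p: "p0 < y'" and y'n: "y' + s2 \<le> n" and pl: "placed ?R ?B (p0 - s2 + 1) y' s2"
    let ?X = "p0 - s2 + 1"
    let ?R' = "?R \<union> arc ?X s2" and ?B' = "?B \<union> arc y' s2"
    have p0i: "p0 \<in> arc ?X s2" using sN by (intro arcI) auto
    have na': "\<not> adj ?R' ?B' (?X - (h + s1)) s1 s2 \<and> \<not> adj ?R' ?B' (?X - (h + s1)) s2 s1"
    proof (rule not_adj_between[OF valid pl _ nseg])
      show "p0 < y'" "y' + s2 \<le> n" by fact+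
      show "z \<notin> ?B" if "p0 < z" "z < n" for z
        using fr[of z] that xb sN unfolding free_def by auto
      show "\<not> free ?R' ?B' p0" using p0i unfolding free_def by simp
      show "\<not> free ?R' ?B' n" by (rule nfn)
      show "\<not> seg ?B n s1" using nB sN unfolding seg_def by (auto dest!: spec[of _ n])
      have "p0 \<notin> ?B" using fr[of p0] xb sN unfolding free_def by auto
      then show "\<not> seg ?B (p0 + 1 - s1) s1" using sN unfolding seg_def by (auto dest!: spec[of _ p0])
    qed (use xb sN sd in auto)
    have "wins (nat ((t + 1)\<^sup>2)) ?R' ?B'"
    proof (rule gap_wins[of "?X - (h + s1)" t _ _ _ s1 s2 h])
      show "gap_plan (?X - (h + s1)) t (nat ((t + 1)\<^sup>2))"
        by (rule gap_plan_power[of _ k]) (use xb sN sd t h in auto)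
      show "valid ?R' ?B'" by (rule placed_valid[OF valid pl])
      show "longer_than ?R' t" "longer_than ?B' t"
        using placed_longer[OF valid pl bigR] sd unfolding longer_than_def by fastforce+
      show "seg ?R' h s1" using placed_segR[OF valid pl] segR by auto
      have eX: "h + s1 + (?X - (h + s1)) = ?X" by simp
      show "seg ?R' (h + s1 + (?X - (h + s1))) s2"
        unfolding eX using placed_segR[OF valid pl] by blast
      show "free ?R' ?B' z" if z: "h + s1 \<le> z" "z < h + s1 + (?X - (h + s1))" for z
      proof -
        have "z \<notin> arc y' s2" by (rule not_arc') (use z y'p y'n N h t5 sd in auto)
        moreover have "z \<notin> arc ?X s2" by (rule not_arc') (use z N h t5 sd in auto)
        ultimately show ?thesis unfolding placed_free using fr[of z] z xb sN by auto
      qed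
    qed (use na' sd in auto)
    then show "wins (nat ((t + 1)\<^sup>2) + 2 + nat t) ?R' ?B'" by (rule wins_mono) simp
  next
    fix y' assume "h + s1 \<le> y'" "y' + s2 \<le> p0" and pl: "placed ?R ?B p0 y' s2"
    then show "wins (nat ((t + 1)\<^sup>2) + 2 + nat t) (?R \<union> arc p0 s2) (?B \<union> arc y' s2)"
      using final[OF pl] by blast
  next
    fix y' assume y': "\<And>z. y' \<le> z \<Longrightarrow> z < y' + s2 \<Longrightarrow> z \<notin> arc
      (h + s1) (n - (h + s1))"
      and pl: "placed ?R ?B p0 y' s2"
    let ?R' = "?R \<union> arc p0 s2" and ?B' = "?B \<union> arc y' s2"
    have g': "valid ?R' ?B'" by (rule placed_valid[OF valid pl])
    define g where "g = p0 - h - s1"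
    \<comment> \<open>The gap and the two block lengths add up to \<open>h\<close>, which is the
      whole space to the left of the middle cell. A blue copy of the configuration has to fill it
      completely and is pressed against the wall or the red block.\<close>
    have gd: "g = h - s1 - s2" unfolding g_def sd by simp
    have s12: "s1 \<noteq> s2" using sd by simp
    have fin: "wins (nat ((t + 1)\<^sup>2) + 2 + nat t) ?R' ?B'"
      if "y' = y'' + i * N" "y'' = 0 \<and> y'' + s2 \<le> h \<or> y'' + s2 = h \<and> 0 \<le> y''" for y'' i
    proof -
      have "placed ?R ?B p0 y'' s2" using placed_shift[of ?R ?B p0 y'' i s2] pl valid that(1) by simp
      moreover have "arc y' s2 = arc y'' s2" by (rule arc_cong) (simp add: that(1))
      ultimately show ?thesis using final[of y''] that(2) by auto
    qed
    have fy: "free ?R ?B z" if "y' \<le> z" "z < y' + s2" for z using pl that unfolding placed_def by blast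
    consider "adj ?R' ?B' g s1 s2" | "adj ?R' ?B' g s2 s1" | "\<not> adj ?R' ?B' g s1 s2" "\<not> adj ?R'
      ?B' g s2 s1" by blast
    then show "wins (nat ((t + 1)\<^sup>2) + 2 + nat t) ?R' ?B'"
    proof cases
      case 1
      from adj_left[OF valid pl s12 nseg 1]
      have a: "seg ?B (y' - g - s1) s1" "\<And>z. y' - g \<le> z \<Longrightarrow> z < y' \<Longrightarrow>
        free ?R ?B z"
        unfolding placed_free by auto
      have "(y' - g - s1) mod N = y mod N" using a(1) unfolding segB by blast
      then obtain i where "y' - g - s1 = y + i * N" by (rule modE)
      then have i: "y' = (y + s1 + g) + i * N" by simp
      define y'' where "y'' = y + s1 + g"
      have fz: "free ?R ?B z" if "y + s1 \<le> z" "z < y'' + s2" for z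
      proof -
        have "free ?R ?B (z + i * N)" using a(2)[of "z + i * N"] fy[of "z + i * N"] that i unfolding y''_def
          by (cases "z < y + s1 + g") auto
        then show ?thesis using free_shift[OF valid] by blast
      qed
      have "y'' + s2 \<le> h" using fz[of h] nfh w by linarith
      then have "y'' + s2 = h" unfolding y''_def gd using y by simp
      then show ?thesis using i y gd xb sd h t5 by (intro fin[of y'' i]) (auto simp: y''_def)
    next
      case 2
      from adj_right[OF valid pl s12 nseg 2]
      have a: "seg ?B (y' + s2 + g) s1" "\<And>z. y' + s2 \<le> z \<Longrightarrow> z < y' + s2 + g
        \<Longrightarrow> free ?R ?B z"
        unfolding placed_free by auto
      have "(y' + s2 + g) mod N = y mod N" using a(1) unfolding segB by blast
      then obtain i where "y' + s2 + g = y + i * N" by (rule modE)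
      then have i: "y' = (y - s2 - g) + i * N" by simp
      define y'' where "y'' = y - s2 - g"
      have fz: "free ?R ?B z" if "y'' \<le> z" "z < y" for z
      proof -
        have "free ?R ?B (z + i * N)" using a(2)[of "z + i * N"] fy[of "z + i * N"] that i unfolding y''_def
          by (cases "z < y - g") auto
        then show ?thesis using free_shift[OF valid] by blast
      qed
      have "0 \<le> y''" using fz[of "-1"] nf1[of ?R ?B] y by linarith
      then have "y'' = 0" unfolding y''_def gd using y w by simp
      then show ?thesis using i y gd xb sd h t5 by (intro fin[of y'' i]) (auto simp: y''_def)
    next
      case 3
      have "wins (nat ((t + 1)\<^sup>2)) ?R' ?B'"
      proof (rule gap_wins[of g t _ _ _ s1 s2 h])
        show "gap_plan g t (nat ((t + 1)\<^sup>2))"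
          by (rule gap_plan_power[of _ k]) (use g_def gd xb sN sd t h in auto)
        show "valid ?R' ?B'" by (rule g')
        show "longer_than ?R' t" "longer_than ?B' t"
          using placed_longer[OF valid pl bigR] sd unfolding longer_than_def by fastforce+
        show "seg ?R' h s1" using placed_segR[OF valid pl] segR by auto
        have eX: "h + s1 + g = p0" by (simp add: g_def)
        show "seg ?R' (h + s1 + g) s2"
          unfolding eX using placed_segR[OF valid pl] by blast
        show "free ?R' ?B' z" if z: "h + s1 \<le> z" "z < h + s1 + g" for z
        proof -
          have "z \<in> arc (h + s1) (n - (h + s1))" using z sN xb g_def by (intro arcI) auto
          then have "z \<notin> arc y' s2"
            using arc_disjoint[OF periodic_arc, of y' s2 "h + s1" "n - (h + s1)" z] y' by blast
          moreover have "z \<notin> arc p0 s2" by (rule not_arc') (use z N h t5 sd g_def in auto)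
          ultimately show ?thesis unfolding placed_free using fr[of z] z xb sN g_def by auto
        qed
      qed (use 3 s12 in auto)
      then show ?thesis by (rule wins_mono) simp
    qed
  qed
  moreover have "nat ((t + 1)\<^sup>2) + 2 + nat t + nat s2 \<le> nat ((t + 1)\<^sup>2) + nat (2 * t) + 5"
    using sd t5 by simp
  ultimately show ?thesis using wins_mono unfolding s1_def by blast
qed

text \<open>The reflection that exchanges the two halves fixes the middle cell, so the first reply
  may be assumed to lie in the left half.\<close>

lemma path_wins:
  assumes N: "N = 2 * h + 2" and W: "W = cell (-1)" and t: "int k + 5 \<le> t" "2 * h + 2 \<le> 2 ^ k"
    and h: "6 * t + 40 \<le> h"
  shows "wins (nat ((t + 1)\<^sup>2) + nat (3 * t) + 10) {} {}"
proof -
  define n where "n = 2 * h + 1"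
  have t5: "5 \<le> t" using t(1) by simp
  have inW: "z \<in> W \<longleftrightarrow> z = -1" if "-1 \<le> z" "z < n" for z
    unfolding W by (rule cell_window[where c = "-1"]) (use that N h t5 n_def in auto)
  have nW: "n \<in> W" unfolding W cell_def n_def using N by (simp add: mod_eq_dvd_iff add.commute)
  have g0: "valid {} {}" unfolding valid_def by (simp add: W)
  have W': "refl_set (2 * h) W = W"
  proof -
    have "cell (2 * h + 1) = cell (-1)"
      by (rule cell_eq) (use N in \<open>simp add: mod_eq_dvd_iff add.commute\<close>)
    then show ?thesis unfolding W refl_cell by simp
  qed
  let ?m = "nat ((t + 1)\<^sup>2) + nat (2 * t) + 5"
  have low: "wins (?m + nat (t + 3)) (arc h 1) (arc y 1)" if y: "0 \<le> y" "y < h" for y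
  proof -
    have "wins (?m + nat (t + 3)) ({} \<union> arc h 1) ({} \<union> arc y 1)"
    proof (rule grow[where t = "t + 4" and L = h and H = n and X = h and s = "t + 4" and yi = y])
      show "free {} {} z" if "h \<le> z" "z < n" for z using inW[of z] that h t5 unfolding free_def by auto
      show "free {} {} z \<and> z \<notin> arc h (n - h)" if "y \<le> z" "z < y + 1" for z
      proof -
        have "z = y" using that by simp
        moreover have "y \<notin> arc h (n - h)" by (rule not_arc') (use y N n_def in auto)
        ultimately show ?thesis using inW[of y] y n_def unfolding free_def by auto
      qed
    next
      fix y' assume y': "y' \<le> y" "y < y' + (t + 4)"
        "\<And>z. y' \<le> z \<Longrightarrow> z < y' + (t + 4) \<Longrightarrow> free {} {} z \<and> z
          \<notin> arc h (n - h)"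
      have "y' + (t + 4) \<le> h"
      proof (rule ccontr)
        assume "\<not> ?thesis"
        then have "h \<notin> arc h (n - h)" using y' y by (intro y'(3)[THEN conjunct2]) auto
        then show False using n_def h t5 by (auto intro: arcI)
      qed
      moreover have "0 \<le> y'"
      proof (rule ccontr)
        assume "\<not> ?thesis"
        then have "free {} {} (-1)" using y' y by (intro y'(3)[THEN conjunct1]) auto
        then show False using inW[of "-1"] n_def h t5 unfolding free_def by auto
      qed
      ultimately show "wins ?m ({} \<union> arc h (t + 4)) ({} \<union> arc y' (t + 4))"
        using path_stage[OF N W t h] by simp
    qed (use g0 h t5 n_def nW in \<open>auto simp: longer_than_def seg_def free_def\<close>)
    then show ?thesis by simp
  qed
  have "wins (Suc (?m + nat (t + 3))) {} {}"
  proof (rule place[of _ _ h])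
    show "free {} {} h" using inW[of h] h t5 n_def unfolding free_def by auto
    fix y0 assume y0: "free {} {} y0" "y0 \<notin> cell h"
    \<comment> \<open>The representative of the reply in the period that starts at the wall
      \<open>-1\<close>.\<close>
    define y1 where "y1 = (y0 + 1) mod N - 1"
    have y1r: "-1 \<le> y1" "y1 < n"
      using N n_def pos_mod_sign[of N "y0 + 1"] pos_mod_bound[of N "y0 + 1"] N3 unfolding y1_def by linarith+
    have m: "y0 mod N = y1 mod N" unfolding y1_def by (simp add: mod_simps)
    have y1c: "arc y0 1 = arc y1 1" by (rule arc_cong[OF m])
    have "free {} {} y1" using y0(1) free_cong[OF g0 m] by simp
    then have "y1 \<noteq> -1" using inW[of "-1"] n_def h t5 unfolding free_def by auto
    then have y10: "0 \<le> y1" using y1r by simp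
    have "y1 \<noteq> h" using y0(2) m unfolding cell_def by auto
    have "wins (?m + nat (t + 3)) (arc h 1) (arc y1 1)"
    proof (cases "y1 < h")
      case True
      then show ?thesis using low y10 by blast
    next
      case False
      have "wins (?m + nat (t + 3)) (arc h 1) (arc (2 * h - y1) 1)"
        by (rule low) (use False \<open>y1 \<noteq> h\<close> y1r n_def in auto)
      from wins_refl[OF W' this] show ?thesis by (simp add: refl_arc)
    qed
    then show "wins (?m + nat (t + 3)) ({} \<union> arc h 1) ({} \<union> arc y0 1)" unfolding y1c by simp
  qed auto
  then show ?thesis by (rule wins_mono) (use t5 in auto)
qed

section \<open>The cycle\<close>

text \<open>
  The middle cell of the odd gap leaves the second player no mirror image inside the gap, and a copy in
  the other gap at the right distance leaves different rooms because \<open>N\<close> is odd.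
\<close>

lemma cycle_stage:
  assumes W: "W = {}" and oddN: "odd N" and t: "int k + 5 \<le> t" "N \<le> 2 ^ k"
    and s: "t + 4 \<le> s" and h: "2 * t + 10 \<le> h" and len: "2 * s + 2 * h + 1 \<le> N"
  shows "wins (nat ((t + 1)\<^sup>2) + nat (2 * t) + 5) (arc x s) (arc (x + s + 2 * h + 1) s)"
proof -
  define s2 where "s2 = t + 2"
  define r where "r = x + s"
  define p0 where "p0 = r + h"
  define y where "y = x + s + 2 * h + 1"
  \<comment> \<open>The room left between the new red block and the blue component at
    \<open>y\<close>.\<close>
  define e where "e = h + 1 - s2"
  let ?R = "arc x s" and ?B = "arc y s"
  have t5: "5 \<le> t" using t(1) by simp
  have od: "s2 = t + 2" "r = x + s" "p0 = x + s + h" "y = x + s + 2 * h + 1" "e = h - t - 1"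
    using s2_def r_def p0_def y_def e_def by auto
  have inR: "z \<in> ?R \<longleftrightarrow> z < r" if "x \<le> z" "z < x + N" for z
    using arc_window[of x x s z] that len h t5 s od by auto
  have inB: "z \<in> ?B \<longleftrightarrow> y \<le> z \<and> z < y + s" if "x \<le> z" "z < x + N" for z
    by (rule arc_window[where c = x]) (use that len h t5 s od in auto)
  have valid: "valid ?R ?B"
  proof -
    have "z \<notin> arc x s" if "y \<le> z" "z < y + s" for z using inR[of z] that len h t5 s od by auto
    moreover have "valid {} {}" unfolding valid_def using W by simp
    moreover have "free {} {} z" for z unfolding free_def using W by simp
    ultimately have "valid ({} \<union> arc x s) ({} \<union> arc y s)" by (intro valid_arc) blast+
    then show ?thesis by simp
  qed
  have sN: "1 \<le> s" "s < N" "1 \<le> s2" "s2 < N" "s2 + 1 < N" "s + 1 < N" using len h t5 s od by auto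
  have segR: "seg ?R a p \<longleftrightarrow> p = s \<and> a mod N = x mod N" for a p
    by (rule seg_arc[OF sN(1,2)])
  have segB: "seg ?B a p \<longleftrightarrow> p = s \<and> a mod N = y mod N" for a p
    by (rule seg_arc[OF sN(1,2)])
  have bigR: "longer_than ?R (t + 2)" "longer_than ?B (t + 2)" unfolding longer_than_def segR segB
    using s by auto
  have fr: "free ?R ?B z" if "r \<le> z" "z < y" for z
    using inR[of z] inB[of z] that len h t5 s od W unfolding free_def by auto
  have fr2: "free ?R ?B z" if "y + s \<le> z" "z < x + N" for z
    using inR[of z] inB[of z] that len h t5 s od W unfolding free_def by auto
  have xN: "x + N \<in> ?R" using periodic_shift[OF periodic_arc, of x 1 x s] inR[of x] sN od by auto
  have cR: "r - 1 \<in> ?R" "r - 1 \<notin> ?B" using inR[of "r - 1"] inB[of "r - 1"] len h t5 s od by auto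
  have cB: "y \<in> ?B" "y \<notin> ?R" "y + s - 1 \<in> ?B" "y + s - 1 \<notin> ?R"
    using inR[of y] inB[of y] inR[of "y + s - 1"] inB[of "y + s - 1"] len h t5 s od by auto
  have nfr: "\<not> free ?R ?B (r - 1)" "\<not> free ?R ?B y" "\<not> free ?R ?B (x + N)"
    using cR cB xN unfolding free_def by auto
  have xb: "r + s2 + 3 < p0" "p0 + s2 + e \<le> y" "y \<le> p0 + s2 + e" "s2 + 3 < e" "e < h"
    "p0 + h + 1 \<le> y" "y \<le> p0 + h + 1"
    using h t5 od by auto
  have xc: "r + s2 + 3 < p0" "p0 + s2 + 3 < y" using xb by auto
  have s12: "s \<noteq> s2" "s \<noteq> s2 + 1" using s od by auto
  have ends: "p0 - 1 \<notin> ?R" "p0 + 1 \<notin> ?R" "p0 + s2 \<notin> ?R" "p0 - s2 \<notin> ?R"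
    by (subst inR; use len s h t5 od in auto)+
  have nseg: "\<not> seg ?B b s2" for b unfolding segB using s12 by auto
  have final: "wins (nat ((t + 1)\<^sup>2) + 2 + nat t) (?R \<union> arc p0 s2) (?B \<union> arc y' s2)"
    if pl: "placed ?R ?B p0 y' s2"
      and win: "r \<le> y' \<and> y' + s2 \<le> p0 \<or> y' = y + s + h \<and> y' + s2 \<le> x + N" for y'
  proof -
    let ?R' = "?R \<union> arc p0 s2" and ?B' = "?B \<union> arc y' s2"
    have g': "valid ?R' ?B'" by (rule placed_valid[OF valid pl])
    have sR: "seg ?R' a p \<longleftrightarrow> p = s \<and> a mod N = x mod N \<or> p = s2 \<and> a mod N
      = p0 mod N" for a p
      unfolding placed_segR[OF valid pl] segR ..
    have sB: "seg ?B' a p \<longleftrightarrow> p = s \<and> a mod N = y mod N \<or> p = s2 \<and> a mod N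
      = y' mod N" for a p
      unfolding placed_segB[OF valid pl] segB ..
    have inP: "z \<in> arc p0 s2 \<longleftrightarrow> p0 \<le> z \<and> z < p0 + s2"
      if "x \<le> z" "z < x + N" for z
      by (rule arc_window[where c = x]) (use that len h t5 s od in auto)
    have inY: "z \<in> arc y' s2 \<longleftrightarrow> y' \<le> z \<and> z < y' + s2"
      if "x \<le> z" "z < x + N" for z
      by (rule arc_window[where c = x]) (use that len h t5 s od win in auto)
    have yb: "y \<le> x + N" "y + s \<le> x + N" "x \<le> r" using len od s t5 by auto
    have f2: "free ?R' ?B' (p0 + s2)"
      unfolding placed_free using fr[of "p0 + s2"] inP[of "p0 + s2"] inY[of "p0 + s2"] xb win sN yb h t5
        by auto
    have f1: "free ?R' ?B' (p0 - 1) \<or> y' + s2 = p0"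
      unfolding placed_free using fr[of "p0 - 1"] inP[of "p0 - 1"] inY[of "p0 - 1"] xb win sN yb h t5 by auto
    have p0R: "p0 \<in> ?R'" using inP[of p0] xb sN yb by auto
    have no: "\<not> seg ?R' c (s2 - 1)" "\<not> seg ?R' c (s - 1)" for c unfolding sR using s12 s t5 od
      by auto
    have uniq: "c mod N = y' mod N" if "seg ?B' c s2" for c using that s12 unfolding sB by auto
    have uniq2: "c mod N = y mod N" if "seg ?B' c s" for c using that s12 unfolding sB by auto
    have segs: "seg ?R' p0 s2" "seg ?B' y' s2" "seg ?R' x s" "seg ?B' y s" unfolding sR sB by auto
    have notfree: "\<not> free ?R' ?B' z" if "z \<in> ?R \<or> z \<in> ?B" for z using that
      unfolding free_def by auto
    have block: "wins (nat ((t + 1)\<^sup>2) + 2 + nat t) ?R' ?B'"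
      if "\<not> free ?R' ?B' (y' - 1) \<or> \<not> free ?R' ?B' (y' + s2)" and "y' + s2 \<le> p0
        \<Longrightarrow> \<not> free ?R' ?B' (y' - 1)"
    proof -
      have "wins 2 ?R' ?B'"
      proof (rule block_wins[OF g' segs(1) _ sN(5) segs(2) uniq no(1)])
        show "2 \<le> s2" using od t5 by simp
        show "free ?R' ?B' (p0 - 1) \<and> free ?R' ?B' (p0 + s2) \<and>
            \<not> (free ?R' ?B' (y' - 1) \<and> free ?R' ?B' (y' + s2)) \<or>
            (free ?R' ?B' (p0 - 1) \<or> free ?R' ?B' (p0 + s2)) \<and>
            \<not> free ?R' ?B' (y' - 1) \<and> \<not> free ?R' ?B' (y' + s2)"
        proof (cases "y' + s2 = p0")
          case True
          have "\<not> free ?R' ?B' (y' + s2)" unfolding True using p0R unfolding free_def by simp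
          then show ?thesis using f2 that(2) True by simp
        next
          case False
          then show ?thesis using f1 f2 that(1) by blast
        qed
      qed
      then show ?thesis by (rule wins_mono) simp
    qed
    consider "y' = r" | "y' + s2 = x + N" "y' = y + s + h" | "r < y'" "y' + s2 \<le> p0" | "y' = y + s + h"
      "y' + s2 < x + N"
      using win by linarith
    then show ?thesis
    proof cases
      case 1
      then have "\<not> free ?R' ?B' (y' - 1)" using notfree cR by simp
      then show ?thesis by (intro block) auto
    next
      case 2
      then have "\<not> free ?R' ?B' (y' + s2)" using notfree xN by simp
      then show ?thesis using 2 xb sN by (intro block) auto
    next
      case c: 3
      show ?thesis
      proof (rule room_wins'[OF g' _ _ segs(1,4) _ _ segs(3) _ _ sN(6) uniq2 no(2), of t e k])
        show "longer_than ?R' t" "longer_than ?B' t" unfolding longer_than_def sR sB using s od by auto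
        show "free ?R' ?B' z" if "p0 + s2 \<le> z" "z < y" for z
          unfolding placed_free using fr[of z] inP[of z] inY[of z] that c xb sN yb by auto
        show "e \<le> 2 ^ k" using xb t(2) len s h t5 by auto
        have "free ?R' ?B' r"
          unfolding placed_free using fr[of r] inP[of r] inY[of r] c xb sN yb by auto
        then have fx: "free ?R' ?B' (x + s)" using r_def by simp
        show "free ?R' ?B' (x - 1) \<and> free ?R' ?B' (x + s) \<or>
            (free ?R' ?B' (x - 1) \<or> free ?R' ?B' (x + s)) \<and> \<not> free ?R' ?B' (y + s)"
        proof (cases "y + s = x + N")
          case True
          have "\<not> free ?R' ?B' (y + s)" unfolding True using notfree xN by simp
          then show ?thesis using fx by blast
        next
          case False
          have "free ?R' ?B' (x + N - 1)"
            unfolding placed_free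
              using fr2[of "x + N - 1"] inP[of "x + N - 1"] inY[of "x + N - 1"] False c xb sN yb
            by auto
          then have "free ?R' ?B' (x - 1)" using free_shift[OF g', of "x - 1" 1] by (simp add: algebra_simps)
          then show ?thesis using fx by blast
        qed
      next
        fix b assume b: "seg ?B' b s2" "seg ?R' (b + s2 + e) s"
          "\<And>z. b + s2 \<le> z \<Longrightarrow> z < b + s2 + e \<Longrightarrow> free ?R' ?B' z"
        from segs_shift[OF g' uniq[OF b(1)], of "s2 + e" s s2 "s2 + e"] b(2,3)
        have "free ?R' ?B' z" if "y' + s2 \<le> z" "z < y' + s2 + e" for z
          using that by (auto simp: algebra_simps)
        then have "free ?R' ?B' p0" using c xb e_def p0_def by auto
        then show False using p0R unfolding free_def by simp
      next
        fix b assume b: "seg ?B' b s2" "seg ?R' (b - e - s) s"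
          "\<And>z. b - e \<le> z \<Longrightarrow> z < b \<Longrightarrow> free ?R' ?B' z"
        from segs_shift[OF g' uniq[OF b(1)], of "- e - s" s "- e" 0] b(2,3)
        have "free ?R' ?B' z" if "y' - e \<le> z" "z < y'" for z
          using that by (auto simp: algebra_simps)
        then have "free ?R' ?B' (r - 1)" using c xb e_def p0_def by auto
        then show False using notfree cR by blast
      qed (use xb sN s12 t s od in auto)
    next
      case c: 4
      show ?thesis
      proof (rule room_wins'[OF g' _ _ segs(1,4) _ _ segs(3) _ _ sN(6) uniq2 no(2), of t e k])
        show "longer_than ?R' t" "longer_than ?B' t" unfolding longer_than_def sR sB using s od by auto
        show "free ?R' ?B' z" if "p0 + s2 \<le> z" "z < y" for z
          unfolding placed_free using fr[of z] inP[of z] inY[of z] that c xb sN yb by auto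
        show "e \<le> 2 ^ k" using xb t(2) len s h t5 by auto
        have "free ?R' ?B' r"
          unfolding placed_free using fr[of r] inP[of r] inY[of r] c xb sN yb by auto
        then have fx: "free ?R' ?B' (x + s)" using r_def by simp
        have "free ?R' ?B' (x + N - 1)"
          unfolding placed_free using fr2[of "x + N - 1"] inP[of "x + N - 1"] inY[of "x + N - 1"] c xb sN yb
          by auto
        then have "free ?R' ?B' (x - 1)" using free_shift[OF g', of "x - 1" 1] by (simp add: algebra_simps)
        then show "free ?R' ?B' (x - 1) \<and> free ?R' ?B' (x + s) \<or>
            (free ?R' ?B' (x - 1) \<or> free ?R' ?B' (x + s)) \<and> \<not> free ?R' ?B' (y + s)" using fx
              by blast
      next
        fix b assume b: "seg ?B' b s2" "seg ?R' (b + s2 + e) s"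
          "\<And>z. b + s2 \<le> z \<Longrightarrow> z < b + s2 + e \<Longrightarrow> free ?R' ?B' z"
        from segs_shift[OF g' uniq[OF b(1)], of "s2 + e" s s2 "s2 + e"] b(2,3)
        have a: "seg ?R' (y' + s2 + e) s" "\<And>z. y' + s2 \<le> z \<Longrightarrow> z < y' + s2 + e
          \<Longrightarrow> free ?R' ?B' z"
          by (auto simp: algebra_simps)
        have 1: "y' + s2 + e \<le> x + N" using a(2)[of "x + N"] notfree[of "x + N"] xN c by linarith
        have 2: "y' + s2 + e \<in> ?R'" using a(1) sN unfolding seg_def by auto
        have "y' + s2 + e = x + N"
        proof (rule ccontr)
          define q where "q = y' + s2 + e"
          assume "y' + s2 + e \<noteq> x + N"
          then have "q < x + N" "x \<le> q" "\<not> q < r" "\<not> q < p0 + s2"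
            using 1 c xb sN yb h t5 unfolding q_def by linarith+
          then show False using 2 inR[of q] inP[of q] unfolding q_def[symmetric] by blast
        qed
        \<comment> \<open>Equal rooms would mean that the other gap has length
          \<open>2 * h + 1\<close> too; with two blocks of length \<open>s\<close> the board would
          then be even.\<close>
        then have "N = 2 * (s + 2 * h + 1)" using c od by simp
        then show False using oddN by simp
      next
        fix b assume b: "seg ?B' b s2" "seg ?R' (b - e - s) s"
          "\<And>z. b - e \<le> z \<Longrightarrow> z < b \<Longrightarrow> free ?R' ?B' z"
        from segs_shift[OF g' uniq[OF b(1)], of "- e - s" s "- e" 0] b(2,3)
        have a: "seg ?R' (y' - e - s) s" "\<And>z. y' - e \<le> z \<Longrightarrow> z < y'
          \<Longrightarrow> free ?R' ?B' z"
          by (auto simp: algebra_simps)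
        have 1: "y + s - 1 < y' - e" using a(2)[of "y + s - 1"] notfree[of "y + s - 1"] cB c h sN xb
          by linarith
        define q where "q = y' - e - 1"
        have 2: "q \<in> ?R'" using a(1) sN unfolding seg_def q_def by auto
        have "q < x + N" "x \<le> q" "\<not> q < r" "\<not> q < p0 + s2"
          using 1 c xb sN yb h t5 unfolding q_def by linarith+
        then show False using 2 inR[of q] inP[of q] by blast
      qed (use xb sN s12 t s od in auto)
    qed
  qed
  have yrN: "y - r < N" using len od s t5 by simp
  have "wins (nat ((t + 1)\<^sup>2) + 2 + nat t + nat s2) ?R ?B"
  proof (rule build[OF valid bigR(2) sN(3) order_refl _ fr, where x = p0])
    show "s2 \<le> t + 2" using s2_def by simp
    show "\<not> free ?R ?B (r - 1)" "\<not> free ?R ?B y" by (rule nfr)+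
    show "r \<le> p0 - s2" "p0 + s2 \<le> y" "p0 + s2 \<notin> ?R" using xc sN ends by auto
  next
    fix y' assume y'p: "p0 < y'" and y'n: "y' + s2 \<le> y" and pl: "placed ?R ?B (p0 - s2 + 1) y' s2"
    let ?X = "p0 - s2 + 1"
    let ?R' = "?R \<union> arc ?X s2" and ?B' = "?B \<union> arc y' s2"
    have p0i: "p0 \<in> ?R'" using sN by (auto intro: arcI)
    define g where "g = ?X - r"
    have gd: "g = h - s2 + 1" "4 \<le> g" unfolding g_def p0_def using xb p0_def by auto
    have na1: "\<not> adj ?R' ?B' g s s2"
    proof
      assume "adj ?R' ?B' g s s2"
      from adj_left[OF valid pl s12(1) nseg this]
      have a: "seg ?B (y' - g - s) s" "\<And>z. y' - g \<le> z \<Longrightarrow> z < y' \<Longrightarrow>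
        free ?R' ?B' z" by auto
      have "\<not> free ?R' ?B' p0" using p0i unfolding free_def by simp
      then have "p0 \<le> y' - g - 1" using a(2)[of p0] y'p by linarith
      moreover have "y' - g - 1 \<in> ?B" using a(1) sN unfolding seg_def by auto
      ultimately show False using fr[of "y' - g - 1"] y'n xb sN gd unfolding free_def by auto
    qed
    have na2: "\<not> adj ?R' ?B' g s2 s"
    proof
      assume "adj ?R' ?B' g s2 s"
      from adj_right[OF valid pl s12(1) nseg this]
      have a: "seg ?B (y' + s2 + g) s" "\<And>z. y' + s2 \<le> z \<Longrightarrow> z < y' + s2 + g
        \<Longrightarrow> free ?R' ?B' z" by auto
      have "\<not> free ?R' ?B' y" using cB unfolding free_def by simp
      then have 1: "y' + s2 + g \<le> y" using a(2)[of y] y'n by linarith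
      have "y' + s2 + g \<in> ?B" using a(1) sN unfolding seg_def by auto
      then have "\<not> y' + s2 + g < y" using fr[of "y' + s2 + g"] y'p xb sN gd unfolding free_def by auto
      then show False using 1 gd y'p xb by simp
    qed
    have "wins (nat ((t + 1)\<^sup>2)) ?R' ?B'"
    proof (rule gap_wins[of g t _ _ _ s s2 x])
      show "gap_plan g t (nat ((t + 1)\<^sup>2))"
        by (rule gap_plan_power[of _ k]) (use gd t len s h t5 sN in auto)
      show "valid ?R' ?B'" by (rule placed_valid[OF valid pl])
      show "longer_than ?R' t" "longer_than ?B' t"
        using placed_longer[OF valid pl bigR] s2_def unfolding longer_than_def by fastforce+
      show "seg ?R' x s" using placed_segR[OF valid pl] segR by auto
      have eX: "x + s + g = ?X" using g_def r_def by simp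
      show "seg ?R' (x + s + g) s2"
        unfolding eX using placed_segR[OF valid pl] by blast
      show "free ?R' ?B' z" if z: "x + s \<le> z" "z < x + s + g" for z
      proof -
        have "z \<notin> arc y' s2" by (rule not_arc') (use z eX y'p y'n yrN xb r_def sN in auto)
        moreover have "z \<notin> arc ?X s2" by (rule not_arc') (use z eX yrN xb r_def sN in auto)
        ultimately show ?thesis unfolding placed_free using fr[of z] z xb sN r_def g_def by auto
      qed
    qed (use na1 na2 s12 in auto)
    then show "wins (nat ((t + 1)\<^sup>2) + 2 + nat t) ?R' ?B'" by (rule wins_mono) simp
  next
    fix y' assume "r \<le> y'" "y' + s2 \<le> p0" and pl: "placed ?R ?B p0 y' s2"
    then show "wins (nat ((t + 1)\<^sup>2) + 2 + nat t) (?R \<union> arc p0 s2) (?B \<union> arc y' s2)"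
      using final[OF pl] by blast
  next
    fix y' assume y': "\<And>z. y' \<le> z \<Longrightarrow> z < y' + s2 \<Longrightarrow> z \<notin> arc r
      (y - r)"
      and pl: "placed ?R ?B p0 y' s2"
    let ?R' = "?R \<union> arc p0 s2" and ?B' = "?B \<union> arc y' s2"
    have g': "valid ?R' ?B'" by (rule placed_valid[OF valid pl])
    have fy: "free ?R ?B z" if "y' \<le> z" "z < y' + s2" for z using pl that unfolding placed_def by blast
    consider "adj ?R' ?B' h s s2" | "adj ?R' ?B' h s2 s" | "\<not> adj ?R' ?B' h s s2" "\<not> adj ?R' ?B'
      h s2 s" by blast
    then show "wins (nat ((t + 1)\<^sup>2) + 2 + nat t) ?R' ?B'"
    proof cases
      case 1
      from adj_left[OF valid pl s12(1) nseg 1]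
      have a: "seg ?B (y' - h - s) s" "\<And>z. y' - h \<le> z \<Longrightarrow> z < y' \<Longrightarrow>
        free ?R ?B z"
        unfolding placed_free by auto
      have "(y' - h - s) mod N = y mod N" using a(1) unfolding segB by blast
      then obtain i where "y' - h - s = y + i * N" by (rule modE)
      then have i: "y' = (y + s + h) + i * N" by simp
      define y'' where "y'' = y + s + h"
      have fz: "free ?R ?B z" if "y + s \<le> z" "z < y'' + s2" for z
      proof -
        have "free ?R ?B (z + i * N)" using a(2)[of "z + i * N"] fy[of "z + i * N"] that i unfolding y''_def
          by (cases "z < y + s + h") auto
        then show ?thesis using free_shift[OF valid] by blast
      qed
      have "y + s \<le> x + N" using len od by simp
      then have "y'' + s2 \<le> x + N" using fz[of "x + N"] nfr by linarith
      moreover have "placed ?R ?B p0 y'' s2"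
        using placed_shift[of ?R ?B p0 y'' i s2] pl valid i unfolding y''_def by simp
      moreover have "arc y' s2 = arc y'' s2" by (rule arc_cong) (simp add: i y''_def)
      ultimately show ?thesis using final[of y''] y''_def by auto
    next
      case 2
      from adj_right[OF valid pl s12(1) nseg 2]
      have a: "seg ?B (y' + s2 + h) s" by auto
      have "(y' + s2 + h) mod N = y mod N" using a unfolding segB by blast
      then obtain i where "y' + s2 + h = y + i * N" by (rule modE)
      \<comment> \<open>The mirror image inside the odd gap would end in the middle cell
        \<open>p0\<close>, which is already red.\<close>
      then have i: "y' + s2 = p0 + 1 + i * N" using xb by simp
      have "p0 + i * N \<notin> arc r (y - r)" using y'[of "p0 + i * N"] i sN by auto
      then have "p0 \<notin> arc r (y - r)" using periodic_shift[OF periodic_arc, of p0 i] by blast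
      moreover have "p0 \<in> arc r (y - r)" using xb sN by (intro arcI) auto
      ultimately show ?thesis by blast
    next
      case 3
      have "wins (nat ((t + 1)\<^sup>2)) ?R' ?B'"
      proof (rule gap_wins[of h t _ _ _ s s2 x])
        show "gap_plan h t (nat ((t + 1)\<^sup>2))"
          by (rule gap_plan_power[of _ k]) (use t len s h t5 sN in auto)
        show "valid ?R' ?B'" by (rule g')
        show "longer_than ?R' t" "longer_than ?B' t"
          using placed_longer[OF valid pl bigR] s2_def unfolding longer_than_def by fastforce+
        show "seg ?R' x s" using placed_segR[OF valid pl] segR by auto
        have eX: "x + s + h = p0" using p0_def r_def by simp
        show "seg ?R' (x + s + h) s2"
          unfolding eX using placed_segR[OF valid pl] by blast
        show "free ?R' ?B' z" if z: "x + s \<le> z" "z < x + s + h" for z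
        proof -
          have "z \<in> arc r (y - r)" using z eX xb r_def sN h t5 by (intro arcI) auto
          then have "z \<notin> arc y' s2" using arc_disjoint[OF periodic_arc, of y' s2 r "y - r" z] y'
            by blast
          moreover have "z \<notin> arc p0 s2" by (rule not_arc') (use z len od s t5 h in auto)
          ultimately show ?thesis unfolding placed_free using fr[of z] z eX xb sN r_def h t5 by auto
        qed
      qed (use 3 s12 in auto)
      then show ?thesis by (rule wins_mono) simp
    qed
  qed
  moreover have "nat ((t + 1)\<^sup>2) + 2 + nat t + nat s2 \<le> nat ((t + 1)\<^sup>2) + nat (2 * t) + 5"
    using s2_def t5 by simp
  ultimately show ?thesis using wins_mono unfolding y_def by blast
qed

text \<open>
  The first player extends the red block into the odd gap. Either this gap shrinks by 2, or it and the
  other gap shrink by 1 and exchange their parities; a gap of length 1 forces the latter.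
\<close>

lemma cycle_step:
  assumes W: "W = {}" and j: "1 \<le> j" and G: "1 \<le> G" "odd G" and len: "2 * j + G \<le> N" and oddN:
    "odd N"
    and c1: "3 \<le> G \<Longrightarrow> wins m (arc x (j + 1)) (arc (x + j + G - 1) (j + 1))"
    and c2: "2 * j + G < N \<Longrightarrow> \<exists>x'. wins m (arc x' (j + 1)) (arc (x' + (j + 1) + (N -
      2 * j - G - 1)) (j + 1))"
  shows "wins (Suc m) (arc x j) (arc (x + j + G) j)"
proof (rule wins.intros[of _ _ "x + j"])
  define y where "y = x + j + G"
  let ?R = "arc x j" and ?B = "arc (x + j + G) j"
  have inR: "z \<in> ?R \<longleftrightarrow> z < x + j" if "x \<le> z" "z < x + N" for z
    using arc_window[of x x j z] that len j G by auto
  have inB: "z \<in> ?B \<longleftrightarrow> y \<le> z \<and> z < y + j" if "x \<le> z" "z < x + N" for z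
    using arc_window[of x y j z] that len j G y_def by auto
  have jN: "j < N" "j + G < N" using len j G by auto
  show "free ?R ?B (x + j)" using inR[of "x + j"] inB[of "x + j"] W jN G j y_def unfolding free_def by auto
  have t: "runs ?R (x + j) j 0"
  proof -
    have "x - 1 \<notin> ?R" by (rule not_arc') (use jN in auto)
    moreover have "x + j \<notin> ?R" by (rule not_arc) (use jN j in auto)
    moreover have "x + j + 1 \<notin> ?R" by (rule not_arc) (use len j G in auto)
    ultimately show ?thesis using j unfolding runs_def by (auto intro: arcI)
  qed
  fix y1 assume y1: "free ?R ?B y1" "y1 \<notin> cell (x + j)" "same_type ?R (x + j) ?B y1"
  have y1B: "y1 \<notin> ?B" using y1(1) unfolding free_def by simp
  have "seg ?B (y1 - j) j \<or> seg ?B (y1 + 1) j"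
    using same_typeD[OF y1(3) t] runs_seg_left[of ?B y1 j 0] runs_seg_right[of ?B y1 0 j] y1B j by blast
  then have "(y1 - j) mod N = y mod N \<or> (y1 + 1) mod N = y mod N"
    using seg_arc[OF j jN(1)] y_def by auto
  then show "wins m (?R \<union> cell (x + j)) (?B \<union> cell y1)"
  proof
    assume "(y1 + 1) mod N = y mod N"
    then obtain i where "y1 + 1 = y + i * N" by (rule modE)
    then have i: "y1 = (y - 1) + i * N" by simp
    then have cl: "cell y1 = cell (y - 1)" by (intro cell_eq) simp
    have "G \<noteq> 1"
    proof
      assume "G = 1"
      then have "cell y1 = cell (x + j)" using cl y_def by simp
      then show False using y1(2) unfolding cell_def by blast
    qed
    then have "G \<noteq> 1" "G \<noteq> 2" using G by auto
    then have "3 \<le> G" using G by simp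
    moreover have "?B \<union> cell y1 = arc (x + j + G - 1) (j + 1)"
      using arc_left[of j "x + j + G"] j cl y_def by simp
    ultimately show ?thesis using c1 arc_right[of j x] j by simp
  next
    assume "(y1 - j) mod N = y mod N"
    then obtain i where "y1 - j = y + i * N" by (rule modE)
    then have i: "y1 = (y + j) + i * N" by simp
    then have cl: "cell y1 = cell (y + j)" by (intro cell_eq) simp
    have Be: "?B \<union> cell y1 = arc y (j + 1)" using arc_right[of j y] j cl y_def by simp
    have "2 * j + G \<noteq> N"
    proof
      assume "2 * j + G = N"
      then have "y1 = x + (i + 1) * N" using i y_def by (simp add: algebra_simps)
      then have "y1 \<in> ?R" using periodic_shift[OF periodic_arc, of x "i + 1" x j] inR[of x] j jN by simp
      then show False using y1(1) unfolding free_def by simp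
    qed
    then have "2 * j + G < N" using len by simp
    then obtain x' where w: "wins m (arc x' (j + 1)) (arc (x' + (j + 1) + (N - 2 * j - G - 1)) (j + 1))"
      using c2 by blast
    \<comment> \<open>Carries the red block at \<open>x'\<close> to the one at \<open>x\<close> and
      reverses the orientation, because the other gap lies to the left of the red block.\<close>
    define c where "c = x + x' + j"
    have W': "refl_set c W = W" unfolding W refl_set_def by simp
    have 1: "refl_set c (arc x' (j + 1)) = arc x (j + 1)" unfolding refl_arc c_def by simp
    have "refl_set c (arc (x' + (j + 1) + (N - 2 * j - G - 1)) (j + 1)) = arc (y - N) (j + 1)"
      unfolding refl_arc c_def y_def by (rule arg_cong[where f = "\<lambda>z. arc z (j + 1)"]) simp
    also have "\<dots> = arc y (j + 1)" by (rule arc_cong) simp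
    finally show ?thesis using wins_refl[OF W' w] 1 Be arc_right[of j x] j by simp
  qed
qed

text \<open>Extensions shorten the odd gap by 2 until the second player has to extend on the far
  side, which makes the long gap odd. The hypothesis \<open>2 * j + G + 4 * t + 30 \<le> N\<close>
  leaves this gap at least the length \<open>4 * t + 21\<close> that \<open>cycle_stage\<close>
  needs, namely \<open>2 * h + 1\<close> for \<open>h = 2 * t + 10\<close>.\<close>

lemma cycle_stage2:
  assumes W: "W = {}" and oddN: "odd N" and t: "int k + 5 \<le> t" "N \<le> 2 ^ k"
  shows "t + 4 \<le> j \<Longrightarrow> odd G \<Longrightarrow> 1 \<le> G \<Longrightarrow> 2 * j + G
    \<le> N \<Longrightarrow> G < 4 * t + 21 \<Longrightarrow> 2 * j + G + 4 * t + 30 \<le> N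
      \<Longrightarrow>
    G \<le> int d \<Longrightarrow> wins (nat ((t + 1)\<^sup>2) + nat (2 * t) + 5 + d) (arc x j) (arc (x +
      j + G) j)"
proof (induction d arbitrary: x j G)
  case 0
  then show ?case by simp
next
  case (Suc d)
  have longer_than: "wins (nat ((t + 1)\<^sup>2) + nat (2 * t) + 5 + d) (arc x' s) (arc (x' + s + G') s)"
    if "t + 4 \<le> s" "odd G'" "4 * t + 21 \<le> G'" "2 * s + G' \<le> N" for x' s G'
  proof -
    obtain h where h: "G' = 2 * h + 1" using \<open>odd G'\<close> by (rule oddE)
    have "wins (nat ((t + 1)\<^sup>2) + nat (2 * t) + 5) (arc x' s) (arc (x' + s + 2 * h + 1) s)"
      by (rule cycle_stage[OF W oddN t]) (use that h in auto)
    then have "wins (nat ((t + 1)\<^sup>2) + nat (2 * t) + 5) (arc x' s) (arc (x' + s + G') s)"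
      unfolding h by (simp add: algebra_simps)
    then show ?thesis by (rule wins_mono) simp
  qed
  have "wins (Suc (nat ((t + 1)\<^sup>2) + nat (2 * t) + 5 + d)) (arc x j) (arc (x + j + G) j)"
  proof (rule cycle_step[OF W _ Suc.prems(3,2,4) oddN])
    show "1 \<le> j" using Suc.prems t by simp
    assume G3: "3 \<le> G"
    have "wins (nat ((t + 1)\<^sup>2) + nat (2 * t) + 5 + d) (arc x (j + 1)) (arc (x + (j + 1) + (G - 2))
      (j + 1))"
      by (rule Suc.IH) (use Suc.prems G3 in auto)
    then show "wins (nat ((t + 1)\<^sup>2) + nat (2 * t) + 5 + d) (arc x (j + 1)) (arc (x + j + G - 1) (j +
      1))"
      by (simp add: algebra_simps)
  next
    have "odd (N - 2 * j - G - 1)" using oddN Suc.prems by simp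
    then have "wins (nat ((t + 1)\<^sup>2) + nat (2 * t) + 5 + d) (arc 0 (j + 1))
        (arc (0 + (j + 1) + (N - 2 * j - G - 1)) (j + 1))"
      by (intro longer_than) (use Suc.prems in auto)
    then show "\<exists>x'. wins (nat ((t + 1)\<^sup>2) + nat (2 * t) + 5 + d) (arc x' (j + 1))
        (arc (x' + (j + 1) + (N - 2 * j - G - 1)) (j + 1))" by blast
  qed
  then show ?case by simp
qed

text \<open>Since \<open>N\<close> is odd and the two blocks have equal length, exactly one of the
  two gaps is odd after every round. So both blocks can be grown to length \<open>t + 4\<close>
  before parity is used, and \<open>20 * t + 100 \<le> N\<close> then makes at least one gap
  long.\<close>

lemma cycle_stage1:
  assumes W: "W = {}" and oddN: "odd N" and t: "int k + 5 \<le> t" "N \<le> 2 ^ k" and N: "20 * t + 100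
    \<le> N"
  shows "1 \<le> j \<Longrightarrow> odd G \<Longrightarrow> 1 \<le> G \<Longrightarrow> 2 * j + G \<le> N
    \<Longrightarrow> t + 4 - j = int d \<Longrightarrow>
    wins (nat ((t + 1)\<^sup>2) + nat (6 * t) + 30 + d) (arc x j) (arc (x + j + G) j)"
proof (induction d arbitrary: x j G)
  case 0
  show ?case
  proof (cases "4 * t + 21 \<le> G")
    case True
    obtain h where h: "G = 2 * h + 1" using 0(2) by (rule oddE)
    have "wins (nat ((t + 1)\<^sup>2) + nat (2 * t) + 5) (arc x j) (arc (x + j + 2 * h + 1) j)"
      by (rule cycle_stage[OF W oddN t]) (use 0 h True in auto)
    then have "wins (nat ((t + 1)\<^sup>2) + nat (2 * t) + 5) (arc x j) (arc (x + j + G) j)"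
      unfolding h by (simp add: algebra_simps)
    then show ?thesis by (rule wins_mono) (use t in auto)
  next
    case False
    have "wins (nat ((t + 1)\<^sup>2) + nat (2 * t) + 5 + nat (4 * t + 21)) (arc x j) (arc (x + j + G) j)"
      by (rule cycle_stage2[OF W oddN t]) (use 0 False N t in auto)
    then show ?thesis by (rule wins_mono) (use t in auto)
  qed
next
  case (Suc d)
  have "wins (Suc (nat ((t + 1)\<^sup>2) + nat (6 * t) + 30 + d)) (arc x j) (arc (x + j + G) j)"
  proof (rule cycle_step[OF W Suc.prems(1,3,2,4) oddN])
    assume G3: "3 \<le> G"
    have "wins (nat ((t + 1)\<^sup>2) + nat (6 * t) + 30 + d) (arc x (j + 1)) (arc (x + (j + 1) + (G - 2))
      (j + 1))"
      by (rule Suc.IH) (use Suc.prems G3 in auto)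
    then show "wins (nat ((t + 1)\<^sup>2) + nat (6 * t) + 30 + d) (arc x (j + 1)) (arc (x + j + G - 1) (j
      + 1))"
      by (simp add: algebra_simps)
  next
    assume l: "2 * j + G < N"
    have o: "odd (N - 2 * j - G - 1)" using oddN Suc.prems by simp
    then have "N - 2 * j - G - 1 \<noteq> 0" using dvd_0_right by metis
    then have "wins (nat ((t + 1)\<^sup>2) + nat (6 * t) + 30 + d) (arc 0 (j + 1))
        (arc (0 + (j + 1) + (N - 2 * j - G - 1)) (j + 1))"
      by (intro Suc.IH) (use Suc.prems o l in auto)
    then show "\<exists>x'. wins (nat ((t + 1)\<^sup>2) + nat (6 * t) + 30 + d) (arc x' (j + 1))
        (arc (x' + (j + 1) + (N - 2 * j - G - 1)) (j + 1))" by blast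
  qed
  then show ?case by simp
qed

text \<open>The two gaps between the first cells have total length \<open>N - 2\<close>, so one of
  them is odd; a reflection puts it to the right of the red cell.\<close>

lemma cycle_wins:
  assumes W: "W = {}" and oddN: "odd N" and t: "int k + 5 \<le> t" "N \<le> 2 ^ k" and N: "20 * t + 100
    \<le> N"
  shows "wins (nat ((t + 1)\<^sup>2) + nat (7 * t) + 40) {} {}"
proof -
  have fin: "wins (nat ((t + 1)\<^sup>2) + nat (6 * t) + 30 + nat (t + 3)) (arc 0 1) (arc y 1)"
    if "odd (y - 1)" "1 \<le> y - 1" "y < N" for y
    using cycle_stage1[OF W oddN t N, of 1 "y - 1" "nat (t + 3)" 0] that t by simp
  have "wins (Suc (nat ((t + 1)\<^sup>2) + nat (6 * t) + 30 + nat (t + 3))) {} {}"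
  proof (rule place[of _ _ 0])
    fix y0 assume y0: "y0 \<notin> cell 0"
    define y where "y = y0 mod N"
    have yc: "arc y0 1 = arc y 1" by (rule arc_cong) (simp add: y_def)
    have "y \<noteq> 0" using y0 unfolding y_def cell_def by simp
    moreover have "0 \<le> y" "y < N" using N3 unfolding y_def by auto
    ultimately have y: "1 \<le> y" "y < N" by auto
    have "wins (nat ((t + 1)\<^sup>2) + nat (6 * t) + 30 + nat (t + 3)) (arc 0 1) (arc y 1)"
    proof (cases "odd (y - 1)")
      case True
      then have "y - 1 \<noteq> 0" by auto
      then show ?thesis using fin[OF True] y by simp
    next
      case False
      have "odd (N - y - 1)" using False oddN by simp
      moreover then have "N - y - 1 \<noteq> 0" using dvd_0_right by metis
      ultimately have "wins (nat ((t + 1)\<^sup>2) + nat (6 * t) + 30 + nat (t + 3)) (arc 0 1) (arc (N - y)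
        1)"
        by (intro fin) (use y in auto)
      moreover have "refl_set 0 W = W" unfolding W refl_set_def by simp
      ultimately have "wins (nat ((t + 1)\<^sup>2) + nat (6 * t) + 30 + nat (t + 3)) (refl_set 0 (arc 0 1))
        (refl_set 0 (arc (N - y) 1))"
        using wins_refl by blast
      moreover have "arc (y - N) 1 = arc y 1" by (rule arc_cong) simp
      ultimately show ?thesis unfolding refl_arc by simp
    qed
    then show "wins (nat ((t + 1)\<^sup>2) + nat (6 * t) + 30 + nat (t + 3)) ({} \<union> arc 0 1) ({}
      \<union> arc y0 1)"
      unfolding yc by simp
  next
    show "free {} {} 0" unfolding free_def using W by simp
  qed auto
  then show ?thesis by (rule wins_mono) (use t in auto)
qed

end

section \<open>Isomorphisms and types\<close>

text \<open>Paths with \<open>j\<close> edges, with a direction. Their number is invariant under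
  isomorphism and changes in a computable way when an edge is added, so that components need not be
  matched explicitly.\<close>

definition walks :: "'a set set \<Rightarrow> nat \<Rightarrow> 'a list set" where
  "walks F j = {vs. length vs = Suc j \<and> distinct vs \<and> (\<forall>i<j. {vs ! i, vs ! Suc i} \<in> F)}"

lemma walks_set:
  assumes "vs \<in> walks F j" "1 \<le> j" shows "set vs \<subseteq> \<Union>F"
proof
  fix v assume "v \<in> set vs"
  then obtain i where i: "i < Suc j" "v = vs ! i" using assms unfolding walks_def in_set_conv_nth by auto
  show "v \<in> \<Union>F"
  proof (cases i)
    case 0
    then have "{vs ! 0, vs ! Suc 0} \<in> F" using assms unfolding walks_def by auto
    then show ?thesis using i 0 by blast
  next
    case (Suc i')
    then have "{vs ! i', vs ! Suc i'} \<in> F" using assms i unfolding walks_def by auto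
    then show ?thesis using i Suc by blast
  qed
qed

lemma finite_walks: "finite (\<Union>F) \<Longrightarrow> 1 \<le> j \<Longrightarrow> finite (walks F j)"
proof -
  assume f: "finite (\<Union>F)" and j: "1 \<le> j"
  have "walks F j \<subseteq> {vs. set vs \<subseteq> \<Union>F \<and> length vs = Suc j}"
  proof
    fix vs assume "vs \<in> walks F j"
    then show "vs \<in> {vs. set vs \<subseteq> \<Union>F \<and> length vs = Suc j}"
      using walks_set[of vs F j] j unfolding walks_def by simp
  qed
  then show ?thesis by (rule finite_subset[OF _ finite_lists_length_eq[OF f]])
qed

lemma card_walks_le:
  assumes iso: "graph_iso (edge_subgraph F) (edge_subgraph F')" and j: "1 \<le> j" and fin: "finite
    (\<Union>F')"
  shows "card (walks F j) \<le> card (walks F' j)"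
proof -
  obtain f where f: "bij_betw f (\<Union>F) (\<Union>F')"
    "\<And>u v. u \<in> \<Union>F \<Longrightarrow> v \<in> \<Union>F \<Longrightarrow> {u, v} \<in> F
      \<longleftrightarrow> {f u, f v} \<in> F'"
    using iso unfolding graph_iso_def edge_subgraph_def graph.select_convs by blast
  have inj: "inj_on f (\<Union>F)" using f(1) by (rule bij_betw_imp_inj_on)
  show ?thesis
  proof (rule card_inj_on_le[of "map f"])
    show "inj_on (map f) (walks F j)"
    proof (rule inj_onI)
      fix vs ws assume "vs \<in> walks F j" "ws \<in> walks F j" "map f vs = map f ws"
      then show "vs = ws" using map_inj_on[of f vs ws] walks_set[OF _ j] inj
        by (meson inj_on_subset le_sup_iff)
    qed
    show "map f ` walks F j \<subseteq> walks F' j"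
    proof
      fix ws assume "ws \<in> map f ` walks F j"
      then obtain vs where vs: "vs \<in> walks F j" "ws = map f vs" by blast
      have s: "set vs \<subseteq> \<Union>F" by (rule walks_set[OF vs(1) j])
      have "{ws ! i, ws ! Suc i} \<in> F'" if "i < j" for i
      proof -
        have l: "i < length vs" "Suc i < length vs" using vs that unfolding walks_def by auto
        then have "vs ! i \<in> \<Union>F" "vs ! Suc i \<in> \<Union>F" using s nth_mem by blast+
        moreover have "{vs ! i, vs ! Suc i} \<in> F" using vs that unfolding walks_def by auto
        ultimately show ?thesis using f(2) l vs(2) by simp
      qed
      moreover have "distinct ws" using vs s inj inj_on_subset unfolding walks_def
        by (auto simp: distinct_map)
      ultimately show "ws \<in> walks F' j" using vs unfolding walks_def by auto
    qed
  qed (rule finite_walks[OF fin j])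
qed

context board begin

section \<open>Edges of the board and windows of colored cells\<close>

definition vertex :: "int \<Rightarrow> nat" where "vertex z = nat (z mod N)"

definition edge :: "int \<Rightarrow> nat set" where "edge z = {vertex z, vertex (z + 1)}"

definition cells :: "nat set set \<Rightarrow> int set" where "cells F = {z. edge z \<in> F}"

lemma vertex_eq: "vertex i = vertex j \<longleftrightarrow> i mod N = j mod N"
  unfolding vertex_def using N3 by (simp add: eq_nat_nat_iff)

lemma int_vertex: "int (vertex z) = z mod N"
  unfolding vertex_def using N3 by simp

lemma vertex_add: "vertex (int (vertex z) + w) = vertex (z + w)"
  unfolding vertex_eq int_vertex by (simp add: mod_simps)

lemma not_mod_2: "(z + 1) mod N \<noteq> (z - 1) mod N"
proof
  assume "(z + 1) mod N = (z - 1) mod N"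
  then have "z + 1 = z - 1" by (rule mod_eq_near) (use N3 in simp)
  then show False by simp
qed

text \<open>By \<open>3 \<le> N\<close> no two different edges have the same pair of ends.\<close>

lemma edge_eq: "edge i = edge j \<longleftrightarrow> i mod N = j mod N"
proof
  assume "edge i = edge j"
  then have "i mod N = j mod N \<or> i mod N = (j + 1) mod N \<and> (i + 1) mod N = j mod N"
    unfolding edge_def doubleton_eq_iff vertex_eq by blast
  moreover have False if "i mod N = (j + 1) mod N" "(i + 1) mod N = j mod N"
  proof -
    have "(i + 1) mod N = (i - 1) mod N" using that by (metis add_diff_cancel_right' mod_diff_left_eq)
    then show False using not_mod_2 by blast
  qed
  ultimately show "i mod N = j mod N" by blast
next
  assume h: "i mod N = j mod N"
  then have "(i + 1) mod N = (j + 1) mod N" by (metis mod_add_left_eq)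
  then have "vertex i = vertex j" "vertex (i + 1) = vertex (j + 1)" using h unfolding vertex_eq by auto
  then show "edge i = edge j" unfolding edge_def by simp
qed

lemma edge_cell: "edge y = edge x \<longleftrightarrow> y \<in> cell x"
  unfolding edge_eq cell_def by simp

lemma periodic_cells: "periodic (cells F)"
  unfolding periodic_def cells_def using edge_eq by (metis mem_Collect_eq)

lemma cells_insert: "cells (insert (edge x) F) = cells F \<union> cell x"
  unfolding cells_def cell_def using edge_eq by blast

definition windows :: "int set \<Rightarrow> nat \<Rightarrow> int set" where
  "windows S j = {a. 0 \<le> a \<and> a < N \<and> (\<forall>i<j. a + int i \<in> S)}"

text \<open>
  The factor 2 counts the two directions in which a window is traversed.
\<close>

lemma card_walks:
  assumes F: "F \<subseteq> range edge" and j: "1 \<le> j" "int j < N"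
  shows "card (walks F j) = 2 * card (windows (cells F) j)"
proof -
  define r where "r a d = map (\<lambda>i. vertex (a + d * int i)) [0..<Suc j]" for a d :: int
  define h where "h = (\<lambda>(a, u). if u then r a 1 else r (a + int j) (-1))"
  have rl: "length (r a d) = Suc j" for a d unfolding r_def by simp
  have rn: "r a d ! i = vertex (a + d * int i)" if "i \<le> j" for a d i
  proof -
    have "[0..<Suc j] ! i = i" using that by (subst nth_upt) auto
    then show ?thesis using that unfolding r_def by (subst nth_map) auto
  qed
  have rc: "r a d = r a' d \<longleftrightarrow> a mod N = a' mod N" for a a' d
  proof
    assume "r a d = r a' d"
    then have "r a d ! 0 = r a' d ! 0" by simp
    then show "a mod N = a' mod N" using rn[of 0] by (simp add: vertex_eq)
  next
    assume "a mod N = a' mod N"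
    then have "(a + w) mod N = (a' + w) mod N" for w by (metis mod_add_left_eq)
    then show "r a d = r a' d" unfolding r_def by (simp add: vertex_eq)
  qed
  have rdist: "distinct (r a d)" if "d = 1 \<or> d = -1" for a d
  proof -
    have "i = i'" if i: "i \<le> j" "i' \<le> j" "r a d ! i = r a d ! i'" for i i'
    proof -
      have "(a + d * int i) mod N = (a + d * int i') mod N" using i rn by (simp add: vertex_eq)
      moreover have "\<bar>(a + d * int i) - (a + d * int i')\<bar> < N"
        using \<open>d = 1 \<or> d = -1\<close> i(1,2) j by auto
      ultimately have "a + d * int i = a + d * int i'" by (rule mod_eq_near)
      then show ?thesis using \<open>d = 1 \<or> d = -1\<close> by auto
    qed
    then show ?thesis unfolding distinct_conv_nth rl by (metis less_Suc_eq_le)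
  qed
  have "bij_betw h (windows (cells F) j \<times> UNIV) (walks F j)"
    unfolding bij_betw_def
  proof
    show "inj_on h (windows (cells F) j \<times> UNIV)"
    proof (rule inj_onI)
      fix p q assume pq: "p \<in> windows (cells F) j \<times> (UNIV :: bool set)" "q \<in> windows (cells
        F) j \<times> UNIV" "h p = h q"
      obtain a u a' u' where e: "p = (a, u)" "q = (a', u')" by (cases p, cases q)
      have b: "0 \<le> a" "a < N" "0 \<le> a'" "a' < N" using pq e unfolding windows_def by auto
      have cross: "r c 1 \<noteq> r c' (-1)" for c c'
      proof
        assume eq: "r c 1 = r c' (-1)"
        have "c mod N = c' mod N" "(c + 1) mod N = (c' - 1) mod N"
          using arg_cong[OF eq, of "\<lambda>l. l ! 0"] arg_cong[OF eq, of "\<lambda>l. l ! 1"] rn[of 0]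
            rn[of 1] j
          by (auto simp: vertex_eq)
        then have "(c + 1) mod N = (c - 1) mod N" by (metis mod_diff_left_eq)
        then show False using not_mod_2 by blast
      qed
      have "u = u'" using pq(3) cross cross[symmetric] unfolding e h_def by (cases u; cases u') auto
      moreover have "a mod N = a' mod N"
      proof (cases u)
        case True
        then show ?thesis using pq(3) \<open>u = u'\<close> rc unfolding e h_def by auto
      next
        case False
        then have "(a + int j) mod N = (a' + int j) mod N" using pq(3) \<open>u = u'\<close> rc
          unfolding e h_def by auto
        then have "(a + int j - int j) mod N = (a' + int j - int j) mod N" by (metis mod_diff_left_eq)
        then show ?thesis by simp
      qed
      ultimately show "p = q" using b e by simp
    qed
    show "h ` (windows (cells F) j \<times> UNIV) = walks F j"
    proof
      show "h ` (windows (cells F) j \<times> UNIV) \<subseteq> walks F j"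
      proof
        fix vs assume "vs \<in> h ` (windows (cells F) j \<times> UNIV)"
        then obtain a u where a: "a \<in> windows (cells F) j" "vs = h (a, u)" by auto
        have c: "edge (a + int i) \<in> F" if "i < j" for i using a that unfolding windows_def cells_def
          by auto
        show "vs \<in> walks F j"
        proof (cases u)
          case True
          then have vs: "vs = r a 1" using a unfolding h_def by simp
          have "{vs ! i, vs ! Suc i} \<in> F" if "i < j" for i
            using c[OF that] rn[of i a 1] rn[of "Suc i" a 1] that unfolding vs edge_def
              by (simp add: algebra_simps)
          then show ?thesis unfolding walks_def using vs rl rdist by simp
        next
          case False
          then have vs: "vs = r (a + int j) (-1)" using a unfolding h_def by simp
          have "{vs ! i, vs ! Suc i} \<in> F" if "i < j" for i
          proof -
            have "vs ! i = vertex (a + int (j - Suc i) + 1)" "vs ! Suc i = vertex (a + int (j - Suc i))"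
              using rn[of i "a + int j" "-1"] rn[of "Suc i" "a + int j" "-1"] that unfolding vs
              by (auto simp: of_nat_diff algebra_simps)
            then have "{vs ! i, vs ! Suc i} = edge (a + int (j - Suc i))" unfolding edge_def by auto
            then show ?thesis using c[of "j - Suc i"] that by simp
          qed
          then show ?thesis unfolding walks_def using vs rl rdist by simp
        qed
      qed
      show "walks F j \<subseteq> h ` (windows (cells F) j \<times> UNIV)"
      proof
        fix vs assume vs: "vs \<in> walks F j"
        then have len: "length vs = Suc j" and dist: "distinct vs"
          and ed: "\<And>i. i < j \<Longrightarrow> {vs ! i, vs ! Suc i} \<in> F" unfolding walks_def by auto
        define v0 where "v0 = int (vs ! 0)"
        have nxt: "vs ! Suc i = vertex (z + 1) \<or> vs ! Suc i = vertex (z - 1)"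
          if i: "i < j" "vs ! i = vertex z" for i z
        proof -
          obtain w where "{vs ! i, vs ! Suc i} = edge w" using ed[OF i(1)] F by auto
          then have "vs ! i = vertex w \<and> vs ! Suc i = vertex (w + 1) \<or> vs ! i = vertex (w + 1)
            \<and> vs ! Suc i = vertex w"
            unfolding edge_def doubleton_eq_iff by blast
          then show ?thesis
          proof
            assume h: "vs ! i = vertex w \<and> vs ! Suc i = vertex (w + 1)"
            then have "vertex (w + 1) = vertex (z + 1)" using i(2) vertex_add[of w 1] vertex_add[of z 1]
              by simp
            then show ?thesis using h by simp
          next
            assume h: "vs ! i = vertex (w + 1) \<and> vs ! Suc i = vertex w"
            then have "vertex w = vertex (z - 1)"
              using i(2) vertex_add[of "w + 1" "-1"] vertex_add[of z "-1"] by simp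
            then show ?thesis using h by simp
          qed
        qed
        have "\<exists>w. vs ! 0 = vertex w"
        proof -
          obtain w where "{vs ! 0, vs ! Suc 0} = edge w" using ed[of 0] F j by auto
          then show ?thesis unfolding edge_def doubleton_eq_iff by blast
        qed
        then have V0: "vs ! 0 = vertex v0" unfolding v0_def using vertex_add[of _ 0]
          by (metis add.right_neutral)
        have v0r: "0 \<le> v0" "v0 < N"
        proof -
          show "0 \<le> v0" unfolding v0_def by simp
          have "v0 = v0 mod N" using V0 int_vertex unfolding v0_def by metis
          then show "v0 < N" using N3 pos_mod_bound[of N v0] by simp
        qed
        \<comment> \<open>The second vertex fixes the direction. From then on distinctness forbids
          turning back, so the whole walk is determined.\<close>
        define d :: int where "d = (if vs ! 1 = vertex (v0 + 1) then 1 else -1)"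
        have d: "d = 1 \<or> d = -1" unfolding d_def by auto
        have all: "i \<le> j \<longrightarrow> vs ! i = vertex (v0 + d * int i)" for i
        proof (induction i rule: less_induct)
          case (less k)
          show ?case
          proof (cases k)
            case 0
            then show ?thesis using V0 by simp
          next
            case (Suc i)
            have "vs ! Suc i = vertex (v0 + d * int (Suc i))" if i: "Suc i \<le> j"
            proof -
            have h: "vs ! i = vertex (v0 + d * int i)" using less[of i] Suc i by simp
            have n: "vs ! Suc i = vertex (v0 + d * int i + 1) \<or> vs ! Suc i = vertex (v0 + d * int i - 1)"
              by (rule nxt) (use i h in auto)
            have "vs ! Suc i \<noteq> vertex (v0 + d * int i - d)"
            proof (cases i)
              case 0
              have "vertex (v0 + 1) \<noteq> vertex (v0 - 1)" unfolding vertex_eq by (rule not_mod_2)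
              then show ?thesis using 0 n unfolding d_def by (auto split: if_splits)
            next
              case i': (Suc i')
              have "vs ! Suc i \<noteq> vs ! i'" using dist len i i' by (simp add: nth_eq_iff_index_eq)
              moreover have "vs ! i' = vertex (v0 + d * int i')" using less[of i'] Suc i' i by simp
              ultimately show ?thesis using i' by (simp add: algebra_simps)
            qed
            then show ?thesis using n d by (auto simp: algebra_simps)
            qed
            then show ?thesis using Suc by simp
          qed
        qed
        show "vs \<in> h ` (windows (cells F) j \<times> UNIV)"
        proof -
          have vr: "vs = r v0 d"
            by (rule nth_equalityI) (use all rn len rl in auto)
          show ?thesis
          proof (cases "d = 1")
            case True
            have "edge (v0 + int i) \<in> F" if "i < j" for i
              using ed[OF that] all[of i] all[of "Suc i"] that True unfolding edge_def
                by (simp add: algebra_simps)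
            then have "v0 \<in> windows (cells F) j" using v0r unfolding windows_def cells_def by simp
            then show ?thesis using vr True unfolding h_def by (intro image_eqI[of _ _ "(v0, True)"]) auto
          next
            case False
            then have dm: "d = -1" using d by simp
            \<comment> \<open>A walk in the negative direction comes from the window that starts at
              its last vertex; \<open>windows\<close> uses representatives between 0 and
              \<open>N - 1\<close>.\<close>
            define a where "a = (v0 - int j) mod N"
            have ar: "0 \<le> a" "a < N" unfolding a_def using N3 by auto
            have am: "(a + w) mod N = (v0 - int j + w) mod N" for w unfolding a_def by (simp add: mod_simps)
            have "edge (a + int i) \<in> F" if "i < j" for i
            proof -
              have "edge (a + int i) = edge (v0 - int j + int i)" unfolding edge_eq by (rule am)
              also have "\<dots> = {vs ! (j - i), vs ! (j - Suc i)}"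
                using all[of "j - i"] all[of "j - Suc i"] that dm unfolding edge_def
                by (auto simp: of_nat_diff algebra_simps)
              also have "\<dots> \<in> F"
                using ed[of "j - Suc i"] that by (simp add: Suc_diff_Suc insert_commute)
              finally show ?thesis .
            qed
            then have "a \<in> windows (cells F) j" using ar unfolding windows_def cells_def by simp
            moreover have "vs = h (a, False)"
              unfolding vr dm h_def using rc[of v0 "-1" "a + int j"] am[of "int j"] by simp
            ultimately show ?thesis by (intro image_eqI[of _ _ "(a, False)"]) auto
          qed
        qed
      qed
    qed
  qed
  then have "card (windows (cells F) j \<times> (UNIV :: bool set)) = card (walks F j)"
    by (rule bij_betw_same_card)
  then show ?thesis by (simp add: card_cartesian_product)
qed

lemma finite_windows: "finite (windows S j)"
  by (rule finite_subset[of _ "{0..<N}"]) (auto simp: windows_def)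

text \<open>
  The number of windows of length \<open>j\<close> through a new cell with \<open>l\<close> cells of its
  color to the left and \<open>r\<close> to the right.
\<close>

definition through :: "int \<Rightarrow> int \<Rightarrow> int \<Rightarrow> nat" where
  "through l r j = nat (min 0 (r + 1 - j) - max (- l) (1 - j) + 1)"

text \<open>The new windows are those that contain \<open>x\<close>, and they lie within the merged
  run. By \<open>l + r + 1 < N\<close> this run does not close up, so none of them is counted twice
  modulo \<open>N\<close>.\<close>

lemma card_windows_add:
  assumes S: "periodic S" and x: "x \<notin> S" and t: "runs S x l r" and lr: "l + r + 1 < N" and j: "1
    \<le> j"
  shows "card (windows (S \<union> cell x) j) = card (windows S j) + through l r (int j)"
proof -
  define I where "I = {max (x - l) (x + 1 - int j)..min x (x + r + 1 - int j)}"
  have t': "0 \<le> l" "0 \<le> r" "x - l - 1 \<notin> S" "x + r + 1 \<notin> S"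
    "\<And>z. x - l \<le> z \<Longrightarrow> z < x \<Longrightarrow> z \<in> S" "\<And>z. x < z
      \<Longrightarrow> z \<le> x + r \<Longrightarrow> z \<in> S"
    using t unfolding runs_def by auto
  have xc: "x - l - 1 \<notin> cell x" "x + r + 1 \<notin> cell x"
    using cell_near[of "x - l - 1" x] cell_near[of "x + r + 1" x] t' lr by auto
  have PT: "periodic (S \<union> cell x)" by (rule periodic_Un[OF S periodic_cell])
  have "windows (S \<union> cell x) j = windows S j \<union> (\<lambda>b. b mod N) ` I"
  proof
    show "windows (S \<union> cell x) j \<subseteq> windows S j \<union> (\<lambda>b. b mod N) ` I"
    proof
      fix a assume a: "a \<in> windows (S \<union> cell x) j"
      show "a \<in> windows S j \<union> (\<lambda>b. b mod N) ` I"
      proof (cases "a \<in> windows S j")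
        case False
        then obtain i where i: "i < j" "a + int i \<in> cell x" using a unfolding windows_def by auto
        then have "(a + int i) mod N = x mod N" unfolding cell_def mem_Collect_eq by simp
        then obtain k where k: "a + int i = x + k * N" by (rule modE)
        define b where "b = a - k * N"
        have bi: "b + int i = x" using k unfolding b_def by simp
        have win: "z \<in> S \<union> cell x" if "b \<le> z" "z < b + int j" for z
        proof -
          have "nat (z - b) < j" using that by linarith
          then have "a + int (nat (z - b)) \<in> S \<union> cell x" using a unfolding windows_def by blast
          then have "z + k * N \<in> S \<union> cell x" using that unfolding b_def by simp
          then show ?thesis using periodic_shift[OF PT] by blast
        qed
        have "x - l \<le> b" using win[of "x - l - 1"] t'(1,3) xc bi i by fastforce
        moreover have "b + int j \<le> x + r + 1" using win[of "x + r + 1"] t'(2,4) xc bi i by fastforce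
        ultimately have "b \<in> I" using bi i unfolding I_def by auto
        moreover have "a = b mod N"
        proof -
          have "b mod N = (a + (- k) * N) mod N" unfolding b_def by simp
          also have "\<dots> = a mod N" by (rule mod_mult_self1)
          also have "\<dots> = a" using a unfolding windows_def by simp
          finally show ?thesis by simp
        qed
        ultimately show ?thesis by blast
      qed simp
    qed
    show "windows S j \<union> (\<lambda>b. b mod N) ` I \<subseteq> windows (S \<union> cell x) j"
    proof -
      have "b mod N \<in> windows (S \<union> cell x) j" if b: "b \<in> I" for b
      proof -
        have "b mod N + int i \<in> S \<union> cell x" if "i < j" for i
        proof -
          have "b + int i \<in> S \<union> cell x"
          proof (cases "b + int i = x")
            case True
            then show ?thesis unfolding cell_def by simp
          next
            case False
            then show ?thesis using t'(5,6)[of "b + int i"] b that unfolding I_def by fastforce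
          qed
          moreover have "(b mod N + int i) mod N = (b + int i) mod N" by (simp add: mod_simps)
          ultimately show ?thesis using periodic_iff[OF PT] by blast
        qed
        then show ?thesis using N3 unfolding windows_def by auto
      qed
      moreover have "windows S j \<subseteq> windows (S \<union> cell x) j" unfolding windows_def by auto
      ultimately show ?thesis by blast
    qed
  qed
  moreover have "windows S j \<inter> (\<lambda>b. b mod N) ` I = {}"
  proof -
    have "b mod N \<notin> windows S j" if b: "b \<in> I" for b
    proof
      assume w: "b mod N \<in> windows S j"
      have "x - b < int j" "0 \<le> x - b" using b unfolding I_def by auto
      then have "nat (x - b) < j" by linarith
      then have "b mod N + int (nat (x - b)) \<in> S" using w unfolding windows_def by blast
      then have "b mod N + (x - b) \<in> S" using \<open>0 \<le> x - b\<close> by simp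
      moreover have "(b mod N + (x - b)) mod N = x mod N" by (simp add: mod_simps)
      ultimately show False using x periodic_iff[OF S] by blast
    qed
    then show ?thesis by blast
  qed
  moreover have "card ((\<lambda>b. b mod N) ` I) = card I"
  proof (rule card_image, rule inj_onI)
    fix b b' assume b: "b \<in> I" "b' \<in> I" "b mod N = b' mod N"
    show "b = b'" by (rule mod_eq_near[OF b(3)]) (use b t' lr in \<open>auto simp: I_def\<close>)
  qed
  moreover have "card I = through l r (int j)"
  proof -
    have e: "min x (x + r + 1 - int j) = x + min 0 (r + 1 - int j)"
      "max (x - l) (x + 1 - int j) = x + max (- l) (1 - int j)" by auto
    show ?thesis unfolding I_def through_def e by (simp add: algebra_simps)
  qed
  ultimately show ?thesis by (simp add: card_Un_disjoint finite_windows I_def)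
qed

text \<open>The largest \<open>j\<close> with a nonzero count is \<open>l + r + 1\<close>, which
  determines the sum. The count equals \<open>j\<close> up to \<open>min l r + 1\<close> and then
  stops growing, so \<open>j = min l r + 2\<close> separates types with equal sum and a larger
  minimum on the other side.\<close>

lemma through_inj:
  assumes eq: "\<And>j. 1 \<le> j \<Longrightarrow> j < N \<Longrightarrow> through l r j = through l' r' j"
    and b: "0 \<le> l" "0 \<le> r" "0 \<le> l'" "0 \<le> r'" "l + r + 1 < N" "l' + r' + 1 < N"
  shows "l = l' \<and> r = r' \<or> l = r' \<and> r = l'"
proof -
  have "l + r \<le> l' + r'" using eq[of "l + r + 1"] b unfolding through_def by auto
  moreover have "l' + r' \<le> l + r" using eq[of "l' + r' + 1"] b unfolding through_def by auto
  ultimately have s: "l + r = l' + r'" by simp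
  have "\<not> min l r < min l' r'"
  proof
    assume m: "min l r < min l' r'"
    then have "min l r + 2 < N" using b s by auto
    then have "through l r (min l r + 2) = through l' r' (min l r + 2)" using b by (intro eq) auto
    then show False using m b unfolding through_def by (auto simp: min_def max_def split: if_splits)
  qed
  moreover have "\<not> min l' r' < min l r"
  proof
    assume m: "min l' r' < min l r"
    then have "min l' r' + 2 < N" using b s by auto
    then have "through l r (min l' r' + 2) = through l' r' (min l' r' + 2)" using b by (intro eq) auto
    then show False using m b unfolding through_def by (auto simp: min_def max_def split: if_splits)
  qed
  ultimately show ?thesis using s by (auto simp: min_def split: if_splits)
qed

text \<open>The cell \<open>u\<close> separates the left run from the right run on the far side of
  the circle.\<close>

lemma runs_exist:
  assumes S: "periodic S" and x: "x \<notin> S" and u: "u \<notin> S" "u \<notin> cell x"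
  shows "\<exists>l r. runs S x l r \<and> l + r + 1 < N"
proof -
  have u': "u + q * N \<notin> S" "u + q * N \<notin> cell x" for q
    using u periodic_shift[OF S] periodic_shift[OF periodic_cell] by auto
  have xN: "x + k * N \<notin> S" for k using x periodic_shift[OF S] by blast
  define l where "l = (LEAST l::nat. x - 1 - int l \<notin> S)"
  define r where "r = (LEAST r::nat. x + 1 + int r \<notin> S)"
  have "x - 1 - int (nat (N - 1)) \<notin> S" using xN[of "-1"] N3 by simp
  then have l: "x - 1 - int l \<notin> S" "\<And>i. i < l \<Longrightarrow> x - 1 - int i \<in> S"
    unfolding l_def by (rule LeastI) (use not_less_Least in blast)
  have "x + 1 + int (nat (N - 1)) \<notin> S" using xN[of 1] N3 by simp
  then have r: "x + 1 + int r \<notin> S" "\<And>i. i < r \<Longrightarrow> x + 1 + int i \<in> S"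
    unfolding r_def by (rule LeastI) (use not_less_Least in blast)
  have L: "z \<in> S" if "x - int l \<le> z" "z < x" for z using l(2)[of "nat (x - 1 - z)"] that by simp
  have R: "z \<in> S" if "x < z" "z \<le> x + int r" for z using r(2)[of "nat (z - x - 1)"] that by simp
  have t: "runs S x (int l) (int r)" unfolding runs_def using L R l(1) r(1) by (auto simp: algebra_simps)
  have "int l + int r + 1 < N"
  proof (rule ccontr)
    assume "\<not> ?thesis"
    then have "u \<in> arc (x - int l) (int l + int r + 1)" by (intro arc_full) simp
    then obtain q where q: "x - int l \<le> u + q * N" "u + q * N < x - int l + (int l + int r + 1)"
      by (rule arcE)
    have "u + q * N \<noteq> x" using u'(2)[of q] unfolding cell_def by auto
    then show False using u'(1)[of q] L[of "u + q * N"] R[of "u + q * N"] q by linarith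
  qed
  then show ?thesis using t by blast
qed

text \<open>Isomorphism before and after the round equates the numbers of new windows of every
  length below \<open>N\<close>, and these numbers determine the type.\<close>

lemma iso_same_type:
  assumes F: "F \<subseteq> range edge" "F' \<subseteq> range edge"
    and i0: "graph_iso (edge_subgraph F) (edge_subgraph F')"
    and i1: "graph_iso (edge_subgraph (insert (edge x) F)) (edge_subgraph (insert (edge y) F'))"
    and x: "x \<notin> cells F" "u \<notin> cells F" "u \<notin> cell x"
    and y: "y \<notin> cells F'" "v \<notin> cells F'" "v \<notin> cell y"
  shows "same_type (cells F) x (cells F') y"
proof -
  have fin: "finite (\<Union>H)" if "H \<subseteq> range edge" for H
  proof (rule finite_subset)
    show "\<Union>H \<subseteq> {..<nat N}"
    proof
      fix v assume "v \<in> \<Union>H"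
      then obtain z where "v \<in> edge z" using \<open>H \<subseteq> range edge\<close> by blast
      then obtain w where "v = vertex w" unfolding edge_def by auto
      then show "v \<in> {..<nat N}" using N3 unfolding vertex_def by simp
    qed
  qed simp
  have same: "card (windows (cells H) j) = card (windows (cells H') j)"
    if h: "graph_iso (edge_subgraph H) (edge_subgraph H')" "H \<subseteq> range edge" "H' \<subseteq> range
      edge" "1 \<le> j" "int j < N"
    for H H' j
  proof -
    have "card (walks H j) = card (walks H' j)"
      using card_walks_le[OF h(1,4) fin[OF h(3)]] card_walks_le[OF graph_iso_sym[OF h(1)] h(4) fin[OF
        h(2)]] by simp
    then show ?thesis using card_walks[OF h(2,4,5)] card_walks[OF h(3,4,5)] by simp
  qed
  obtain l r where t: "runs (cells F) x l r" "l + r + 1 < N" using runs_exist[OF periodic_cells x] by blast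
  obtain l' r' where t': "runs (cells F') y l' r'" "l' + r' + 1 < N"
    using runs_exist[OF periodic_cells y] by blast
  have b: "0 \<le> l" "0 \<le> r" "0 \<le> l'" "0 \<le> r'" using t t' unfolding runs_def by auto
  have "through l r j = through l' r' j" if j: "1 \<le> j" "j < N" for j
  proof -
    define i where "i = nat j"
    have i: "1 \<le> i" "int i < N" "int i = j" using j unfolding i_def by auto
    have "card (windows (cells F \<union> cell x) i) = card (windows (cells F' \<union> cell y) i)"
      using same[OF i1 _ _ i(1,2)] F unfolding cells_insert by simp
    then have "card (windows (cells F) i) + through l r (int i) = card (windows (cells F') i) + through l'
      r' (int i)"
      using card_windows_add[OF periodic_cells x(1) t i(1)] card_windows_add[OF periodic_cells y(1) t'
        i(1)] by simp
    then show ?thesis using same[OF i0 F i(1,2)] i(3) by simp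
  qed
  from through_inj[OF this b t(2) t'(2)]
  show ?thesis using t(1) t'(1) unfolding same_type_def by blast
qed

section \<open>From the type game to the game on edges\<close>

lemma game_length_board:
  assumes G: "edges G = edge ` (- W)" and w: "wins m {} {}"
  shows "game_length G \<le> m"
proof -
  \<comment> \<open>The last conjunct provides the separating cell that \<open>iso_same_type\<close>
    requires for red: a blue cell, or \<open>x + 1\<close> when nothing is colored. For blue, the
    new red cell \<open>x\<close> serves.\<close>
  define Inv where "Inv i A B \<longleftrightarrow> i \<le> m \<and> wins (m - i) (cells A) (cells B) \<and>
    A \<subseteq> edges G \<and> B \<subseteq> edges G \<and> A \<inter> B = {} \<and> (A = {} \<or> B
      \<noteq> {})" for i A B
  have fin: "finite (edges G)"
  proof (rule finite_subset)
    show "edges G \<subseteq> edge ` {0..<N}"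
    proof
      fix e assume "e \<in> edges G"
      then obtain z where "e = edge z" using G by blast
      moreover have "edge z = edge (z mod N)" unfolding edge_eq by simp
      ultimately have "e = edge (z mod N)" by simp
      then show "e \<in> edge ` {0..<N}" using N3 by auto
    qed
  qed simp
  show ?thesis
  proof (rule game_length_le[OF fin, of Inv])
    show "Inv 0 {} {}" unfolding Inv_def cells_def using w by simp
    show "\<not> Inv m A B" for A B unfolding Inv_def by (auto elim: wins.cases)
    fix i A B assume i: "i < m" and I: "Inv i A B"
    have "wins (Suc (m - Suc i)) (cells A) (cells B)" using I i unfolding Inv_def by (simp add: Suc_diff_Suc)
    then obtain x where x: "free (cells A) (cells B) x"
      "\<And>y. free (cells A) (cells B) y \<Longrightarrow> y \<notin> cell x \<Longrightarrow> same_type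
        (cells A) x (cells B) y \<Longrightarrow>
        wins (m - Suc i) (cells A \<union> cell x) (cells B \<union> cell y)"
      by (auto elim: wins.cases)
    have AB: "A \<subseteq> edges G" "B \<subseteq> edges G" "A \<inter> B = {}" "A = {} \<or> B \<noteq>
      {}" using I unfolding Inv_def by auto
    have rng: "A \<subseteq> range edge" "B \<subseteq> range edge" using AB G by auto
    have ExG: "edge x \<in> edges G - (A \<union> B)" using x(1) G unfolding free_def cells_def by auto
    show "\<exists>a\<in>edges G - (A \<union> B). \<forall>b\<in>edges G - insert a (A \<union> B).
        graph_iso (edge_subgraph A) (edge_subgraph B) \<and>
        graph_iso (edge_subgraph (insert a A)) (edge_subgraph (insert b B)) \<longrightarrow>
        Inv (Suc i) (insert a A) (insert b B)"
    proof (intro bexI[OF _ ExG] ballI impI)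
      fix b assume b: "b \<in> edges G - insert (edge x) (A \<union> B)"
        and iso: "graph_iso (edge_subgraph A) (edge_subgraph B) \<and>
          graph_iso (edge_subgraph (insert (edge x) A)) (edge_subgraph (insert b B))"
      obtain y where y: "b = edge y" "y \<notin> W" using b G by auto
      have fy: "free (cells A) (cells B) y" using b y unfolding free_def cells_def by auto
      have yx: "y \<notin> cell x" using b y unfolding edge_cell[symmetric] by auto
      have "\<exists>u. u \<notin> cells A \<and> u \<notin> cell x"
      proof (cases "B = {}")
        case True
        then have "A = {}" using AB by simp
        moreover have "x + 1 \<notin> cell x" using cell_near[of "x + 1" x] N3 by auto
        ultimately show ?thesis unfolding cells_def by blast
      next
        case False
        then obtain z where z: "edge z \<in> B" using rng by blast
        then have "z \<notin> cells A" using AB unfolding cells_def by auto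
        moreover have "z \<notin> cell x" using ExG z unfolding edge_cell[symmetric] by auto
        ultimately show ?thesis by blast
      qed
      then obtain u where u: "u \<notin> cells A" "u \<notin> cell x" by blast
      have "same_type (cells A) x (cells B) y"
      proof (rule iso_same_type[OF rng _ _ _ u])
        show "x \<notin> cells A" "y \<notin> cells B" "x \<notin> cells B" using x(1) fy
          unfolding free_def by auto
        show "x \<notin> cell y" using yx cell_sym by blast
      qed (use iso y in auto)
      then have "wins (m - Suc i) (cells (insert (edge x) A)) (cells (insert b B))"
        using x(2)[OF fy yx] unfolding y(1) cells_insert by simp
      then show "Inv (Suc i) (insert (edge x) A) (insert b B)"
        unfolding Inv_def using AB ExG b i by auto
    qed
  qed
qed

end

section \<open>Numerical bounds\<close>

lemma power_choice:
  assumes "1024 \<le> n"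
  obtains k :: nat where "n + 1 \<le> 2 ^ k" "20 * k + 200 \<le> n" "real k \<le> log 2 (real n) + 1"
proof -
  define k where "k = (LEAST k. n + 1 \<le> (2::nat) ^ k)"
  have "n + 1 \<le> 2 ^ (n + 1)" using less_exp[of "n + 1"] by simp
  then have k: "n + 1 \<le> 2 ^ k" unfolding k_def by (rule LeastI)
  have "10 < k"
  proof (rule ccontr)
    assume "\<not> ?thesis"
    then have "(2::nat) ^ k \<le> 2 ^ 10" by (intro power_increasing) auto
    then show False using k assms by simp
  qed
  then obtain j where j: "k = Suc j" "10 \<le> j" by (cases k) auto
  have "\<not> n + 1 \<le> 2 ^ j" using j unfolding k_def by (metis lessI not_less_Least)
  then have n: "2 ^ j \<le> n" by simp
  have "20 * j + 220 \<le> (2::nat) ^ j" using j(2) by (induction j rule: dec_induct) auto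
  \<comment> \<open>This is \<open>20 * t + 100\<close> for \<open>t = k + 5\<close>, the length
    that \<open>cycle_wins\<close> asks for; the threshold 1024 makes \<open>j\<close> large
    enough.\<close>
  then have "20 * k + 200 \<le> n" using n j by simp
  moreover have "real j \<le> log 2 (real n)"
  proof -
    have "(2::real) ^ j \<le> real n" using n by (metis of_nat_le_iff of_nat_numeral of_nat_power)
    then have "log 2 (2 ^ j) \<le> log 2 (real n)" using assms by (subst log_le_cancel_iff) auto
    then show ?thesis by simp
  qed
  ultimately show ?thesis using that[of k] k j by simp
qed

lemma log_ge_1: "3 \<le> n \<Longrightarrow> 1 \<le> log 2 (real n)"
  by (subst le_log_iff) auto

lemma upper_arith:
  assumes k: "real k \<le> log 2 (real n) + 1" and n: "3 \<le> n"
    and m: "m \<le> nat ((int k + 5 + 1)\<^sup>2) + nat (7 * (int k + 5)) + 40"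
  shows "real m \<le> 512 * (log 2 (real n))\<^sup>2"
proof -
  define L where "L = log 2 (real n)"
  have L: "1 \<le> L" unfolding L_def by (rule log_ge_1[OF n])
  have "nat ((int k + 5 + 1)\<^sup>2) = (k + 6)\<^sup>2"
  proof -
    have e: "int k + 5 + 1 = int (k + 6)" by simp
    show ?thesis unfolding e of_nat_power[symmetric] nat_int ..
  qed
  moreover have "nat (7 * (int k + 5)) = 7 * k + 35" by simp
  ultimately have "m \<le> (k + 6)\<^sup>2 + (7 * k + 35) + 40" using m by simp
  then have "real m \<le> real ((k + 6)\<^sup>2 + (7 * k + 35) + 40)" by (rule of_nat_mono)
  then have "real m \<le> (real k + 6)\<^sup>2 + 7 * real k + 75" by simp
  also have "\<dots> \<le> (L + 7)\<^sup>2 + 7 * (L + 1) + 75"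
  proof -
    have kL: "real k \<le> L + 1" using k unfolding L_def .
    have "(real k + 6)\<^sup>2 \<le> (L + 7)\<^sup>2" by (rule power_mono) (use kL in auto)
    then show ?thesis by (intro add_mono) (use kL in auto)
  qed
  also have "\<dots> = L\<^sup>2 + 21 * L + 131" by (simp add: power2_eq_square algebra_simps)
  also have "\<dots> \<le> L\<^sup>2 + 21 * L\<^sup>2 + 131 * L\<^sup>2"
  proof -
    have "1 * L \<le> L * L" using L by (intro mult_right_mono) auto
    then have "L \<le> L * L" "1 \<le> L * L" using L by linarith+
    then show ?thesis by (simp add: power2_eq_square)
  qed
  also have "\<dots> \<le> 512 * L\<^sup>2" by simp
  finally show ?thesis unfolding L_def .
qed

text \<open>Below the threshold 1024 the trivial bound by half the number of edges suffices. It
  fixes the constant 512, which also exceeds the sum \<open>1 + 21 + 131\<close> from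
  \<open>upper_arith\<close>.\<close>

lemma upper_small:
  assumes "3 \<le> n" "n \<le> 1024" "m \<le> n div 2"
  shows "real m \<le> 512 * (log 2 (real n))\<^sup>2"
proof -
  have "m \<le> 512" using assms by simp
  then have "real m \<le> 512 * 1" by simp
  also have "\<dots> \<le> 512 * (log 2 (real n))\<^sup>2"
    using log_ge_1[OF assms(1)] by (intro mult_left_mono) (auto simp: one_le_power)
  finally show ?thesis .
qed

lemma edges_path_image: "edges (path_graph n) = (\<lambda>i. {i, Suc i}) ` {..<n}"
  by (auto simp: path_graph_def)

lemma edges_cycle_image: "edges (cycle_graph n) = (\<lambda>i. {i, Suc i mod n}) ` {..<n}"
  by (auto simp: cycle_graph_def)

lemma path_upper:
  assumes "odd n" "3 \<le> n"
  shows "real (game_length (path_graph n)) \<le> 512 * (log 2 (real n))\<^sup>2"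
proof (cases "1024 \<le> n")
  case False
  have "game_length (path_graph n) \<le> n div 2"
    using game_length_le_half[of "path_graph n"] unfolding card_edges_path_graph
    by (simp add: edges_path_image)
  then show ?thesis by (intro upper_small) (use assms False in auto)
next
  case True
  then obtain k where k: "n + 1 \<le> 2 ^ k" "20 * k + 200 \<le> n" "real k \<le> log 2 (real n) + 1"
    by (rule power_choice)
  obtain h where h: "n = 2 * h + 1" using assms(1) by (rule oddE)
  define N where "N = 2 * int h + 2"
  define W where "W = {z. z mod N = (-1) mod N}"
  interpret board N W by unfold_locales (use h assms N_def in auto)
  have Wc: "W = cell (-1)" unfolding W_def cell_def ..
  let ?t = "int k + 5"
  have N2: "2 * int h + 2 \<le> 2 ^ k"
  proof -
    have "int (n + 1) \<le> int (2 ^ k)" using k(1) by (rule of_nat_mono)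
    then show ?thesis using h by simp
  qed
  have w: "wins (nat ((?t + 1)\<^sup>2) + nat (3 * ?t) + 10) {} {}"
    by (rule path_wins[OF N_def Wc _ N2]) (use k h in auto)
  have minus1: "(-1) mod N = int n" using h N_def by (simp add: zmod_minus1)
  have Ei: "edge (int i) = {i, Suc i}" if "i < n" for i
  proof -
    have "int i mod N = int i" "(int i + 1) mod N = int (Suc i)" using that h N_def by auto
    then show ?thesis unfolding edge_def vertex_def by (simp only: nat_int)
  qed
  have "edges (path_graph n) = edge ` (- W)"
  proof
    show "edges (path_graph n) \<subseteq> edge ` (- W)"
    proof
      fix e assume "e \<in> edges (path_graph n)"
      then obtain i where i: "i < n" "e = {i, Suc i}" unfolding edges_path_image by auto
      have "e = edge (int i)" using i Ei by simp
      moreover have "int i \<notin> W" using i minus1 h unfolding W_def N_def by simp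
      ultimately show "e \<in> edge ` (- W)" by blast
    qed
    show "edge ` (- W) \<subseteq> edges (path_graph n)"
    proof
      fix e assume "e \<in> edge ` (- W)"
      then obtain z where z: "e = edge z" "z \<notin> W" by blast
      define i where "i = nat (z mod N)"
      have i0: "int i = z mod N" unfolding i_def using N3 by simp
      have "z mod N < N" using N3 by simp
      moreover have "z mod N \<noteq> int n" using z(2) minus1 unfolding W_def by simp
      ultimately have i: "i < n" using i0 h unfolding N_def by linarith
      have "e = edge (int i)" unfolding z(1) edge_eq i0 by simp
      also have "\<dots> = {i, Suc i}" by (rule Ei[OF i])
      finally show "e \<in> edges (path_graph n)" using i unfolding edges_path_image by blast
    qed
  qed
  from game_length_board[OF this w]
  have "game_length (path_graph n) \<le> nat ((?t + 1)\<^sup>2) + nat (7 * ?t) + 40" by simp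
  then show ?thesis by (rule upper_arith[OF k(3) assms(2)])
qed

lemma cycle_upper:
  assumes "odd n" "3 \<le> n"
  shows "real (game_length (cycle_graph n)) \<le> 512 * (log 2 (real n))\<^sup>2"
proof (cases "1024 \<le> n")
  case False
  have "game_length (cycle_graph n) \<le> n div 2"
    using game_length_le_half[of "cycle_graph n"] unfolding card_edges_cycle_graph[OF assms(2)]
    by (simp add: edges_cycle_image)
  then show ?thesis by (intro upper_small) (use assms False in auto)
next
  case True
  then obtain k where k: "n + 1 \<le> 2 ^ k" "20 * k + 200 \<le> n" "real k \<le> log 2 (real n) + 1"
    by (rule power_choice)
  define W where "W = ({} :: int set)"
  interpret board "int n" W by unfold_locales (use assms in auto)
  let ?t = "int k + 5"
  have N2: "int n \<le> 2 ^ k" using k(1) by simp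
  have w: "wins (nat ((?t + 1)\<^sup>2) + nat (7 * ?t) + 40) {} {}"
    by (rule cycle_wins[OF W_def _ _ N2]) (use k assms in auto)
  have Ei: "edge (int i) = {i, Suc i mod n}" if "i < n" for i
  proof -
    have "(int i + 1) mod int n = int (Suc i mod n)" by (simp add: zmod_int add.commute)
    then show ?thesis using that unfolding edge_def vertex_def by simp
  qed
  have "edges (cycle_graph n) = edge ` (- W)"
  proof
    show "edges (cycle_graph n) \<subseteq> edge ` (- W)"
      unfolding edges_cycle_image W_def using Ei by fastforce
    show "edge ` (- W) \<subseteq> edges (cycle_graph n)"
    proof
      fix e assume "e \<in> edge ` (- W)"
      then obtain z where z: "e = edge z" by blast
      define i where "i = nat (z mod int n)"
      have i0: "int i = z mod int n" unfolding i_def using N3 by simp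
      have "z mod int n < int n" using N3 by simp
      then have i: "i < n" using i0 by linarith
      have "e = edge (int i)" unfolding z(1) edge_eq i0 by simp
      then show "e \<in> edges (cycle_graph n)" using i Ei unfolding edges_cycle_image by auto
    qed
  qed
  from game_length_board[OF this w]
  show ?thesis by (rule upper_arith[OF k(3) assms(2)])
qed

section \<open>The theorem\<close>

lemma graph_iso_single:
  assumes "card e = 2" "card e' = 2"
  shows "graph_iso (edge_subgraph {e}) (edge_subgraph {e'})"
proof -
  obtain a b where e: "e = {a, b}" "a \<noteq> b" using assms(1) unfolding card_2_iff by blast
  obtain c d where e': "e' = {c, d}" "c \<noteq> d" using assms(2) unfolding card_2_iff by blast
  let ?f = "\<lambda>v. if v = a then c else d"
  have bij: "bij_betw ?f {a, b} {c, d}"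
    unfolding bij_betw_def inj_on_def using e(2) e'(2) by (simp add: insert_commute)
  have iff: "{u, v} = {a, b} \<longleftrightarrow> {?f u, ?f v} = {c, d}"
    if "u \<in> {a, b}" "v \<in> {a, b}" for u v
    using that e(2) e'(2) unfolding doubleton_eq_iff by auto
  show ?thesis
    unfolding graph_iso_def edge_subgraph_def graph.select_convs
  proof (intro exI[of _ ?f] conjI ballI)
    show "bij_betw ?f (\<Union>{e}) (\<Union>{e'})" using bij e(1) e'(1) by simp
    show "{u, v} \<in> {e} \<longleftrightarrow> {?f u, ?f v} \<in> {e'}"
      if "u \<in> \<Union>{e}" "v \<in> \<Union>{e}" for u v
      unfolding e(1) e'(1) singleton_iff by (rule iff) (use that e(1) in simp_all)
  qed
qed

text \<open>Single edges are always isomorphic. The first round has to be counted separately because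
  the bound by powers of 3 gives nothing for small \<open>n\<close>, where the logarithm is already
  positive.\<close>

lemma game_length_pos:
  assumes fin: "finite (edges G)" and two: "\<And>e. e \<in> edges G \<Longrightarrow> card e = 2" and m:
    "2 \<le> card (edges G)"
  shows "1 \<le> game_length G"
proof (rule game_length_ge[OF fin, where Inv = "\<lambda>i A B. i = 0 \<and> A = {} \<and> B = {} \<or>
    (\<exists>a\<in>edges G. \<exists>b\<in>edges G. A = {a} \<and> B = {b})"])
  show "1 \<le> card (edges G) div 2" using m by simp
  fix i :: nat and A B :: "'a set set" and a :: "'a set"
  assume "i < 1" and I: "i = 0 \<and> A = {} \<and> B = {} \<or> (\<exists>a\<in>edges G.
    \<exists>b\<in>edges G. A = {a} \<and> B = {b})"
    and a: "a \<in> edges G - (A \<union> B)" and "card A = i"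
  then have AB: "A = {}" "B = {}" by auto
  have "edges G \<noteq> {a}" using m by auto
  then obtain b where "b \<in> edges G" "b \<noteq> a" using a by blast
  then show "\<exists>b\<in>edges G - insert a (A \<union> B). Suc i = 0 \<and> insert a A = {} \<and>
    insert b B = {} \<or>
      (\<exists>a'\<in>edges G. \<exists>b'\<in>edges G. insert a A = {a'} \<and> insert b B = {b'})"
    unfolding AB using a by blast
next
  fix i :: nat and A B :: "'a set set"
  assume "i = 0 \<and> A = {} \<and> B = {} \<or> (\<exists>a\<in>edges G. \<exists>b\<in>edges G. A = {a}
    \<and> B = {b})"
  then show "graph_iso (edge_subgraph A) (edge_subgraph B)"
  proof
    assume "i = 0 \<and> A = {} \<and> B = {}"
    then show ?thesis by (auto simp: graph_iso_def edge_subgraph_def bij_betw_def)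
  next
    assume "\<exists>a\<in>edges G. \<exists>b\<in>edges G. A = {a} \<and> B = {b}"
    then show ?thesis using graph_iso_single two by blast
  qed
qed simp

text \<open>From \<open>n \<le> 3 ^ (L + 2) \<le> 4 ^ (L + 2)\<close> the logarithm is at most
  \<open>2 * L + 4\<close>, which is at most \<open>6 * L\<close> because of
  \<open>1 \<le> L\<close>; this yields the constant \<open>1 / 6\<close>.\<close>

lemma lower_arith:
  assumes n: "3 \<le> n" and L: "1 \<le> L" "\<And>k. 3 ^ (k + 1) < n \<Longrightarrow> k \<le> L"
  shows "1 / 6 * log 2 (real n) \<le> real L"
proof -
  have "\<not> 3 ^ (L + 1 + 1) < n" using L(2)[of "L + 1"] by auto
  then have "n \<le> 3 ^ (L + 2)" by simp
  also have "\<dots> \<le> 4 ^ (L + 2)" by (rule power_mono) auto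
  also have "\<dots> = 2 ^ (2 * (L + 2))" unfolding power_mult by simp
  finally have "real n \<le> real (2 ^ (2 * (L + 2)))" by (rule of_nat_mono)
  then have "log 2 (real n) \<le> log 2 (2 ^ (2 * (L + 2)))" using n by (subst log_le_cancel_iff) auto
  also have "\<dots> = real (2 * (L + 2))" by (rule log_pow_cancel) auto
  finally show ?thesis using L(1) by simp
qed

theorem theorem3p1:
  "\<exists>c::real. \<exists>C::real. c > 0 \<and> C > 0 \<and>
     (\<forall>n::nat. odd n \<longrightarrow>
        c * log 2 (real n) \<le> real (game_length (path_graph n)) \<and>
        real (game_length (path_graph n)) \<le> C * (log 2 (real n))\<^sup>2) \<and>
     (\<forall>n::nat. odd n \<and> n \<ge> 3 \<longrightarrow>
        c * log 2 (real n) \<le> real (game_length (cycle_graph n)) \<and>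
        real (game_length (cycle_graph n)) \<le> C * (log 2 (real n))\<^sup>2)"
proof (rule exI[of _ "1 / 6"], rule exI[of _ 512], intro conjI allI impI)
  fix n :: nat assume odd: "odd n"
  have "n = 1 \<or> 3 \<le> n" using odd by presburger
  then consider "n = 1" | "3 \<le> n" by blast
  then have "1 / 6 * log 2 (real n) \<le> real (game_length (path_graph n)) \<and>
      real (game_length (path_graph n)) \<le> 512 * (log 2 (real n))\<^sup>2"
  proof cases
    case 1
    \<comment> \<open>With a single edge no full round is played, and the logarithm is 0 as
      well.\<close>
    have "game_length (path_graph 1) \<le> 0"
      using game_length_le_half[of "path_graph 1"] unfolding card_edges_path_graph
      by (simp add: edges_path_image)
    then show ?thesis using 1 by simp
  next
    case 2
    have "1 \<le> game_length (path_graph n)"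
    proof (rule game_length_pos)
      show "finite (edges (path_graph n))" by (simp add: edges_path_image)
      show "card e = 2" if "e \<in> edges (path_graph n)" for e
        using that finite_simple_path_graph[of n] unfolding finite_simple_graph_def by blast
    qed (use 2 card_edges_path_graph[of n] in simp)
    from lower_arith[OF 2 this path_lower] path_upper[OF odd 2] show ?thesis by blast
  qed
  then show "1 / 6 * log 2 (real n) \<le> real (game_length (path_graph n))"
    "real (game_length (path_graph n)) \<le> 512 * (log 2 (real n))\<^sup>2" by auto
next
  fix n :: nat assume n: "odd n \<and> 3 \<le> n"
  have "1 \<le> game_length (cycle_graph n)"
  proof (rule game_length_pos)
    show "finite (edges (cycle_graph n))" by (simp add: edges_cycle_image)
    show "card e = 2" if "e \<in> edges (cycle_graph n)" for e
      using that finite_simple_cycle_graph[of n] n unfolding finite_simple_graph_def by blast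
  qed (use n card_edges_cycle_graph[of n] in simp)
  then show "1 / 6 * log 2 (real n) \<le> real (game_length (cycle_graph n))"
    using n cycle_lower by (intro lower_arith) auto
  show "real (game_length (cycle_graph n)) \<le> 512 * (log 2 (real n))\<^sup>2"
    using cycle_upper n by blast
qed simp_all

end
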